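(* Let $X$ be a hyperkähler variety of $K3^{[2]}$-type, $r=b_2(X)=23$, endowed with a lift $L\in\mathrm{CH}^2(X\times X)$ of the Beauville–Bogomolov class $\mathfrak{B}$, and let $l=\Delta^*L\in\mathrm{CH}^2(X)$. Assume $$L^2=2\Delta-\frac{2}{r+2}L(l_1+l_2)-\frac{1}{r(r+2)}(2l_1^2-rl_1l_2+2l_2^2)\quad\text{in }\mathrm{CH}^4(X\times X),$$ $$L_*(l^2)=0,\qquad L_*(l\cdot L_*(\sigma))=(r+2)L_*(\sigma)\ \text{ for all }\sigma\in\mathrm{CH}^4(X),$$ $$(L^2)_*(l\cdot(L^2)_*(\tau))=0\ \text{ for all }\tau\in\mathrm{CH}^2(X).$$ Let $$H := \frac{4}{r(r+2)}(l_2^2-l_1^2)+\frac{2}{r+2}L(l_2-l_1)\in\mathrm{CH}^4(X\times X)$$ and let $\mathrm{CH}^i(X)_s\subseteq\mathrm{CH}^i(X)$ be the eigenspace of $H_*$ for the eigenvalue $2i-4-s$. Then the eigenspace decomposition of $H_*$, $$\mathrm{CH}^0=\mathrm{CH}^0_0,\ \ \mathrm{CH}^1=\mathrm{CH}^1_0,\ \ \mathrm{CH}^2=\mathrm{CH}^2_0\oplus\mathrm{CH}^2_2,\ \ \mathrm{CH}^3=\mathrm{CH}^3_0\oplus\mathrm{CH}^3_2,\ \ \mathrm{CH}^4=\mathrm{CH}^4_0\oplus\mathrm{CH}^4_2\oplus\mathrm{CH}^4_4$$ (writing $\mathrm{CH}^i_s=\mathrm{CH}^i(X)_s$), agrees with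 the Fourier decomposition: for each pair $(i,s)$ occurring here, $$\mathrm{CH}^i(X)_s={}^{e^L}\mathrm{CH}^i(X)_s,$$ where ${}^{e^L}\mathrm{CH}^i(X)_s:=\{Z\in\mathrm{CH}^i(X):(e^L)_*(Z)\in\mathrm{CH}^{4-i+s}(X)\}$ and $e^L=[X\times X]+L+\frac12L^2+\frac16L^3+\frac1{24}L^4$.
   Context: All Chow groups have $\mathbb{Q}$-coefficients. A hyperkähler variety of $K3^{[2]}$-type is a smooth projective irreducible holomorphic symplectic variety over $\mathbb{C}$ deformation equivalent to the Hilbert scheme of two points of a $K3$ surface (dimension $4$). $(-,-)$ is the Beauville–Bogomolov form on $H^2(X,\mathbb{Q})$, normalized by $\int_X\alpha^4=3(\alpha,\alpha)^2$. The Beauville–Bogomolov class is $\mathfrak{B}=\sum_{i=1}^re_i\otimes e_i\in H^4(X\times X,\mathbb{Q})$, for an orthonormal basis $(e_i)$ of $H^2(X,\mathbb{C})$; a lift of $\mathfrak{B}$ is a cycle class whose cohomology class is $\mathfrak{B}$. $\Delta$ denotes both the diagonal embedding $X\to X\times X$ and the class of the diagonal. For a class $Z$ on $X$, $Z_1,Z_2$ are its pullbacks to $X\times X$ along the two projections $p_1,p_2$. Correspondences act by $\Gamma_*(Z)=(p_2)_*(\Gamma\cdot p_1^*Z)$. Under the stated assumptions, Shen and Vial proved that the displayed decomposition holds with $\mathrm{CH}^i(X)_s$ replaced by ${}^{e^L}\mathrm{CH}^i(X)_s$ (the Fourier decomposition). *)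

theory Defs
  imports
    "HOL-Complex_Analysis.Complex_Analysis"
    "HOL-Homology.Homology"
    "HOL-Algebra.Ideal"
    "HOL-Library.Poly_Mapping"
    "HOL-Library.Nat_Bijection"
begin

section \<open>Complex projective varieties\<close>

text \<open>
  A point of complex projective space is represented by its unique homogeneous coordinate
  vector whose first nonzero entry is 1.  All projective spaces live in the
  one type of sequences: a point of \<open>P\<^sup>N\<close> has vanishing coordinates beyond \<open>N\<close>.  This lets the
  product of two varieties (via the Segre embedding) be again a set of points of the same type.
  Regular functions and morphisms are given by homogeneous polynomials, so
  the choice of representative is immaterial.
\<close>

type_synonym pt = "nat \<Rightarrow> complex"
type_synonym mpoly = "(nat \<Rightarrow>\<^sub>0 nat) \<Rightarrow>\<^sub>0 complex"

definition nrm :: "(nat \<Rightarrow> complex) \<Rightarrow> pt" where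
  "nrm v = (\<lambda>i. v i / v (LEAST j. v j \<noteq> 0))"

definition proj_space :: "nat \<Rightarrow> pt set" where
  "proj_space N = {x. (\<forall>i>N. x i = 0) \<and> (\<exists>i\<le>N. x i = 1 \<and> (\<forall>j<i. x j = 0))}"

definition peval :: "mpoly \<Rightarrow> (nat \<Rightarrow> complex) \<Rightarrow> complex" where
  "peval p x = (\<Sum>m\<in>Poly_Mapping.keys p. Poly_Mapping.lookup p m *
     (\<Prod>i\<in>Poly_Mapping.keys m. x i ^ Poly_Mapping.lookup m i))"

definition homogeneous :: "nat \<Rightarrow> mpoly \<Rightarrow> bool" where
  "homogeneous d p \<longleftrightarrow>
     (\<forall>m\<in>Poly_Mapping.keys p. (\<Sum>i\<in>Poly_Mapping.keys m. Poly_Mapping.lookup m i) = d)"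

definition zclosed :: "pt set \<Rightarrow> bool" where
  "zclosed V \<longleftrightarrow> (\<exists>N F. (\<forall>p\<in>F. \<exists>d. homogeneous d p) \<and>
     V = {x \<in> proj_space N. \<forall>p\<in>F. peval p x = 0})"

definition zopenin :: "pt set \<Rightarrow> pt set \<Rightarrow> bool" where
  "zopenin W U \<longleftrightarrow> U \<subseteq> W \<and> zclosed (W - U)"

definition variety :: "pt set \<Rightarrow> bool" where
  "variety V \<longleftrightarrow> zclosed V \<and> V \<noteq> {} \<and>
     (\<forall>A B. zclosed A \<and> zclosed B \<and> V = A \<union> B \<longrightarrow> V = A \<or> V = B)"

definition subvariety :: "pt set \<Rightarrow> pt set \<Rightarrow> bool" where
  "subvariety V X \<longleftrightarrow> variety V \<and> V \<subseteq> X"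

definition zclosure :: "pt set \<Rightarrow> pt set" where
  "zclosure A = \<Inter>{V. zclosed V \<and> A \<subseteq> V}"

definition zdim :: "pt set \<Rightarrow> enat" where
  "zdim V = Sup {enat n | n. \<exists>C :: nat \<Rightarrow> pt set.
     (\<forall>i\<le>n. subvariety (C i) V) \<and> (\<forall>i<n. C i \<subset> C (Suc i))}"

definition components :: "pt set \<Rightarrow> pt set set" where
  "components A = {W. subvariety W A \<and> (\<forall>W'. subvariety W' A \<and> W \<subseteq> W' \<longrightarrow> W' = W)}"

text \<open>
  The Zariski tangent space of the affine cone over \<open>V\<close> at the vector \<open>x\<close>.  It contains the line
  spanned by \<open>x\<close>, the quotient by which is the tangent space of \<open>V\<close> at the point \<open>x\<close> (up to a twist),
  whence the \<open>+ 1\<close> in the definition of smoothness.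
\<close>

definition tangent_cone_space :: "pt set \<Rightarrow> pt \<Rightarrow> (nat \<Rightarrow> complex) set" where
  "tangent_cone_space V x = {v. \<forall>p. (\<exists>d. homogeneous d p) \<and> (\<forall>y\<in>V. peval p y = 0) \<longrightarrow>
     ((\<lambda>t. peval p (\<lambda>i. x i + t * v i)) has_field_derivative 0) (at 0)}"

definition has_cdim :: "(nat \<Rightarrow> complex) set \<Rightarrow> nat \<Rightarrow> bool" where
  "has_cdim T n \<longleftrightarrow> (\<exists>b :: nat \<Rightarrow> nat \<Rightarrow> complex.
     bij_betw (\<lambda>c i. \<Sum>k<n. c k * b k i) {c. \<forall>k\<ge>n. c k = 0} T)"

definition smooth_at :: "pt set \<Rightarrow> pt \<Rightarrow> bool" where
  "smooth_at V x \<longleftrightarrow> x \<in> V \<and> (\<exists>n. zdim V = enat n \<and> has_cdim (tangent_cone_space V x) (n + 1))"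

definition smooth_projective :: "pt set \<Rightarrow> bool" where
  "smooth_projective X \<longleftrightarrow> variety X \<and> (\<forall>x\<in>X. smooth_at X x)"

definition morphism :: "pt set \<Rightarrow> pt set \<Rightarrow> (pt \<Rightarrow> pt) \<Rightarrow> bool" where
  "morphism X Y f \<longleftrightarrow> f ` X \<subseteq> Y \<and>
     (\<forall>x\<in>X. \<exists>U d (G :: nat \<Rightarrow> mpoly). zopenin X U \<and> x \<in> U \<and> (\<forall>i. homogeneous d (G i)) \<and>
        (\<forall>y\<in>U. (\<exists>i. peval (G i) y \<noteq> 0) \<and> f y = nrm (\<lambda>i. peval (G i) y)))"

subsection \<open>Products\<close>

text \<open>The Segre map.  The pair of leading indices of two normalised vectors has the least code of
  all pairs of indices of nonzero coordinates, so that the image is again normalised.\<close>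

definition segre :: "pt \<Rightarrow> pt \<Rightarrow> pt" where
  "segre x y = (\<lambda>k. case prod_decode k of (i, j) \<Rightarrow> x i * y j)"

definition pprod :: "pt set \<Rightarrow> pt set \<Rightarrow> pt set"  (infixr "\<boxtimes>" 80) where
  "X \<boxtimes> Y = {segre x y | x y. x \<in> X \<and> y \<in> Y}"

definition pr1 :: "pt set \<Rightarrow> pt set \<Rightarrow> pt \<Rightarrow> pt" where
  "pr1 X Y z = fst (inv_into (X \<times> Y) (\<lambda>(x, y). segre x y) z)"

definition pr2 :: "pt set \<Rightarrow> pt set \<Rightarrow> pt \<Rightarrow> pt" where
  "pr2 X Y z = snd (inv_into (X \<times> Y) (\<lambda>(x, y). segre x y) z)"

definition graph :: "pt set \<Rightarrow> (pt \<Rightarrow> pt) \<Rightarrow> pt set" where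
  "graph X f = {segre x (f x) | x. x \<in> X}"

abbreviation diag :: "pt \<Rightarrow> pt" where
  "diag x \<equiv> segre x x"


section \<open>Chow groups with rational coefficients\<close>

type_synonym cyc = "pt set \<Rightarrow>\<^sub>0 rat"
type_synonym cls = "cyc set"

subsection \<open>Orders of vanishing of rational functions\<close>

definition regular_on :: "pt set \<Rightarrow> pt set \<Rightarrow> (pt \<Rightarrow> complex) \<Rightarrow> bool" where
  "regular_on W U f \<longleftrightarrow> (\<forall>x\<in>U. \<exists>U' p q d. zopenin W U' \<and> x \<in> U' \<and> U' \<subseteq> U \<and>
     homogeneous d p \<and> homogeneous d q \<and> (\<forall>y\<in>U'. peval q y \<noteq> 0 \<and> f y = peval p y / peval q y))"

text \<open>Regular functions on open subsets of \<open>W\<close> meeting \<open>V\<close>; their germs form the local ring of \<open>W\<close>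
  along \<open>V\<close>, which for \<open>V = W\<close> is the function field of \<open>W\<close>.\<close>

definition local_sections :: "pt set \<Rightarrow> pt set \<Rightarrow> (pt set \<times> (pt \<Rightarrow> complex)) set" where
  "local_sections W V = {(U, f). zopenin W U \<and> U \<inter> V \<noteq> {} \<and> regular_on W U f}"

definition germ :: "pt set \<Rightarrow> pt set \<Rightarrow> pt set \<times> (pt \<Rightarrow> complex) \<Rightarrow> (pt set \<times> (pt \<Rightarrow> complex)) set" where
  "germ W V s = {s' \<in> local_sections W V. \<forall>x \<in> fst s \<inter> fst s'. snd s' x = snd s x}"

definition local_ring :: "pt set \<Rightarrow> pt set \<Rightarrow> (pt set \<times> (pt \<Rightarrow> complex)) set ring" where
  "local_ring W V = \<lparr>
     carrier = germ W V ` local_sections W V,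
     mult = (\<lambda>a b. \<Union>s\<in>a. \<Union>t\<in>b. germ W V (fst s \<inter> fst t, \<lambda>x. snd s x * snd t x)),
     one = germ W V (W, \<lambda>_. 1),
     zero = germ W V (W, \<lambda>_. 0),
     add = (\<lambda>a b. \<Union>s\<in>a. \<Union>t\<in>b. germ W V (fst s \<inter> fst t, \<lambda>x. snd s x + snd t x)) \<rparr>"

definition quotient_length :: "('a, 'b) ring_scheme \<Rightarrow> 'a \<Rightarrow> nat" where
  "quotient_length R a = Sup {n. \<exists>J :: nat \<Rightarrow> 'a set. J 0 = PIdl\<^bsub>R\<^esub> a \<and>
     (\<forall>i\<le>n. ideal (J i) R) \<and> (\<forall>i<n. J i \<subset> J (Suc i))}"

definition ord_along :: "pt set \<Rightarrow> pt set \<Rightarrow> pt set \<times> (pt \<Rightarrow> complex) \<Rightarrow> int" where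
  "ord_along W V f = (THE k. \<exists>a\<in>local_sections W V. \<exists>b\<in>local_sections W V.
     germ W V b \<noteq> \<zero>\<^bsub>local_ring W V\<^esub> \<and>
     (\<forall>x \<in> fst f \<inter> fst a \<inter> fst b. snd a x = snd f x * snd b x) \<and>
     k = int (quotient_length (local_ring W V) (germ W V a))
         - int (quotient_length (local_ring W V) (germ W V b)))"

subsection \<open>Rational equivalence and Chow groups\<close>

definition cycles :: "pt set \<Rightarrow> cyc set" where
  "cycles X = {z. \<forall>V\<in>Poly_Mapping.keys z. subvariety V X}"

definition smul :: "rat \<Rightarrow> cyc \<Rightarrow> cyc" where
  "smul q z = Poly_Mapping.map (\<lambda>a. q * a) z"

abbreviation prime_cycle :: "pt set \<Rightarrow> cyc" where
  "prime_cycle V \<equiv> Poly_Mapping.single V 1"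

definition principal_cycles :: "pt set \<Rightarrow> cyc set" where
  "principal_cycles X = {z. \<exists>W f. subvariety W X \<and> f \<in> local_sections W W \<and>
     (\<exists>x\<in>fst f. snd f x \<noteq> 0) \<and>
     (\<forall>V. Poly_Mapping.lookup z V =
        (if subvariety V W \<and> zdim V + 1 = zdim W then of_int (ord_along W V f) else 0))}"

inductive_set rat_equiv_zero :: "pt set \<Rightarrow> cyc set" for X where
  zero: "0 \<in> rat_equiv_zero X"
| step: "z \<in> rat_equiv_zero X \<Longrightarrow> w \<in> principal_cycles X \<Longrightarrow> z + smul q w \<in> rat_equiv_zero X"

text \<open>A cycle class is a coset of the space of cycles rationally equivalent to zero.
  \<open>Chow X i\<close> is \<open>CH\<^sup>i(X)\<close>, seen inside the total Chow group \<open>Chow_total X\<close>.\<close>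

definition cls :: "pt set \<Rightarrow> cyc \<Rightarrow> cls" where
  "cls X z = {w. w - z \<in> rat_equiv_zero X}"

definition Chow_total :: "pt set \<Rightarrow> cls set" where
  "Chow_total X = cls X ` cycles X"

definition Chow :: "pt set \<Rightarrow> nat \<Rightarrow> cls set" where
  "Chow X i = cls X ` {z \<in> cycles X. \<forall>V\<in>Poly_Mapping.keys z. zdim V + enat i = zdim X}"

definition fund :: "pt set \<Rightarrow> cls" where
  "fund X = cls X (prime_cycle X)"

text \<open>The vector space operations on cosets.  Differences of elements of a coset run
  through the underlying subspace, which makes the scalar multiple correct also for the scalar 0.\<close>

definition cadd :: "cls \<Rightarrow> cls \<Rightarrow> cls"  (infixl "+\<^sub>C" 65) where
  "a +\<^sub>C b = {u + v | u v. u \<in> a \<and> v \<in> b}"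

definition csub :: "cls \<Rightarrow> cls \<Rightarrow> cls"  (infixl "-\<^sub>C" 65) where
  "a -\<^sub>C b = {u - v | u v. u \<in> a \<and> v \<in> b}"

definition cscale :: "rat \<Rightarrow> cls \<Rightarrow> cls"  (infixr "*\<^sub>C" 75) where
  "q *\<^sub>C a = {smul q u + (v - w) | u v w. u \<in> a \<and> v \<in> a \<and> w \<in> a}"

definition czero :: "pt set \<Rightarrow> cls" where
  "czero X = cls X 0"

subsection \<open>Proper push-forward\<close>

text \<open>The degree of a generically finite map between complex varieties, as the number of points in
  a general fibre.\<close>

definition map_degree :: "(pt \<Rightarrow> pt) \<Rightarrow> pt set \<Rightarrow> nat" where
  "map_degree f V = (THE n. \<exists>U. zopenin (f ` V) U \<and> U \<noteq> {} \<and>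
     (\<forall>y\<in>U. finite {x \<in> V. f x = y} \<and> card {x \<in> V. f x = y} = n))"

definition push_prime :: "(pt \<Rightarrow> pt) \<Rightarrow> pt set \<Rightarrow> cyc" where
  "push_prime f V =
     (if zdim (f ` V) = zdim V then Poly_Mapping.single (f ` V) (of_nat (map_degree f V)) else 0)"

definition push_cyc :: "(pt \<Rightarrow> pt) \<Rightarrow> cyc \<Rightarrow> cyc" where
  "push_cyc f z = (\<Sum>V\<in>Poly_Mapping.keys z. smul (Poly_Mapping.lookup z V) (push_prime f V))"

text \<open>The operation on classes is the one on representatives; the union
  is over equal classes, since push-forward respects rational equivalence.\<close>

definition push :: "pt set \<Rightarrow> (pt \<Rightarrow> pt) \<Rightarrow> cls \<Rightarrow> cls" where
  "push Y f a = (\<Union>z\<in>a. cls Y (push_cyc f z))"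

subsection \<open>Intersection products\<close>

definition generically_transverse :: "pt set \<Rightarrow> pt set \<Rightarrow> pt set \<Rightarrow> bool" where
  "generically_transverse X A B \<longleftrightarrow> (\<forall>W\<in>components (A \<inter> B). \<exists>x\<in>W.
     smooth_at X x \<and> smooth_at A x \<and> smooth_at B x \<and>
     {u. \<exists>v\<in>tangent_cone_space A x. \<exists>w\<in>tangent_cone_space B x. u = (\<lambda>i. v i + w i)}
       = tangent_cone_space X x)"

text \<open>Pull-back along \<open>f : X \<rightarrow> Y\<close> with respect to an intersection product \<open>dot\<close>:
  \<open>f\<^sup>*[Z] = p\<^sub>1\<^sub>*([\<Gamma>\<^sub>f] \<cdot> [X \<times> Z])\<close>.\<close>

definition cross_cyc :: "pt set \<Rightarrow> cyc \<Rightarrow> cyc" where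
  "cross_cyc X z = (\<Sum>V\<in>Poly_Mapping.keys z. Poly_Mapping.single (X \<boxtimes> V) (Poly_Mapping.lookup z V))"

definition pull :: "(pt set \<Rightarrow> cls \<Rightarrow> cls \<Rightarrow> cls) \<Rightarrow> pt set \<Rightarrow> pt set \<Rightarrow> (pt \<Rightarrow> pt) \<Rightarrow> cls \<Rightarrow> cls" where
  "pull dot X Y f a = (\<Union>z\<in>a. push X (pr1 X Y)
     (dot (X \<boxtimes> Y) (cls (X \<boxtimes> Y) (prime_cycle (graph X f))) (cls (X \<boxtimes> Y) (cross_cyc X z))))"

text \<open>
  The intersection product on the Chow groups of smooth projective varieties, through its
  characterisation (Hartshorne, Algebraic Geometry, Appendix A, Theorem 1.1; Eisenbud and Harris, 3264 and
  All That, Theorems 1.5 and 1.23; Fulton, Intersection Theory, Chapter 8).  By the moving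
  lemma, bilinearity and \<open>transverse\<close> alone determine \<open>dot X a b\<close> for smooth
  projective \<open>X\<close> and classes \<open>a\<close>, \<open>b\<close> on \<open>X\<close>.  Thus, up to irrelevant values elsewhere, there is
  exactly one \<open>dot\<close> satisfying this locale; the other clauses are the standard
  properties of this product.
\<close>

locale intersection_theory =
  fixes dot :: "pt set \<Rightarrow> cls \<Rightarrow> cls \<Rightarrow> cls"
  assumes smooth_pprod: "smooth_projective X \<Longrightarrow> smooth_projective Y \<Longrightarrow> smooth_projective (X \<boxtimes> Y)"
    and dot_closed: "smooth_projective X \<Longrightarrow> a \<in> Chow_total X \<Longrightarrow> b \<in> Chow_total X \<Longrightarrow>
      dot X a b \<in> Chow_total X"
    and dot_graded: "smooth_projective X \<Longrightarrow> a \<in> Chow X i \<Longrightarrow> b \<in> Chow X j \<Longrightarrow> dot X a b \<in> Chow X (i + j)"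
    and dot_add: "smooth_projective X \<Longrightarrow> a \<in> Chow_total X \<Longrightarrow> b \<in> Chow_total X \<Longrightarrow>
      c \<in> Chow_total X \<Longrightarrow> dot X (a +\<^sub>C b) c = dot X a c +\<^sub>C dot X b c"
    and dot_scale: "smooth_projective X \<Longrightarrow> a \<in> Chow_total X \<Longrightarrow> b \<in> Chow_total X \<Longrightarrow>
      dot X (q *\<^sub>C a) b = q *\<^sub>C dot X a b"
    and dot_commute: "smooth_projective X \<Longrightarrow> a \<in> Chow_total X \<Longrightarrow> b \<in> Chow_total X \<Longrightarrow>
      dot X a b = dot X b a"
    and dot_assoc: "smooth_projective X \<Longrightarrow> a \<in> Chow_total X \<Longrightarrow> b \<in> Chow_total X \<Longrightarrow>
      c \<in> Chow_total X \<Longrightarrow> dot X (dot X a b) c = dot X a (dot X b c)"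
    and dot_fund: "smooth_projective X \<Longrightarrow> a \<in> Chow_total X \<Longrightarrow> dot X (fund X) a = a"
    and transverse: "smooth_projective X \<Longrightarrow> subvariety A X \<Longrightarrow> subvariety B X \<Longrightarrow>
      generically_transverse X A B \<Longrightarrow>
      dot X (cls X (prime_cycle A)) (cls X (prime_cycle B)) = cls X (\<Sum>W\<in>components (A \<inter> B). prime_cycle W)"
    and push_rat_equiv: "smooth_projective X \<Longrightarrow> smooth_projective Y \<Longrightarrow> morphism X Y f \<Longrightarrow>
      z \<in> rat_equiv_zero X \<Longrightarrow> push_cyc f z \<in> rat_equiv_zero Y"
    and push_comp: "smooth_projective X \<Longrightarrow> smooth_projective Y \<Longrightarrow> smooth_projective Z \<Longrightarrow>
      morphism X Y f \<Longrightarrow> morphism Y Z g \<Longrightarrow> a \<in> Chow_total X \<Longrightarrow>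
      push Z (g \<circ> f) a = push Z g (push Y f a)"
    and pull_graded: "smooth_projective X \<Longrightarrow> smooth_projective Y \<Longrightarrow> morphism X Y f \<Longrightarrow>
      a \<in> Chow Y i \<Longrightarrow> pull dot X Y f a \<in> Chow X i"
    and pull_add: "smooth_projective X \<Longrightarrow> smooth_projective Y \<Longrightarrow> morphism X Y f \<Longrightarrow>
      a \<in> Chow_total Y \<Longrightarrow> b \<in> Chow_total Y \<Longrightarrow>
      pull dot X Y f (a +\<^sub>C b) = pull dot X Y f a +\<^sub>C pull dot X Y f b"
    and pull_scale: "smooth_projective X \<Longrightarrow> smooth_projective Y \<Longrightarrow> morphism X Y f \<Longrightarrow>
      a \<in> Chow_total Y \<Longrightarrow> pull dot X Y f (q *\<^sub>C a) = q *\<^sub>C pull dot X Y f a"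
    and pull_dot: "smooth_projective X \<Longrightarrow> smooth_projective Y \<Longrightarrow> morphism X Y f \<Longrightarrow>
      a \<in> Chow_total Y \<Longrightarrow> b \<in> Chow_total Y \<Longrightarrow>
      pull dot X Y f (dot Y a b) = dot X (pull dot X Y f a) (pull dot X Y f b)"
    and pull_fund: "smooth_projective X \<Longrightarrow> smooth_projective Y \<Longrightarrow> morphism X Y f \<Longrightarrow>
      pull dot X Y f (fund Y) = fund X"
    and pull_id: "smooth_projective X \<Longrightarrow> a \<in> Chow_total X \<Longrightarrow> pull dot X X id a = a"
    and pull_comp: "smooth_projective X \<Longrightarrow> smooth_projective Y \<Longrightarrow> smooth_projective Z \<Longrightarrow>
      morphism X Y f \<Longrightarrow> morphism Y Z g \<Longrightarrow> a \<in> Chow_total Z \<Longrightarrow>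
      pull dot X Z (g \<circ> f) a = pull dot X Y f (pull dot Y Z g a)"
    and pull_pr1: "smooth_projective X \<Longrightarrow> smooth_projective Y \<Longrightarrow> subvariety V X \<Longrightarrow>
      pull dot (X \<boxtimes> Y) X (pr1 X Y) (cls X (prime_cycle V)) = cls (X \<boxtimes> Y) (prime_cycle (V \<boxtimes> Y))"
    and pull_pr2: "smooth_projective X \<Longrightarrow> smooth_projective Y \<Longrightarrow> subvariety V Y \<Longrightarrow>
      pull dot (X \<boxtimes> Y) Y (pr2 X Y) (cls Y (prime_cycle V)) = cls (X \<boxtimes> Y) (prime_cycle (X \<boxtimes> V))"
    and projection_formula: "smooth_projective X \<Longrightarrow> smooth_projective Y \<Longrightarrow> morphism X Y f \<Longrightarrow>
      a \<in> Chow_total X \<Longrightarrow> b \<in> Chow_total Y \<Longrightarrow>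
      push Y f (dot X a (pull dot X Y f b)) = dot Y (push Y f a) b"


section \<open>Complex manifolds\<close>

definition cvec :: "nat \<Rightarrow> (nat \<Rightarrow> complex) set" where
  "cvec d = {z. \<forall>i\<ge>d. z i = 0}"

text \<open>Holomorphic functions on open subsets of \<open>\<complex>\<^sup>d\<close>: continuous and separately holomorphic.\<close>

definition hol :: "nat \<Rightarrow> (nat \<Rightarrow> complex) set \<Rightarrow> ((nat \<Rightarrow> complex) \<Rightarrow> complex) \<Rightarrow> bool" where
  "hol d U g \<longleftrightarrow> openin (top_of_set (cvec d)) U \<and> continuous_on U g \<and>
     (\<forall>z\<in>U. \<forall>i<d. (\<lambda>t. g (z(i := t))) field_differentiable (at (z i)))"

text \<open>A chart is a pair \<open>(W, \<psi>)\<close> of an open subset of \<open>\<complex>\<^sup>d\<close> and a parametrisation of an open subset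
  of the manifold by it.\<close>

type_synonym 'a chart = "(nat \<Rightarrow> complex) set \<times> ((nat \<Rightarrow> complex) \<Rightarrow> 'a)"

record 'a cmfd =
  mdim :: nat
  mtop :: "'a topology"
  charts :: "'a chart set"

definition parametrises :: "nat \<Rightarrow> 'a topology \<Rightarrow> 'a chart \<Rightarrow> bool" where
  "parametrises d T c \<longleftrightarrow> openin (top_of_set (cvec d)) (fst c) \<and> openin T (snd c ` fst c) \<and>
     homeomorphic_map (top_of_set (fst c)) (subtopology T (snd c ` fst c)) (snd c)"

definition transition :: "'a chart \<Rightarrow> 'a chart \<Rightarrow> (nat \<Rightarrow> complex) \<Rightarrow> (nat \<Rightarrow> complex)" where
  "transition c c' z = inv_into (fst c') (snd c') (snd c z)"

definition overlap :: "'a chart \<Rightarrow> 'a chart \<Rightarrow> (nat \<Rightarrow> complex) set" where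
  "overlap c c' = {z \<in> fst c. snd c z \<in> snd c' ` fst c'}"

definition complex_manifold :: "'a cmfd \<Rightarrow> bool" where
  "complex_manifold M \<longleftrightarrow> Hausdorff_space (mtop M) \<and>
     (\<exists>\<B>. countable \<B> \<and> (\<forall>U\<in>\<B>. openin (mtop M) U) \<and>
        (\<forall>U x. openin (mtop M) U \<and> x \<in> U \<longrightarrow> (\<exists>B\<in>\<B>. x \<in> B \<and> B \<subseteq> U))) \<and>
     (\<forall>c\<in>charts M. parametrises (mdim M) (mtop M) c) \<and>
     (\<Union>c\<in>charts M. snd c ` fst c) = topspace (mtop M) \<and>
     (\<forall>c\<in>charts M. \<forall>c'\<in>charts M. \<forall>i. hol (mdim M) (overlap c c') (\<lambda>z. transition c c' z i))"

definition holomorphic_map_on :: "'a cmfd \<Rightarrow> 'b cmfd \<Rightarrow> 'a set \<Rightarrow> ('a \<Rightarrow> 'b) \<Rightarrow> bool" where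
  "holomorphic_map_on M N U f \<longleftrightarrow> openin (mtop M) U \<and>
     continuous_map (subtopology (mtop M) U) (mtop N) f \<and>
     (\<forall>c\<in>charts M. \<forall>c'\<in>charts N. \<forall>i.
        hol (mdim M) {z \<in> fst c. snd c z \<in> U \<and> f (snd c z) \<in> snd c' ` fst c'}
          (\<lambda>z. inv_into (fst c') (snd c') (f (snd c z)) i))"

abbreviation holomorphic_map :: "'a cmfd \<Rightarrow> 'b cmfd \<Rightarrow> ('a \<Rightarrow> 'b) \<Rightarrow> bool" where
  "holomorphic_map M N \<equiv> holomorphic_map_on M N (topspace (mtop M))"

definition biholomorphic :: "'a cmfd \<Rightarrow> 'b cmfd \<Rightarrow> bool" where
  "biholomorphic M N \<longleftrightarrow> (\<exists>f g. holomorphic_map M N f \<and> holomorphic_map N M g \<and>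
     (\<forall>x\<in>topspace (mtop M). g (f x) = x) \<and> (\<forall>y\<in>topspace (mtop N). f (g y) = y))"

subsection \<open>Deformations\<close>

text \<open>A holomorphic map is a submersion if and only if it has a holomorphic local section through every
  point.\<close>

definition submersion :: "'a cmfd \<Rightarrow> 'b cmfd \<Rightarrow> ('a \<Rightarrow> 'b) \<Rightarrow> bool" where
  "submersion M N f \<longleftrightarrow> holomorphic_map M N f \<and>
     (\<forall>x\<in>topspace (mtop M). \<exists>U s. f x \<in> U \<and> holomorphic_map_on N M U s \<and> s (f x) = x \<and>
        (\<forall>y\<in>U. f (s y) = y))"

text \<open>The charts of a fibre are all the parametrisations of open subsets of the fibre which are holomorphic
  as maps to the total space.\<close>

definition fibre :: "'a cmfd \<Rightarrow> 'b cmfd \<Rightarrow> ('a \<Rightarrow> 'b) \<Rightarrow> 'b \<Rightarrow> 'a cmfd" where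
  "fibre M N f b = (let T = subtopology (mtop M) {x \<in> topspace (mtop M). f x = b};
       d = mdim M - mdim N in
     \<lparr> mdim = d, mtop = T,
       charts = {c. parametrises d T c \<and>
         (\<forall>c'\<in>charts M. \<forall>i. hol d (overlap c c') (\<lambda>z. transition c c' z i))} \<rparr>)"

text \<open>The underlying sets of the total space and the base have at most the cardinality of the continuum,
  so that realising them inside the type of points is no restriction.\<close>

definition fibres_of_common_family :: "pt cmfd \<Rightarrow> pt cmfd \<Rightarrow> bool" where
  "fibres_of_common_family M N \<longleftrightarrow> (\<exists>(E :: pt cmfd) (B :: pt cmfd) f b b'.
     complex_manifold E \<and> complex_manifold B \<and> connected_space (mtop B) \<and>
     submersion E B f \<and> proper_map (mtop E) (mtop B) f \<and>
     b \<in> topspace (mtop B) \<and> b' \<in> topspace (mtop B) \<and>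
     biholomorphic M (fibre E B f b) \<and> biholomorphic N (fibre E B f b'))"

definition deformation_equivalent :: "pt cmfd \<Rightarrow> pt cmfd \<Rightarrow> bool" where
  "deformation_equivalent = fibres_of_common_family\<^sup>*\<^sup>*"

subsection \<open>Holomorphic symplectic manifolds\<close>

definition simply_connected_top :: "'a topology \<Rightarrow> bool" where
  "simply_connected_top T \<longleftrightarrow> path_connected_space T \<and> topspace T \<noteq> {} \<and>
     (\<forall>g. continuous_map (top_of_set (sphere (0::complex) 1)) T g \<longrightarrow>
        (\<exists>a. homotopic_with (\<lambda>_. True) (top_of_set (sphere (0::complex) 1)) T g (\<lambda>_. a)))"

definition partial_deriv :: "nat \<Rightarrow> ((nat \<Rightarrow> complex) \<Rightarrow> complex) \<Rightarrow> (nat \<Rightarrow> complex) \<Rightarrow> complex" where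
  "partial_deriv i g z = deriv (\<lambda>t. g (z(i := t))) (z i)"

text \<open>Holomorphic 2-forms, as the family of their coefficient functions in all charts.\<close>

definition holomorphic_2form ::
    "'a cmfd \<Rightarrow> ('a chart \<Rightarrow> (nat \<Rightarrow> complex) \<Rightarrow> nat \<Rightarrow> nat \<Rightarrow> complex) \<Rightarrow> bool" where
  "holomorphic_2form M \<omega> \<longleftrightarrow>
     (\<forall>c\<in>charts M. \<forall>i<mdim M. \<forall>j<mdim M.
        hol (mdim M) (fst c) (\<lambda>z. \<omega> c z i j) \<and> (\<forall>z\<in>fst c. \<omega> c z i j = - \<omega> c z j i)) \<and>
     (\<forall>c\<in>charts M. \<forall>c'\<in>charts M. \<forall>z\<in>overlap c c'. \<forall>i<mdim M. \<forall>j<mdim M.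
        \<omega> c z i j = (\<Sum>k<mdim M. \<Sum>l<mdim M. \<omega> c' (transition c c' z) k l *
          partial_deriv i (\<lambda>w. transition c c' w k) z * partial_deriv j (\<lambda>w. transition c c' w l) z))"

definition nondegenerate_2form ::
    "'a cmfd \<Rightarrow> ('a chart \<Rightarrow> (nat \<Rightarrow> complex) \<Rightarrow> nat \<Rightarrow> nat \<Rightarrow> complex) \<Rightarrow> bool" where
  "nondegenerate_2form M \<omega> \<longleftrightarrow> (\<forall>c\<in>charts M. \<forall>z\<in>fst c. \<forall>v\<in>cvec (mdim M).
     (\<forall>j<mdim M. (\<Sum>i<mdim M. v i * \<omega> c z i j) = 0) \<longrightarrow> v = (\<lambda>_. 0))"

definition irreducible_holomorphic_symplectic :: "'a cmfd \<Rightarrow> bool" where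
  "irreducible_holomorphic_symplectic M \<longleftrightarrow> compact_space (mtop M) \<and> simply_connected_top (mtop M) \<and>
     (\<exists>\<sigma>. holomorphic_2form M \<sigma> \<and> nondegenerate_2form M \<sigma> \<and>
        (\<forall>\<omega>. holomorphic_2form M \<omega> \<longrightarrow> (\<exists>a. \<forall>c\<in>charts M. \<forall>z\<in>fst c.
           \<forall>i<mdim M. \<forall>j<mdim M. \<omega> c z i j = a * \<sigma> c z i j)))"

subsection \<open>The complex manifold underlying a smooth projective variety\<close>

text \<open>The classical topology is the quotient topology from the nonzero vectors of the cone.\<close>

definition classical_top :: "pt set \<Rightarrow> pt topology" where
  "classical_top V = topology (\<lambda>U. U \<subseteq> V \<and> openin (top_of_set {v. nrm v \<in> V}) {v. nrm v \<in> U})"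

definition hol_projective :: "nat \<Rightarrow> pt chart \<Rightarrow> bool" where
  "hol_projective d c \<longleftrightarrow> (\<forall>z\<in>fst c. \<exists>U g. z \<in> U \<and> U \<subseteq> fst c \<and> (\<forall>i. hol d U (\<lambda>w. g w i)) \<and>
     (\<forall>w\<in>U. (\<exists>i. g w i \<noteq> 0) \<and> snd c w = nrm (g w)))"

text \<open>For singular \<open>V\<close> the charts cover the smooth locus only.\<close>

definition analytic :: "pt set \<Rightarrow> pt cmfd" where
  "analytic V = \<lparr> mdim = the_enat (zdim V), mtop = classical_top V,
     charts = {c. parametrises (the_enat (zdim V)) (classical_top V) c \<and>
       hol_projective (the_enat (zdim V)) c \<and> (\<forall>z\<in>fst c. smooth_at V (snd c z))} \<rparr>"


section \<open>Singular cohomology and cycle classes\<close>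

text \<open>Singular cochains with complex coefficients, as functions on singular simplices; only
  the values on the singular simplices of the space in question matter.\<close>

type_synonym 'a cochain = "((nat \<Rightarrow> real) \<Rightarrow> 'a) \<Rightarrow> complex"

definition on_chain :: "'a cochain \<Rightarrow> 'a chain \<Rightarrow> complex" where
  "on_chain \<phi> c = (\<Sum>s\<in>Poly_Mapping.keys c. of_int (Poly_Mapping.lookup c s) * \<phi> s)"

definition cocycle :: "'a topology \<Rightarrow> nat \<Rightarrow> 'a cochain \<Rightarrow> bool" where
  "cocycle T k \<phi> \<longleftrightarrow> (\<forall>s. singular_simplex (Suc k) T s \<longrightarrow>
     on_chain \<phi> (chain_boundary (Suc k) (frag_of s)) = 0)"

definition coboundary :: "'a topology \<Rightarrow> nat \<Rightarrow> 'a cochain \<Rightarrow> bool" where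
  "coboundary T k \<phi> \<longleftrightarrow> (\<exists>\<psi>. \<forall>s. singular_simplex k T s \<longrightarrow>
     \<phi> s = on_chain \<psi> (chain_boundary k (frag_of s)))"

definition cup :: "nat \<Rightarrow> nat \<Rightarrow> 'a cochain \<Rightarrow> 'a cochain \<Rightarrow> 'a cochain" where
  "cup p q \<phi> \<psi> s = \<phi> (restrict s (standard_simplex p)) *
     \<psi> (restrict (\<lambda>x. s (\<lambda>i. if i < p then 0 else x (i - p))) (standard_simplex q))"

definition pullback_cochain :: "nat \<Rightarrow> ('a \<Rightarrow> 'b) \<Rightarrow> 'b cochain \<Rightarrow> 'a cochain" where
  "pullback_cochain k f \<phi> s = \<phi> (simplex_map k f s)"

definition cohomology_basis :: "'a topology \<Rightarrow> nat \<Rightarrow> nat \<Rightarrow> (nat \<Rightarrow> 'a cochain) \<Rightarrow> bool" where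
  "cohomology_basis T k n e \<longleftrightarrow> (\<forall>i<n. cocycle T k (e i)) \<and>
     (\<forall>\<phi>. cocycle T k \<phi> \<longrightarrow> (\<exists>!a :: nat \<Rightarrow> complex. (\<forall>i\<ge>n. a i = 0) \<and>
        coboundary T k (\<lambda>s. \<phi> s - (\<Sum>i<n. a i * e i s))))"

definition betti :: "'a topology \<Rightarrow> nat \<Rightarrow> nat" where
  "betti T k = (THE n. \<exists>e. cohomology_basis T k n e)"

text \<open>
  A cycle representing the fundamental class of a compact variety: it restricts to
  the complex orientation at the centre of every chart polydisc.  The local orientation is given by the affine simplex
  in \<open>\<complex>\<^sup>d = \<real>\<^sup>2\<^sup>d\<close> with vertices \<open>(-1, \<dots>, -1)\<close> and the standard basis vectors, which is positively
  oriented and has barycentre 0.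
\<close>

definition orientation_simplex :: "nat \<Rightarrow> 'a chart \<Rightarrow> (nat \<Rightarrow> real) \<Rightarrow> 'a" where
  "orientation_simplex d c = restrict
     (\<lambda>t. snd c (\<lambda>k. if k < d then Complex (t (2 * k + 1) - t 0) (t (2 * k + 2) - t 0) else 0))
     (standard_simplex (2 * d))"

definition fundamental_cycle :: "'a cmfd \<Rightarrow> 'a chain \<Rightarrow> bool" where
  "fundamental_cycle M \<mu> \<longleftrightarrow> singular_relcycle (2 * mdim M) (mtop M) {} \<mu> \<and>
     (\<forall>c\<in>charts M. {z \<in> cvec (mdim M). \<forall>i. cmod (z i) \<le> 2} \<subseteq> fst c \<longrightarrow>
        homologous_rel (2 * mdim M) (mtop M) (topspace (mtop M) - {snd c (\<lambda>_. 0)})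
          \<mu> (frag_of (orientation_simplex (mdim M) c)))"

definition integral_over :: "'a cmfd \<Rightarrow> 'a cochain \<Rightarrow> complex" where
  "integral_over M \<phi> = on_chain \<phi> (SOME \<mu>. fundamental_cycle M \<mu>)"

text \<open>The cohomology class of a codimension \<open>k\<close> cycle \<open>z\<close> on a smooth projective variety, characterised
  through Poincare duality: \<open>\<integral>\<^sub>X [z] \<union> \<beta> = \<integral>\<^sub>z \<beta>\<close> for all \<open>\<beta>\<close> of complementary degree.\<close>

definition has_cycle_class :: "pt set \<Rightarrow> nat \<Rightarrow> cyc \<Rightarrow> pt cochain \<Rightarrow> bool" where
  "has_cycle_class X k z \<phi> \<longleftrightarrow> z \<in> cycles X \<and>
     (\<forall>V\<in>Poly_Mapping.keys z. zdim V + enat k = zdim X) \<and>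
     cocycle (classical_top X) (2 * k) \<phi> \<and>
     (let m = 2 * (mdim (analytic X) - k) in
      \<forall>\<beta>. cocycle (classical_top X) m \<beta> \<longrightarrow>
        integral_over (analytic X) (cup (2 * k) m \<phi> \<beta>) =
        (\<Sum>V\<in>Poly_Mapping.keys z. of_rat (Poly_Mapping.lookup z V) * integral_over (analytic V) \<beta>))"


section \<open>Hyperkaehler varieties of K3[2]-type\<close>

text \<open>In dimension 2, the irreducible holomorphic symplectic manifolds are the K3 surfaces.\<close>

definition K3_surface :: "pt set \<Rightarrow> bool" where
  "K3_surface S \<longleftrightarrow> smooth_projective S \<and> zdim S = 2 \<and> irreducible_holomorphic_symplectic (analytic S)"

text \<open>
  The Hilbert scheme of two points of a surface \<open>S\<close> in its Grothendieck embedding: a subscheme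
  of length 2 is sent to the 2-dimensional space of functionals on quadratic forms which
  it defines, and this to its Pluecker coordinates.  Since the Gotzmann number of the Hilbert polynomial 2 is 2,
  quadratic forms suffice.  For two distinct points \<open>x\<close>, \<open>y\<close> the Pluecker
  vector is \<open>v(x) \<and> v(y)\<close>, with \<open>v(x) = segre x x\<close> the Veronese vector, and reduced subschemes are dense
  because the Hilbert scheme of two points of a smooth irreducible surface is irreducible.
\<close>

definition pluecker_pair :: "pt \<Rightarrow> pt \<Rightarrow> pt" where
  "pluecker_pair x y = nrm (\<lambda>k. case prod_decode k of (i, j) \<Rightarrow>
     segre x x i * segre y y j - segre x x j * segre y y i)"

definition Hilb2 :: "pt set \<Rightarrow> pt set" where
  "Hilb2 S = zclosure {pluecker_pair x y | x y. x \<in> S \<and> y \<in> S \<and> x \<noteq> y}"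

text \<open>All K3 surfaces are deformation equivalent, and so are their Hilbert schemes, so that it
  makes no difference that \<open>S\<close> is taken to be projective.\<close>

definition hyperkaehler_K3_2_type :: "pt set \<Rightarrow> bool" where
  "hyperkaehler_K3_2_type X \<longleftrightarrow> smooth_projective X \<and> zdim X = 4 \<and>
     irreducible_holomorphic_symplectic (analytic X) \<and>
     (\<exists>S. K3_surface S \<and> deformation_equivalent (analytic X) (analytic (Hilb2 S)))"

text \<open>
  The complex bilinear extension of the Beauville--Bogomolov form, on 2-cocycles.
  The normalisation \<open>\<integral>\<alpha>\<^sup>4 = 3(\<alpha>,\<alpha>)\<^sup>2\<close> determines it up to sign; the sign is the usual one, the form being positive
  on ample classes (tested on the classes of irreducible hyperplane sections).
\<close>

definition beauville_bogomolov_form :: "pt set \<Rightarrow> (pt cochain \<Rightarrow> pt cochain \<Rightarrow> complex) \<Rightarrow> bool" where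
  "beauville_bogomolov_form X B \<longleftrightarrow> (let T = classical_top X in
     (\<forall>\<alpha> \<beta> \<gamma> a b. cocycle T 2 \<alpha> \<and> cocycle T 2 \<beta> \<and> cocycle T 2 \<gamma> \<longrightarrow>
        B (\<lambda>s. a * \<alpha> s + b * \<beta> s) \<gamma> = a * B \<alpha> \<gamma> + b * B \<beta> \<gamma>) \<and>
     (\<forall>\<alpha> \<beta>. cocycle T 2 \<alpha> \<and> cocycle T 2 \<beta> \<longrightarrow> B \<alpha> \<beta> = B \<beta> \<alpha>) \<and>
     (\<forall>\<alpha> \<beta>. coboundary T 2 \<alpha> \<and> cocycle T 2 \<beta> \<longrightarrow> B \<alpha> \<beta> = 0) \<and>
     (\<forall>\<alpha> \<beta>. cocycle T 2 \<alpha> \<and> cocycle T 2 \<beta> \<and>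
        (\<forall>s. singular_simplex 2 T s \<longrightarrow> \<alpha> s \<in> \<rat> \<and> \<beta> s \<in> \<rat>) \<longrightarrow> B \<alpha> \<beta> \<in> \<rat>) \<and>
     (\<forall>\<alpha>. cocycle T 2 \<alpha> \<longrightarrow>
        integral_over (analytic X) (cup 2 6 \<alpha> (cup 2 4 \<alpha> (cup 2 2 \<alpha> \<alpha>))) = 3 * (B \<alpha> \<alpha>)\<^sup>2) \<and>
     (\<forall>p Y \<eta>. homogeneous 1 p \<and> Y = {x \<in> X. peval p x = 0} \<and> Y \<noteq> X \<and> variety Y \<and>
        has_cycle_class X 1 (prime_cycle Y) \<eta> \<longrightarrow> Re (B \<eta> \<eta>) > 0))"

text \<open>\<open>r\<close> is the dimension of \<open>H\<^sup>2\<close>; \<open>e\<^sub>i \<otimes> e\<^sub>i\<close> is \<open>p\<^sub>1\<^sup>*e\<^sub>i \<union> p\<^sub>2\<^sup>*e\<^sub>i\<close>.\<close>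

definition BB_class_cochain :: "pt set \<Rightarrow> nat \<Rightarrow> (nat \<Rightarrow> pt cochain) \<Rightarrow> pt cochain" where
  "BB_class_cochain X r e = (\<lambda>s. \<Sum>i<r.
     cup 2 2 (pullback_cochain 2 (pr1 X X) (e i)) (pullback_cochain 2 (pr2 X X) (e i)) s)"

definition lifts_BB_class :: "pt set \<Rightarrow> cls \<Rightarrow> bool" where
  "lifts_BB_class X L \<longleftrightarrow> (\<exists>B r e. beauville_bogomolov_form X B \<and>
     cohomology_basis (classical_top X) 2 r e \<and>
     (\<forall>i<r. \<forall>j<r. B (e i) (e j) = (if i = j then 1 else 0)) \<and>
     (\<exists>z\<in>L. has_cycle_class (X \<boxtimes> X) 2 z (BB_class_cochain X r e)))"


section \<open>Correspondences and the decompositions of the Chow groups\<close>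

context
  fixes dot :: "pt set \<Rightarrow> cls \<Rightarrow> cls \<Rightarrow> cls"
    and X :: "pt set"
begin

definition corr :: "cls \<Rightarrow> cls \<Rightarrow> cls" where
  "corr \<Gamma> Z = push X (pr2 X X) (dot (X \<boxtimes> X) \<Gamma> (pull dot (X \<boxtimes> X) X (pr1 X X) Z))"

definition first :: "cls \<Rightarrow> cls" where
  "first Z = pull dot (X \<boxtimes> X) X (pr1 X X) Z"

definition second :: "cls \<Rightarrow> cls" where
  "second Z = pull dot (X \<boxtimes> X) X (pr2 X X) Z"

definition diag_class :: cls where
  "diag_class = cls (X \<boxtimes> X) (prime_cycle (diag ` X))"

definition diag_pull :: "cls \<Rightarrow> cls" where
  "diag_pull L = pull dot X (X \<boxtimes> X) diag L"

definition exp_class :: "cls \<Rightarrow> cls" where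
  "exp_class L = (let D = dot (X \<boxtimes> X); L2 = D L L; L3 = D L2 L; L4 = D L3 L in
     fund (X \<boxtimes> X) +\<^sub>C L +\<^sub>C (1/2) *\<^sub>C L2 +\<^sub>C (1/6) *\<^sub>C L3 +\<^sub>C (1/24) *\<^sub>C L4)"

definition H_class :: "nat \<Rightarrow> cls \<Rightarrow> cls" where
  "H_class r L = (let D = dot (X \<boxtimes> X); \<rho> = (of_nat r :: rat); l = diag_pull L;
       l1 = first l; l2 = second l in
     (4 / (\<rho> * (\<rho> + 2))) *\<^sub>C (D l2 l2 -\<^sub>C D l1 l1) +\<^sub>C (2 / (\<rho> + 2)) *\<^sub>C D L (l2 -\<^sub>C l1))"

definition Chow_H :: "nat \<Rightarrow> cls \<Rightarrow> nat \<Rightarrow> nat \<Rightarrow> cls set" where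
  "Chow_H r L i s = {Z \<in> Chow X i. corr (H_class r L) Z = (2 * of_nat i - 4 - of_nat s) *\<^sub>C Z}"

text \<open>Only used for \<open>i \<le> 4\<close>.\<close>

definition Chow_Fourier :: "cls \<Rightarrow> nat \<Rightarrow> nat \<Rightarrow> cls set" where
  "Chow_Fourier L i s = {Z \<in> Chow X i. corr (exp_class L) Z \<in> Chow X (4 - i + s)}"

definition shen_vial_relations :: "nat \<Rightarrow> cls \<Rightarrow> bool" where
  "shen_vial_relations r L \<longleftrightarrow> (let D = dot (X \<boxtimes> X); \<rho> = (of_nat r :: rat); l = diag_pull L;
       l1 = first l; l2 = second l in
     D L L = 2 *\<^sub>C diag_class -\<^sub>C (2 / (\<rho> + 2)) *\<^sub>C D L (l1 +\<^sub>C l2)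
       -\<^sub>C (1 / (\<rho> * (\<rho> + 2))) *\<^sub>C (2 *\<^sub>C D l1 l1 -\<^sub>C \<rho> *\<^sub>C D l1 l2 +\<^sub>C 2 *\<^sub>C D l2 l2) \<and>
     corr L (dot X l l) = czero X \<and>
     (\<forall>\<sigma>\<in>Chow X 4. corr L (dot X l (corr L \<sigma>)) = (\<rho> + 2) *\<^sub>C corr L \<sigma>) \<and>
     (\<forall>\<tau>\<in>Chow X 2. corr (D L L) (dot X l (corr (D L L) \<tau>)) = czero X))"

definition direct_sum :: "cls set \<Rightarrow> cls set list \<Rightarrow> bool" where
  "direct_sum C As \<longleftrightarrow>
     (\<forall>zs. list_all2 (\<in>) zs As \<longrightarrow> foldr (+\<^sub>C) zs (czero X) \<in> C) \<and>
     (\<forall>Z\<in>C. \<exists>!zs. list_all2 (\<in>) zs As \<and> foldr (+\<^sub>C) zs (czero X) = Z)"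

definition chow_decomposition :: "(nat \<Rightarrow> nat \<Rightarrow> cls set) \<Rightarrow> bool" where
  "chow_decomposition A \<longleftrightarrow>
     direct_sum (Chow X 0) [A 0 0] \<and>
     direct_sum (Chow X 1) [A 1 0] \<and>
     direct_sum (Chow X 2) [A 2 0, A 2 2] \<and>
     direct_sum (Chow X 3) [A 3 0, A 3 2] \<and>
     direct_sum (Chow X 4) [A 4 0, A 4 2, A 4 4]"

end

text \<open>The theorem of Shen and Vial on the Fourier decomposition.\<close>

definition shen_vial_theorem :: "(pt set \<Rightarrow> cls \<Rightarrow> cls \<Rightarrow> cls) \<Rightarrow> bool" where
  "shen_vial_theorem dot \<longleftrightarrow> (\<forall>X L r. hyperkaehler_K3_2_type X \<and>
     r = betti (classical_top X) 2 \<and> r = 23 \<and>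
     L \<in> Chow (X \<boxtimes> X) 2 \<and> lifts_BB_class X L \<and> shen_vial_relations dot X r L \<longrightarrow>
     chow_decomposition X (Chow_Fourier dot X L))"

end

theory Submission
  imports Defs
begin

text \<open>
  Write \<open>c = 2 / (r + 2)\<close>. By the projection formula, \<open>H\<^sub>*\<close> and \<open>(L\<^sup>2)\<^sub>*\<close> are combinations of the operators
  \<open>Z \<mapsto> l \<cdot> L\<^sub>* Z\<close>, \<open>Z \<mapsto> L\<^sub>*(l \<cdot> Z)\<close> and degree maps. A class lies in the Fourier component of weight \<open>s\<close>
  iff \<open>(L\<^sup>k)\<^sub>*\<close> kills it for all \<open>k \<noteq> 4 - i + s / 2\<close>; inserting this into the relation for \<open>L\<^sup>2\<close> shows
  that \<open>H\<^sub>*\<close> is \<open>2 i - 4 - s\<close> there. Only \<open>i = 2\<close> needs more: for \<open>s = 2\<close> one has to show that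
  \<open>l \<cdot> Z\<close> has degree 0, for \<open>s = 0\<close> that \<open>L\<^sub>*(l \<cdot> Z) = 0\<close>, which follows from \<open>(L\<^sup>3)\<^sub>* Z = 0\<close>.
  Since the Fourier components span and the eigenvalues are distinct, they are the full eigenspaces.
\<close>

section \<open>Cycle classes\<close>

text \<open>Write \<open>T k\<close> for \<open>(L\<^sup>k)\<^sub>*\<close>. The relation for
  \<open>T 2\<close> contains \<open>l \<cdot> T 1 Z\<close> and \<open>T 1 (l \<cdot> Z)\<close>
  with equal signs, \<open>H\<close> contains them with opposite signs, and the coefficients agree
  up to sign. So if \<open>T 2 Z = 0\<close> and only one of the two survives, it equals
  \<open>25 Z\<close>, and \<open>H\<close> acts by 2 or -2. If only a degree term survives, its
  coefficient in \<open>H\<close> is twice the one in the relation up to sign, which gives 4 or -4.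
  In codimension 2 the relation has a degree term \<open>T 0 (l \<cdot> Z) \<cdot> l\<close> without
  counterpart in \<open>H\<close>, whence the extra work there. The obstacle on the geometric side
  is the grading: the axioms of \<open>intersection_theory\<close> state neither the dimension of a
  product nor that push-forward respects codimension. The dimension of
  \<open>X \<boxtimes> X\<close> is read off the diagonal, whose class the relation for
  \<open>L\<^sup>2\<close> places in codimension 4, and images under \<open>T k\<close> are placed
  in Chow groups by the Fourier decomposition itself.\<close>

lemma lookup_smul [simp]: "Poly_Mapping.lookup (smul q z) V = q * Poly_Mapping.lookup z V"
  by (simp add: smul_def map.rep_eq when_def)

lemma smul_add: "smul q (u + v) = smul q u + smul q v"
  by (rule poly_mapping_eqI) (simp add: lookup_add algebra_simps)

lemma smul_smul: "smul p (smul q z) = smul (p * q) z"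
  by (rule poly_mapping_eqI) simp

lemma smul_zero [simp]: "smul q 0 = 0"
  by (rule poly_mapping_eqI) simp

interpretation cyc: vector_space smul
  by standard (rule poly_mapping_eqI; simp add: lookup_add algebra_simps)+

lemma rat_equiv_zero_add:
  assumes "u \<in> rat_equiv_zero X" "v \<in> rat_equiv_zero X"
  shows "u + v \<in> rat_equiv_zero X"
  using assms(2,1)
  by (induction v rule: rat_equiv_zero.induct)
     (auto simp: add.assoc[symmetric] intro: rat_equiv_zero.intros)

lemma rat_equiv_zero_smul: "z \<in> rat_equiv_zero X \<Longrightarrow> smul q z \<in> rat_equiv_zero X"
  by (induction rule: rat_equiv_zero.induct)
     (auto simp: smul_add smul_smul simp del: cyc.scale_scale intro: rat_equiv_zero.intros)

lemma subspace_rat_equiv_zero: "cyc.subspace (rat_equiv_zero X)"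
  by (simp add: cyc.subspace_def rat_equiv_zero.zero rat_equiv_zero_add rat_equiv_zero_smul)

lemmas rat_equiv_zero_diff = cyc.subspace_diff[OF subspace_rat_equiv_zero]

text \<open>A principal cycle is supported in codimension one on some subvariety \<open>W\<close>,
  and sums add nothing to the supports. This is what will keep the fundamental class away from
  zero.\<close>

lemma rat_equiv_zero_keys:
  assumes "z \<in> rat_equiv_zero X" "V \<in> Poly_Mapping.keys z"
  shows "\<exists>W. subvariety W X \<and> subvariety V W \<and> zdim V + 1 = zdim W"
  using assms
proof (induction rule: rat_equiv_zero.induct)
  case (step z w q)
  then have "V \<in> Poly_Mapping.keys z \<or> V \<in> Poly_Mapping.keys w"
    by (auto simp: in_keys_iff lookup_add)
  then show ?case
    using step by (elim disjE) (auto simp: principal_cycles_def in_keys_iff split: if_splits)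
qed simp

lemma rat_equiv_zero_subset_cycles: "rat_equiv_zero X \<subseteq> cycles X"
  using rat_equiv_zero_keys by (fastforce simp: cycles_def subvariety_def)

lemma cls_eq_iff: "cls X u = cls X v \<longleftrightarrow> u - v \<in> rat_equiv_zero X"
proof
  assume "cls X u = cls X v"
  moreover have "u \<in> cls X u"
    by (simp add: cls_def rat_equiv_zero.zero)
  ultimately show "u - v \<in> rat_equiv_zero X"
    by (simp add: cls_def)
next
  assume d: "u - v \<in> rat_equiv_zero X"
  have "w - u \<in> rat_equiv_zero X \<longleftrightarrow> w - v \<in> rat_equiv_zero X" for w
    using rat_equiv_zero_add[OF _ d, of "w - u"] rat_equiv_zero_diff[OF _ d, of "w - v"] by auto
  then show "cls X u = cls X v"
    by (auto simp: cls_def)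
qed

lemma mem_cls_iff: "w \<in> cls X u \<longleftrightarrow> cls X w = cls X u"
  by (simp add: cls_eq_iff) (simp add: cls_def)

lemma cls_self [simp]: "u \<in> cls X u"
  by (simp add: mem_cls_iff)

lemma cadd_cls [simp]: "cls X u +\<^sub>C cls X v = cls X (u + v)"
proof (rule subset_antisym[OF subsetI subsetI])
  fix w assume "w \<in> cls X (u + v)"
  then have "(w - v) - u \<in> rat_equiv_zero X"
    by (simp add: cls_def algebra_simps)
  then have "w - v \<in> cls X u" "w = (w - v) + v"
    by (simp_all add: cls_def)
  then show "w \<in> cls X u +\<^sub>C cls X v"
    unfolding cadd_def using cls_self[of v X] by blast
next
  fix w assume "w \<in> cls X u +\<^sub>C cls X v"
  then obtain a b where "w = a + b" "a - u \<in> rat_equiv_zero X" "b - v \<in> rat_equiv_zero X"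
    by (auto simp: cadd_def cls_def)
  with rat_equiv_zero_add[of "a - u" X "b - v"] show "w \<in> cls X (u + v)"
    by (simp add: cls_def algebra_simps)
qed

lemma csub_cls [simp]: "cls X u -\<^sub>C cls X v = cls X (u - v)"
proof (rule subset_antisym[OF subsetI subsetI])
  fix w assume "w \<in> cls X (u - v)"
  then have "(w + v) - u \<in> rat_equiv_zero X"
    by (simp add: cls_def algebra_simps)
  then have "w + v \<in> cls X u" "w = (w + v) - v"
    by (simp_all add: cls_def)
  then show "w \<in> cls X u -\<^sub>C cls X v"
    unfolding csub_def using cls_self[of v X] by blast
next
  fix w assume "w \<in> cls X u -\<^sub>C cls X v"
  then obtain a b where w: "w = a - b" and ab: "a - u \<in> rat_equiv_zero X" "b - v \<in> rat_equiv_zero X"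
    by (auto simp: csub_def cls_def)
  have "(a - u) - (b - v) \<in> rat_equiv_zero X"
    by (rule rat_equiv_zero_diff[OF ab])
  moreover have "(a - u) - (b - v) = w - (u - v)"
    by (simp add: w)
  ultimately show "w \<in> cls X (u - v)"
    by (simp add: cls_def)
qed

lemma cscale_cls [simp]: "q *\<^sub>C cls X u = cls X (smul q u)"
proof (rule subset_antisym[OF subsetI subsetI])
  fix w assume "w \<in> cls X (smul q u)"
  \<comment> \<open>The error term \<open>w - smul q u\<close> is written as a difference of two
    representatives, the form in which \<open>cscale\<close> admits it.\<close>
  then have "u + (w - smul q u) \<in> cls X u" "w = smul q u + ((u + (w - smul q u)) - u)"
    by (simp_all add: cls_def)
  then show "w \<in> q *\<^sub>C cls X u"
    unfolding cscale_def using cls_self[of u X] by blast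
next
  fix w assume "w \<in> q *\<^sub>C cls X u"
  then obtain a b c where w: "w = smul q a + (b - c)" and a: "a - u \<in> rat_equiv_zero X"
    and "b - u \<in> rat_equiv_zero X" "c - u \<in> rat_equiv_zero X"
    by (auto simp: cscale_def cls_def)
  then have "b - c \<in> rat_equiv_zero X"
    using rat_equiv_zero_diff[of "b - u" X "c - u"] by simp
  then have "smul q (a - u) + (b - c) \<in> rat_equiv_zero X"
    by (rule rat_equiv_zero_add[OF rat_equiv_zero_smul[OF a]])
  moreover have "smul q (a - u) + (b - c) = w - smul q u"
    by (simp add: w cyc.scale_right_diff_distrib)
  ultimately show "w \<in> cls X (smul q u)"
    by (simp add: cls_def)
qed

lemma range_cls_closed [simp]:
  "a \<in> range (cls X) \<Longrightarrow> b \<in> range (cls X) \<Longrightarrow> a +\<^sub>C b \<in> range (cls X)"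
  "a \<in> range (cls X) \<Longrightarrow> b \<in> range (cls X) \<Longrightarrow> a -\<^sub>C b \<in> range (cls X)"
  "a \<in> range (cls X) \<Longrightarrow> q *\<^sub>C a \<in> range (cls X)"
  "czero X \<in> range (cls X)" "cls X z \<in> range (cls X)"
  by (auto simp: czero_def)

text \<open>The axioms on \<open>dot\<close> and \<open>pull\<close> speak of sums and multiples
  only; differences are reduced to these.\<close>

lemma csub_conv_cadd:
  "a \<in> range (cls X) \<Longrightarrow> b \<in> range (cls X) \<Longrightarrow> a -\<^sub>C b = a +\<^sub>C (-1) *\<^sub>C b"
  by (auto simp: cyc.scale_minus_left)

text \<open>A linear map whose kernel is \<open>rat_equiv_zero X\<close> turns linear relations between classes into
  relations between rational numbers.\<close>

lemma exists_linear_with_kernel: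
  assumes "cyc.subspace R"
  shows "\<exists>f. Vector_Spaces.linear smul smul f \<and> (\<forall>u. f u = 0 \<longleftrightarrow> u \<in> R)"
proof -
  interpret p: vector_space_pair smul smul ..
  obtain B where B: "B \<subseteq> R" "cyc.independent B" "R \<subseteq> cyc.span B"
    using cyc.maximal_independent_subset[of R] by blast
  then have spB: "cyc.span B = R"
    using assms cyc.span_minimal by blast
  define E where "E = cyc.extend_basis B"
  have E: "B \<subseteq> E" "cyc.independent E" "cyc.span E = UNIV"
    using cyc.extend_basis_superset[OF B(2)] cyc.independent_extend_basis[OF B(2)]
      cyc.span_extend_basis[OF B(2)] by (auto simp: E_def)
  \<comment> \<open>The projection along \<open>R\<close> onto the span of \<open>E - B\<close>,
    which is a complement of \<open>R\<close>.\<close>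
  define f where "f = p.construct E (\<lambda>b. if b \<in> B then 0 else b)"
  have lin: "Vector_Spaces.linear smul smul f"
    unfolding f_def by (rule p.linear_construct[OF E(2)])
  interpret f: Vector_Spaces.linear smul smul f by (rule lin)
  have fB: "f b = 0" if "b \<in> B" for b
    using that E by (auto simp: f_def p.construct_basis[OF E(2)])
  have fE: "f b = b" if "b \<in> E - B" for b
    using that by (auto simp: f_def p.construct_basis[OF E(2)])
  have f0: "f u = 0" if "u \<in> cyc.span B" for u
    using p.linear_eq_0_on_span[OF lin fB that] .
  have fid: "f u = u" if "u \<in> cyc.span (E - B)" for u
    using p.linear_eq_on[OF lin cyc.linear_id that] fE by simp
  have "f u = 0 \<longleftrightarrow> u \<in> R" for u
  proof
    assume fu: "f u = 0"
    have "u \<in> cyc.span (B \<union> (E - B))"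
      using E by (simp add: Un_absorb1)
    then obtain s t where st: "u = s + t" "s \<in> cyc.span B" "t \<in> cyc.span (E - B)"
      unfolding cyc.span_Un by auto
    have "t = 0"
      using fu st f0[OF st(2)] fid[OF st(3)] f.add by simp
    then show "u \<in> R" using st spB by simp
  qed (use f0 spB in auto)
  with lin show ?thesis by blast
qed

definition kernel_map :: "pt set \<Rightarrow> cyc \<Rightarrow> cyc" where
  "kernel_map X = (SOME f. Vector_Spaces.linear smul smul f \<and> (\<forall>u. f u = 0 \<longleftrightarrow> u \<in> rat_equiv_zero X))"

text \<open>All representatives of a class on \<open>X\<close> have the same image under
  \<open>kernel_map X\<close>, so the choice is harmless. Identities between cosets become equations
  between rational numbers, within reach of \<open>simp\<close>.\<close>

definition coord :: "pt set \<Rightarrow> cls \<Rightarrow> pt set \<Rightarrow> rat" where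
  "coord X a = Poly_Mapping.lookup (kernel_map X (SOME u. u \<in> a))"

lemma kernel_map:
  "Vector_Spaces.linear smul smul (kernel_map X)" "kernel_map X u = 0 \<longleftrightarrow> u \<in> rat_equiv_zero X"
  using someI_ex[OF exists_linear_with_kernel[OF subspace_rat_equiv_zero[of X]]]
  unfolding kernel_map_def by blast+

lemma coord_cls: "coord X (cls X u) = Poly_Mapping.lookup (kernel_map X u)"
proof -
  interpret f: Vector_Spaces.linear smul smul "kernel_map X" by (rule kernel_map)
  have "(SOME v. v \<in> cls X u) \<in> cls X u"
    by (rule someI) (rule cls_self)
  then show ?thesis
    using kernel_map(2)[of X "(SOME v. v \<in> cls X u) - u"] by (simp add: coord_def cls_def f.diff)
qed

lemma coord_eq_iff:
  assumes "a \<in> range (cls X)" "b \<in> range (cls X)"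
  shows "a = b \<longleftrightarrow> coord X a = coord X b"
proof -
  interpret f: Vector_Spaces.linear smul smul "kernel_map X" by (rule kernel_map)
  obtain u v where "a = cls X u" "b = cls X v"
    using assms by blast
  then show ?thesis
    using kernel_map(2)[of X "u - v"] by (simp add: coord_cls cls_eq_iff lookup_inject f.diff)
qed

lemma coord_simps [simp]:
  "a \<in> range (cls X) \<Longrightarrow> b \<in> range (cls X) \<Longrightarrow> coord X (a +\<^sub>C b) V = coord X a V + coord X b V"
  "a \<in> range (cls X) \<Longrightarrow> b \<in> range (cls X) \<Longrightarrow> coord X (a -\<^sub>C b) V = coord X a V - coord X b V"
  "a \<in> range (cls X) \<Longrightarrow> coord X (q *\<^sub>C a) V = q * coord X a V"
  "coord X (czero X) V = 0"
proof -
  interpret f: Vector_Spaces.linear smul smul "kernel_map X" by (rule kernel_map)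
  note defs = coord_cls f.add f.diff f.scale lookup_add lookup_minus lookup_smul
  show "coord X (a +\<^sub>C b) V = coord X a V + coord X b V" "coord X (a -\<^sub>C b) V = coord X a V - coord X b V"
    if ab: "a \<in> range (cls X)" "b \<in> range (cls X)"
  proof -
    obtain u v where uv: "a = cls X u" "b = cls X v"
      using ab by blast
    show "coord X (a +\<^sub>C b) V = coord X a V + coord X b V" "coord X (a -\<^sub>C b) V = coord X a V - coord X b V"
      unfolding uv cadd_cls csub_cls defs by (rule refl)+
  qed
  show "coord X (q *\<^sub>C a) V = q * coord X a V" if a: "a \<in> range (cls X)"
  proof -
    obtain u where u: "a = cls X u"
      using a by blast
    show ?thesis
      unfolding u cscale_cls defs by (rule refl)
  qed
  show "coord X (czero X) V = 0"
    by (simp add: czero_def coord_cls f.zero)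
qed

lemma cls_eqI:
  assumes "a \<in> range (cls X)" "b \<in> range (cls X)" "\<And>V. coord X a V = coord X b V"
  shows "a = b"
  using assms by (simp add: coord_eq_iff fun_eq_iff)

lemma cadd_czero [simp]:
  assumes "a \<in> range (cls X)"
  shows "a +\<^sub>C czero X = a" "czero X +\<^sub>C a = a"
  by (rule cls_eqI[of _ X]; use assms in simp)+

subsection \<open>The grading\<close>

lemma cycles_closed:
  "u \<in> cycles X \<Longrightarrow> v \<in> cycles X \<Longrightarrow> u + v \<in> cycles X"
  "u \<in> cycles X \<Longrightarrow> smul q u \<in> cycles X"
  using Poly_Mapping.keys_add[of u v] by (auto simp: cycles_def in_keys_iff)

lemma Chow_total_closed [simp]:
  "a \<in> Chow_total X \<Longrightarrow> b \<in> Chow_total X \<Longrightarrow> a +\<^sub>C b \<in> Chow_total X"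
  "a \<in> Chow_total X \<Longrightarrow> q *\<^sub>C a \<in> Chow_total X"
  by (auto simp: Chow_total_def cycles_closed)

lemma Chow_closed:
  "a \<in> Chow X i \<Longrightarrow> b \<in> Chow X i \<Longrightarrow> a +\<^sub>C b \<in> Chow X i"
  "a \<in> Chow X i \<Longrightarrow> q *\<^sub>C a \<in> Chow X i"
  "czero X \<in> Chow X i"
proof -
  show "a +\<^sub>C b \<in> Chow X i" if ab: "a \<in> Chow X i" "b \<in> Chow X i"
  proof -
    obtain u v where uv: "a = cls X u" "b = cls X v" "u \<in> cycles X" "v \<in> cycles X"
      "\<forall>V\<in>Poly_Mapping.keys u. zdim V + enat i = zdim X"
      "\<forall>V\<in>Poly_Mapping.keys v. zdim V + enat i = zdim X"
      using ab unfolding Chow_def by blast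
    then have "u + v \<in> cycles X" "\<forall>V\<in>Poly_Mapping.keys (u + v). zdim V + enat i = zdim X"
      using Poly_Mapping.keys_add[of u v] by (auto simp: cycles_closed)
    then show ?thesis
      using uv unfolding Chow_def by auto
  qed
  show "q *\<^sub>C a \<in> Chow X i" if "a \<in> Chow X i"
    using that by (auto simp: Chow_def cycles_closed in_keys_iff)
  show "czero X \<in> Chow X i"
    unfolding Chow_def czero_def by (auto intro!: imageI simp: cycles_def)
qed

lemma Chow_subset_total: "a \<in> Chow X i \<Longrightarrow> a \<in> Chow_total X"
  by (auto simp: Chow_def Chow_total_def)

lemma Chow_total_range [simp]: "a \<in> Chow_total X \<Longrightarrow> a \<in> range (cls X)"
  by (auto simp: Chow_total_def)

lemma Chow_total_csub [simp]:
  "a \<in> Chow_total X \<Longrightarrow> b \<in> Chow_total X \<Longrightarrow> a -\<^sub>C b \<in> Chow_total X"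
  by (subst csub_conv_cadd[of _ X]) simp_all

lemma Chow_csub: "a \<in> Chow X i \<Longrightarrow> b \<in> Chow X i \<Longrightarrow> a -\<^sub>C b \<in> Chow X i"
  by (subst csub_conv_cadd[of _ X]) (auto intro: Chow_closed Chow_total_range Chow_subset_total)

definition dim_part :: "enat \<Rightarrow> cyc \<Rightarrow> cyc" where
  "dim_part n z = Poly_Mapping.mapp (\<lambda>V a. if zdim V = n then a else 0) z"

lemma lookup_dim_part [simp]:
  "Poly_Mapping.lookup (dim_part n z) V = (if zdim V = n then Poly_Mapping.lookup z V else 0)"
  by (simp add: dim_part_def lookup_mapp in_keys_iff when_def)

lemma dim_part_linear:
  "dim_part n (u + v) = dim_part n u + dim_part n v"
  "dim_part n (u - v) = dim_part n u - dim_part n v"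
  "dim_part n (smul q u) = smul q (dim_part n u)"
  by (rule poly_mapping_eqI; simp add: lookup_add lookup_minus)+

lemma dim_part_sum: "dim_part n (sum f A) = (\<Sum>j\<in>A. dim_part n (f j))"
  by (rule poly_mapping_eqI) (simp add: lookup_sum)

lemma dim_part_homogeneous:
  assumes "\<forall>V\<in>Poly_Mapping.keys z. zdim V = m"
  shows "dim_part n z = (if n = m then z else 0)"
  using assms by (intro poly_mapping_eqI) (auto simp: in_keys_iff)

text \<open>Each principal cycle is homogeneous, of dimension one less than its \<open>W\<close>, so
  taking a part either keeps or kills it. Hence relations between classes can be compared dimension
  by dimension.\<close>

lemma dim_part_rat_equiv_zero:
  assumes "z \<in> rat_equiv_zero X"
  shows "dim_part (enat n) z \<in> rat_equiv_zero X"
  using assms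
proof (induction rule: rat_equiv_zero.induct)
  case zero
  then show ?case
    by (simp add: dim_part_homogeneous rat_equiv_zero.zero)
next
  case (step z w q)
  from step.hyps obtain W f where
    w: "\<And>V. Poly_Mapping.lookup w V =
      (if subvariety V W \<and> zdim V + 1 = zdim W then of_int (ord_along W V f) else 0)"
    by (auto simp: principal_cycles_def)
  have "dim_part (enat n) w = (if zdim W = enat n + 1 then w else 0)"
  proof (rule poly_mapping_eqI)
    fix V
    have "zdim V + 1 = enat n + 1 \<longleftrightarrow> zdim V = enat n"
      by (cases "zdim V") (auto simp: one_enat_def)
    then show "Poly_Mapping.lookup (dim_part (enat n) w) V =
        Poly_Mapping.lookup (if zdim W = enat n + 1 then w else 0) V"
      by (auto simp: w)
  qed
  then show ?case
    using step by (auto simp: dim_part_linear rat_equiv_zero.intros)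
qed

section \<open>Chains of subvarieties and dimension\<close>

lemma zdim_mono:
  assumes "V \<subseteq> W"
  shows "zdim V \<le> zdim W"
  unfolding zdim_def
proof (rule Sup_subset_mono, rule subsetI)
  fix m assume "m \<in> {enat n |n. \<exists>C. (\<forall>i\<le>n. subvariety (C i) V) \<and> (\<forall>i<n. C i \<subset> C (Suc i))}"
  then obtain n C where C: "m = enat n" "\<forall>i\<le>n. subvariety (C i) V" "\<forall>i<n. C i \<subset> C (Suc i)"
    by blast
  with assms have "\<forall>i\<le>n. subvariety (C i) W"
    unfolding subvariety_def by blast
  with C show "m \<in> {enat n |n. \<exists>C. (\<forall>i\<le>n. subvariety (C i) W) \<and> (\<forall>i<n. C i \<subset> C (Suc i))}"
    by blast
qed

lemma enat_Sup_attained: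
  fixes S :: "enat set"
  assumes "S \<noteq> {}" "Sup S = enat n"
  shows "Sup S \<in> S"
  using assms Max_in[of S] by (cases "finite S") (simp_all add: Sup_enat_def)

text \<open>If \<open>V\<close> were proper, a longest chain of subvarieties of \<open>V\<close>
  could be prolonged by \<open>X\<close> and would exceed the dimension of \<open>X\<close>.\<close>

lemma subvariety_full_dim:
  assumes V: "subvariety V X" and X: "variety X" and dim: "zdim V = zdim X" "zdim X = enat n"
  shows "V = X"
proof (rule ccontr)
  assume ne: "V \<noteq> X"
  let ?P = "\<lambda>Y n. \<exists>C :: nat \<Rightarrow> pt set. (\<forall>i\<le>n. subvariety (C i) Y) \<and> (\<forall>i<n. C i \<subset> C (Suc i))"
  let ?S = "{enat n |n. ?P V n}"
  have "?P V 0" using V by (intro exI[of _ "\<lambda>_. V"]) (auto simp: subvariety_def)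
  then have S: "?S \<noteq> {}" by blast
  have sup: "Sup ?S = enat n" using dim by (simp add: zdim_def)
  have "Sup ?S \<in> ?S"
    by (rule enat_Sup_attained[OF S sup])
  then have "?P V n" unfolding sup by auto
  then obtain C where C: "\<forall>i\<le>n. subvariety (C i) V" "\<forall>i<n. C i \<subset> C (Suc i)" by blast
  let ?C = "\<lambda>i. if i \<le> n then C i else X"
  have "subvariety Y X" if "subvariety Y V" for Y
    using that V by (auto simp: subvariety_def)
  moreover have "subvariety X X"
    using X by (simp add: subvariety_def)
  ultimately have "\<forall>i\<le>Suc n. subvariety (?C i) X"
    using C(1) by simp
  moreover have "C n \<subset> X"
    using C(1) V ne by (fastforce simp: subvariety_def)
  with C have "\<forall>i<Suc n. ?C i \<subset> ?C (Suc i)"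
    by (auto simp: less_Suc_eq_le le_less)
  ultimately have "?P X (Suc n)"
    by (intro exI[of _ ?C]) (rule conjI)
  then have "enat (Suc n) \<in> {enat n |n. ?P X n}"
    by (intro CollectI exI[of _ "Suc n"] conjI refl)
  then have "enat (Suc n) \<le> zdim X" unfolding zdim_def by (rule Sup_upper)
  then show False using dim by simp
qed

section \<open>Morphisms of projective varieties\<close>

text \<open>What remains of membership in \<open>proj_space N\<close> when the bound
  \<open>N\<close> is forgotten, so that the Segre map can be studied without tracking ambient
  dimensions.\<close>

definition normalised :: "pt \<Rightarrow> bool" where
  "normalised x \<longleftrightarrow> (\<exists>i. x i = 1 \<and> (\<forall>j<i. x j = 0))"

definition leading :: "pt \<Rightarrow> nat" where
  "leading x = (LEAST i. x i \<noteq> 0)"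

lemma leading_eqI:
  assumes "x i \<noteq> 0" "\<forall>j<i. x j = 0"
  shows "leading x = i"
  unfolding leading_def by (rule Least_equality) (use assms not_less in auto)

lemma normalised_leading:
  assumes "normalised x"
  shows "x (leading x) = 1" "j < leading x \<Longrightarrow> x j = 0"
proof -
  obtain i where i: "x i = 1" "\<forall>j<i. x j = 0"
    using assms by (auto simp: normalised_def)
  then have "leading x = i"
    by (intro leading_eqI) auto
  with i show "x (leading x) = 1" "j < leading x \<Longrightarrow> x j = 0"
    by auto
qed

lemma nrm_scaled:
  assumes "normalised x" "c \<noteq> 0"
  shows "nrm (\<lambda>i. x i * c) = x"
proof -
  have "leading (\<lambda>i. x i * c) = leading x"
    using assms normalised_leading[OF assms(1)] by (intro leading_eqI) auto
  then show ?thesis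
    using assms normalised_leading[OF assms(1)] by (simp add: nrm_def leading_def[symmetric])
qed

lemma zclosed_normalised: "zclosed X \<Longrightarrow> x \<in> X \<Longrightarrow> normalised x"
  by (auto simp: zclosed_def proj_space_def normalised_def)

lemma variety_normalised: "variety X \<Longrightarrow> x \<in> X \<Longrightarrow> normalised x"
  by (auto simp: variety_def intro: zclosed_normalised)

text \<open>\<open>prod_encode (i, j)\<close> is \<open>triangle (i + j) + i\<close>, and both
  summands grow with the indices. The pair of leading indices therefore has the least code among the
  nonzero coordinates of a Segre image.\<close>

lemma prod_encode_mono:
  assumes "i \<le> i'" "j \<le> j'"
  shows "prod_encode (i, j) \<le> prod_encode (i', j')"
proof -
  have "triangle (i + j) \<le> triangle (i' + j')"
    unfolding triangle_def by (rule div_le_mono, rule mult_le_mono) (use assms in simp_all)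
  then show ?thesis
    using assms by (simp add: prod_encode_def)
qed

lemma segre_encode [simp]: "segre x y (prod_encode (i, j)) = x i * y j"
  by (simp add: segre_def)

lemma segre_normalised:
  assumes "normalised x" "normalised y"
  shows "normalised (segre x y)"
proof -
  let ?k = "prod_encode (leading x, leading y)"
  have "segre x y k = 0" if k: "k < ?k" for k
  proof -
    obtain i j where ij: "k = prod_encode (i, j)"
      by (metis prod_decode_inverse surj_pair)
    have "i < leading x \<or> j < leading y"
      using k prod_encode_mono[of "leading x" i "leading y" j] ij by force
    then show ?thesis
      using assms by (auto simp: ij normalised_leading)
  qed
  moreover have "segre x y ?k = 1"
    using assms by (simp add: normalised_leading)
  ultimately show ?thesis
    unfolding normalised_def by blast
qed

text \<open>The nonzero coordinates determine both leading indices; since the leading coordinates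
  are 1, the column and the row through them are the two vectors themselves.\<close>

lemma segre_inject:
  assumes n: "normalised x" "normalised y" "normalised x'" "normalised y'"
    and eq: "segre x y = segre x' y'"
  shows "x = x' \<and> y = y'"
proof -
  have e: "x i * y j = x' i * y' j" for i j
    using fun_cong[OF eq, of "prod_encode (i, j)"] by simp
  have "x' (leading x) \<noteq> 0" "y' (leading y) \<noteq> 0" "x (leading x') \<noteq> 0" "y (leading y') \<noteq> 0"
    using e[of "leading x" "leading y"] e[of "leading x'" "leading y'"] n
    by (auto simp: normalised_leading)
  then have "\<not> leading x < leading x'" "\<not> leading y < leading y'"
    "\<not> leading x' < leading x" "\<not> leading y' < leading y"
    using normalised_leading(2)[OF n(3)] normalised_leading(2)[OF n(4)]
      normalised_leading(2)[OF n(1)] normalised_leading(2)[OF n(2)] by blast+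
  then have l: "leading x' = leading x" "leading y' = leading y"
    by simp_all
  have one: "x (leading x) = 1" "y (leading y) = 1" "x' (leading x) = 1" "y' (leading y) = 1"
    using n[THEN normalised_leading(1)] l by simp_all
  have "x i = x' i" "y i = y' i" for i
    using e[of i "leading y"] e[of "leading x" i] one by simp_all
  then show ?thesis by auto
qed

lemma segre_inj_on:
  assumes "variety X" "variety Y"
  shows "inj_on (\<lambda>(x, y). segre x y) (X \<times> Y)"
proof (rule inj_onI, clarify)
  fix x y x' y' assume a: "x \<in> X" "y \<in> Y" "x' \<in> X" "y' \<in> Y" "segre x y = segre x' y'"
  show "x = x' \<and> y = y'"
    by (rule segre_inject) (use a assms in \<open>auto intro: variety_normalised\<close>)
qed

lemma pr_segre:
  assumes "variety X" "variety Y" "x \<in> X" "y \<in> Y"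
  shows "pr1 X Y (segre x y) = x" "pr2 X Y (segre x y) = y"
proof -
  have "inv_into (X \<times> Y) (\<lambda>(x, y). segre x y) (segre x y) = (x, y)"
    using inv_into_f_f[OF segre_inj_on[OF assms(1,2)], of "(x, y)"] assms by simp
  then show "pr1 X Y (segre x y) = x" "pr2 X Y (segre x y) = y"
    by (simp_all add: pr1_def pr2_def)
qed

section \<open>Zero sets, projections and the diagonal map\<close>

definition var :: "nat \<Rightarrow> mpoly" where
  "var k = Poly_Mapping.single (Poly_Mapping.single k 1) 1"

lemma peval_var [simp]: "peval (var k) x = x k"
  by (simp add: peval_def var_def)

lemma homogeneous_var: "homogeneous (Suc 0) (var k)"
  by (simp add: homogeneous_def var_def)

lemma zclosed_Int_zero_set:
  assumes "zclosed X" "\<forall>p\<in>F. \<exists>d. homogeneous d p"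
  shows "zclosed {x \<in> X. \<forall>p\<in>F. peval p x = 0}"
proof -
  obtain N G where G: "\<forall>p\<in>G. \<exists>d. homogeneous d p" "X = {x \<in> proj_space N. \<forall>p\<in>G. peval p x = 0}"
    using assms(1) by (auto simp: zclosed_def)
  then have "{x \<in> X. \<forall>p\<in>F. peval p x = 0} = {x \<in> proj_space N. \<forall>p\<in>F \<union> G. peval p x = 0}"
    by auto
  moreover have "\<forall>p\<in>F \<union> G. \<exists>d. homogeneous d p"
    using G(1) assms(2) by blast
  ultimately show ?thesis
    unfolding zclosed_def by (intro exI[of _ N] exI[of _ "F \<union> G"] conjI)
qed

lemma zclosed_empty: "zclosed {}"
proof -
  \<comment> \<open>The only point of \<open>proj_space 0\<close> has coordinate 1 at index 0, where
    \<open>var 0\<close> does not vanish.\<close>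
  have "{} = {x \<in> proj_space 0. \<forall>p\<in>{var 0}. peval p x = 0}"
    by (auto simp: proj_space_def)
  moreover have "\<forall>p\<in>{var 0}. \<exists>d. homogeneous d p"
    using homogeneous_var by blast
  ultimately show ?thesis
    unfolding zclosed_def by (intro exI[of _ 0] exI[of _ "{var 0}"] conjI)
qed

lemma zopenin_self: "zopenin X X"
  by (simp add: zopenin_def zclosed_empty)

lemma smooth_projective_variety: "smooth_projective X \<Longrightarrow> variety X"
  by (simp add: smooth_projective_def)

text \<open>Covers both projections at once, with \<open>c x y\<close> the other factor. Once a
  nonzero coordinate \<open>k\<close> of that factor is frozen, the Segre coordinates
  \<open>e i k\<close> are proportional to those of \<open>f\<close>, so linear forms define
  \<open>f\<close> on the open set where not all of them vanish.\<close>

lemma morphism_projection: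
  assumes XY: "zclosed (X \<boxtimes> Y)"
    and f: "\<And>x y. x \<in> X \<Longrightarrow> y \<in> Y \<Longrightarrow> f (segre x y) \<in> Z \<and> normalised (f (segre x y))"
    and fix_coord: "\<And>x y. x \<in> X \<Longrightarrow> y \<in> Y \<Longrightarrow> \<exists>k. c x y k \<noteq> 0"
    and e: "\<And>x y i k. x \<in> X \<Longrightarrow> y \<in> Y \<Longrightarrow> segre x y (e i k) = f (segre x y) i * c x y k"
  shows "morphism (X \<boxtimes> Y) Z f"
  unfolding morphism_def
proof (intro conjI ballI)
  show "f ` (X \<boxtimes> Y) \<subseteq> Z"
    using f by (auto simp: pprod_def)
  fix w assume "w \<in> X \<boxtimes> Y"
  then obtain x y where xy: "x \<in> X" "y \<in> Y" "w = segre x y"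
    by (auto simp: pprod_def)
  obtain k where k: "c x y k \<noteq> 0"
    using fix_coord xy by blast
  let ?Z = "{w \<in> X \<boxtimes> Y. \<forall>p\<in>range (\<lambda>i. var (e i k)). peval p w = 0}"
  define U where "U = X \<boxtimes> Y - ?Z"
  have "zclosed ?Z"
    by (rule zclosed_Int_zero_set[OF XY]) (use homogeneous_var in blast)
  moreover have "X \<boxtimes> Y - U = ?Z"
    unfolding U_def by blast
  ultimately have U: "zopenin (X \<boxtimes> Y) U"
    unfolding zopenin_def U_def by simp
  have w: "w \<in> U"
  proof -
    have "f w (leading (f w)) = 1"
      using f[OF xy(1,2)] xy(3) by (simp add: normalised_leading)
    then have "w (e (leading (f w)) k) \<noteq> 0"
      using e[OF xy(1,2)] k xy(3) by simp
    with \<open>w \<in> X \<boxtimes> Y\<close> show ?thesis by (auto simp: U_def)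
  qed
  have all: "\<forall>v\<in>U. (\<exists>i. peval (var (e i k)) v \<noteq> 0) \<and> f v = nrm (\<lambda>i. peval (var (e i k)) v)"
  proof
    fix v assume v: "v \<in> U"
    obtain a b where ab: "a \<in> X" "b \<in> Y" "v = segre a b"
      using v by (auto simp: pprod_def U_def)
    have nz: "\<exists>i. v (e i k) \<noteq> 0"
      using v by (auto simp: U_def)
    then have "c a b k \<noteq> 0"
      using e[OF ab(1,2)] ab(3) by auto
    then have "nrm (\<lambda>i. f v i * c a b k) = f v"
      using f[OF ab(1,2)] ab(3) by (intro nrm_scaled) auto
    then show "(\<exists>i. peval (var (e i k)) v \<noteq> 0) \<and> f v = nrm (\<lambda>i. peval (var (e i k)) v)"
      using nz e[OF ab(1,2)] ab(3) by simp
  qed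
  have hom: "\<forall>i. homogeneous (Suc 0) (var (e i k))"
    by (simp add: homogeneous_var)
  show "\<exists>U d G. zopenin (X \<boxtimes> Y) U \<and> w \<in> U \<and> (\<forall>i. homogeneous d (G i)) \<and>
      (\<forall>y\<in>U. (\<exists>i. peval (G i) y \<noteq> 0) \<and> f y = nrm (\<lambda>i. peval (G i) y))"
    by (rule exI[of _ U], rule exI[of _ "Suc 0"], rule exI[of _ "\<lambda>i. var (e i k)"])
       (rule conjI[OF U conjI[OF w conjI[OF hom all]]])
qed

lemma
  assumes "variety X" "variety Y" "zclosed (X \<boxtimes> Y)"
  shows morphism_pr1: "morphism (X \<boxtimes> Y) X (pr1 X Y)"
    and morphism_pr2: "morphism (X \<boxtimes> Y) Y (pr2 X Y)"
proof -
  note pr = pr_segre[OF assms(1,2)]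
  have lead: "normalised x" "\<exists>k. x k \<noteq> 0" if "x \<in> X \<or> x \<in> Y" for x
  proof -
    show n: "normalised x"
      using that variety_normalised[OF assms(1)] variety_normalised[OF assms(2)] by blast
    show "\<exists>k. x k \<noteq> 0"
      by (rule exI[of _ "leading x"]) (simp add: normalised_leading(1)[OF n])
  qed
  show "morphism (X \<boxtimes> Y) X (pr1 X Y)"
  proof (rule morphism_projection[OF assms(3), where e = "\<lambda>i k. prod_encode (i, k)" and c = "\<lambda>x y. y"])
    fix x y assume xy: "x \<in> X" "y \<in> Y"
    show "pr1 X Y (segre x y) \<in> X \<and> normalised (pr1 X Y (segre x y))"
      unfolding pr[OF xy] using lead(1)[of x] xy by blast
    show "\<exists>k. y k \<noteq> 0"
      using lead(2)[of y] xy by blast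
    show "segre x y (prod_encode (i, k)) = pr1 X Y (segre x y) i * y k" for i k
      unfolding pr[OF xy] segre_encode by (rule refl)
  qed
  show "morphism (X \<boxtimes> Y) Y (pr2 X Y)"
  proof (rule morphism_projection[OF assms(3), where e = "\<lambda>i k. prod_encode (k, i)" and c = "\<lambda>x y. x"])
    fix x y assume xy: "x \<in> X" "y \<in> Y"
    show "pr2 X Y (segre x y) \<in> Y \<and> normalised (pr2 X Y (segre x y))"
      unfolding pr[OF xy] using lead(1)[of y] xy by blast
    show "\<exists>k. x k \<noteq> 0"
      using lead(2)[of x] xy by blast
    show "segre x y (prod_encode (k, i)) = pr2 X Y (segre x y) i * x k" for i k
      unfolding pr[OF xy] segre_encode by (rule mult.commute)
  qed
qed

lemma morphism_diag:
  assumes "variety X"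
  shows "morphism X (X \<boxtimes> X) diag"
proof -
  \<comment> \<open>The monomials of degree 2. For \<open>i = j\<close> the two exponents merge into
    a square, hence the case distinctions below.\<close>
  define G :: "nat \<Rightarrow> mpoly" where "G = (\<lambda>k. case prod_decode k of (i, j) \<Rightarrow>
      Poly_Mapping.single (Poly_Mapping.single i 1 + Poly_Mapping.single j 1) 1)"
  have G: "peval (G k) x = segre x x k" for k x
  proof -
    obtain i j where ij: "prod_decode k = (i, j)" by (rule prod.exhaust)
    have "Poly_Mapping.keys (Poly_Mapping.single i 1 + Poly_Mapping.single j (1::nat)) = {i, j}"
      by (auto simp: in_keys_iff lookup_add lookup_single when_def split: if_splits)
    then show ?thesis
      by (cases "i = j") (simp_all add: G_def ij segre_def peval_def lookup_add lookup_single power2_eq_square)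
  qed
  have hom: "\<forall>k. homogeneous 2 (G k)"
  proof
    fix k
    obtain i j where ij: "prod_decode k = (i, j)" by (rule prod.exhaust)
    have "Poly_Mapping.keys (Poly_Mapping.single i 1 + Poly_Mapping.single j (1::nat)) = {i, j}"
      by (auto simp: in_keys_iff lookup_add lookup_single when_def split: if_splits)
    then show "homogeneous 2 (G k)"
      by (cases "i = j") (simp_all add: G_def ij homogeneous_def lookup_add lookup_single)
  qed
  have all: "\<forall>x\<in>X. (\<exists>i. peval (G i) x \<noteq> 0) \<and> segre x x = nrm (\<lambda>i. peval (G i) x)"
  proof
    fix x assume "x \<in> X"
    then have n: "normalised (segre x x)"
      using segre_normalised variety_normalised[OF assms] by blast
    have "nrm (segre x x) = segre x x" "segre x x (leading (segre x x)) \<noteq> 0"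
      using nrm_scaled[OF n, of 1] normalised_leading(1)[OF n] by simp_all
    then show "(\<exists>i. peval (G i) x \<noteq> 0) \<and> segre x x = nrm (\<lambda>i. peval (G i) x)"
      unfolding G by metis
  qed
  show ?thesis
    unfolding morphism_def
  proof (intro conjI ballI)
    show "diag ` X \<subseteq> X \<boxtimes> X"
      by (auto simp: pprod_def)
    fix x assume x: "x \<in> X"
    show "\<exists>U d G. zopenin X U \<and> x \<in> U \<and> (\<forall>i. homogeneous d (G i)) \<and>
        (\<forall>y\<in>U. (\<exists>i. peval (G i) y \<noteq> 0) \<and> segre y y = nrm (\<lambda>i. peval (G i) y))"
      by (rule exI[of _ X], rule exI[of _ 2], rule exI[of _ G])
         (rule conjI[OF zopenin_self conjI[OF x conjI[OF hom all]]])
  qed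
qed

subsection \<open>Push-forward of cycles\<close>

lemma push_cyc_supset:
  assumes "finite S" "Poly_Mapping.keys z \<subseteq> S"
  shows "push_cyc f z = (\<Sum>V\<in>S. smul (Poly_Mapping.lookup z V) (push_prime f V))"
  unfolding push_cyc_def using assms
  by (intro sum.mono_neutral_left) (auto simp: in_keys_iff)

lemma push_cyc_add: "push_cyc f (u + v) = push_cyc f u + push_cyc f v"
proof -
  let ?S = "Poly_Mapping.keys u \<union> Poly_Mapping.keys v"
  have S: "finite ?S" "Poly_Mapping.keys (u + v) \<subseteq> ?S"
    using Poly_Mapping.keys_add[of u v] by auto
  show ?thesis
    using S by (simp add: push_cyc_supset[of ?S] lookup_add cyc.scale_left_distrib sum.distrib)
qed

lemma push_cyc_smul: "push_cyc f (smul q u) = smul q (push_cyc f u)"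
proof -
  have S: "Poly_Mapping.keys (smul q u) \<subseteq> Poly_Mapping.keys u"
    by (auto simp: in_keys_iff)
  then show ?thesis
    unfolding push_cyc_supset[OF finite_keys S] by (simp add: push_cyc_def cyc.scale_sum_right)
qed

lemma push_cyc_diff: "push_cyc f (u - v) = push_cyc f u - push_cyc f v"
  using push_cyc_add[of f "u - v" v] by (simp add: algebra_simps)

lemma push_cyc_single [simp]: "push_cyc f (prime_cycle V) = push_prime f V"
  by (simp add: push_cyc_def)

lemma push_cyc_keys:
  assumes "W \<in> Poly_Mapping.keys (push_cyc f z)"
  shows "\<exists>V\<in>Poly_Mapping.keys z. W = f ` V \<and> zdim W = zdim V"
proof -
  obtain V where V: "V \<in> Poly_Mapping.keys z" "Poly_Mapping.lookup (push_prime f V) W \<noteq> 0"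
    using assms by (force simp: in_keys_iff push_cyc_def lookup_sum intro: sum.neutral)
  then have "W = f ` V \<and> zdim W = zdim V"
    by (auto simp: push_prime_def lookup_single when_def split: if_splits)
  with V show ?thesis by blast
qed

lemma map_degree_inj_on:
  assumes "inj_on f V" "V \<noteq> {}"
  shows "map_degree f V = 1"
proof -
  have fib: "{x \<in> V. f x = y} = {the_inv_into V f y}" if "y \<in> f ` V" for y
    using that assms(1) by (auto simp: the_inv_into_f_f inj_on_eq_iff)
  show ?thesis
    unfolding map_degree_def
  proof (rule the_equality)
    show "\<exists>U. zopenin (f ` V) U \<and> U \<noteq> {} \<and>
        (\<forall>y\<in>U. finite {x \<in> V. f x = y} \<and> card {x \<in> V. f x = y} = 1)"
      \<comment> \<open>The open set is the whole image: \<open>zopenin\<close> speaks of the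
        complement, which is empty.\<close>
      using assms(2) zopenin_self[of "f ` V"] by (intro exI[of _ "f ` V"]) (auto simp: fib)
    fix n assume "\<exists>U. zopenin (f ` V) U \<and> U \<noteq> {} \<and>
        (\<forall>y\<in>U. finite {x \<in> V. f x = y} \<and> card {x \<in> V. f x = y} = n)"
    then obtain U where "U \<subseteq> f ` V" "U \<noteq> {}" "\<forall>y\<in>U. card {x \<in> V. f x = y} = n"
      unfolding zopenin_def by blast
    then obtain y where "y \<in> f ` V" "card {x \<in> V. f x = y} = n"
      by blast
    then show "n = 1" by (simp add: fib)
  qed
qed

text \<open>Meant for maps such as \<open>pr2 X X \<circ> diag\<close>, which agree with the
  identity only on \<open>X\<close>.\<close>

lemma push_cyc_identity:
  assumes "z \<in> cycles X" "\<And>x. x \<in> X \<Longrightarrow> f x = x"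
  shows "push_cyc f z = z"
proof -
  have "push_prime f V = prime_cycle V" if "V \<in> Poly_Mapping.keys z" for V
  proof -
    have V: "V \<subseteq> X" "V \<noteq> {}"
      using that assms(1) by (auto simp: cycles_def subvariety_def variety_def)
    then have f: "\<And>x. x \<in> V \<Longrightarrow> f x = x"
      using assms(2) by blast
    have "f ` V = V" "inj_on f V"
      using f by (auto simp: inj_on_def image_iff)
    then show ?thesis
      using map_degree_inj_on[OF _ V(2)] by (simp add: push_prime_def)
  qed
  then have "push_cyc f z = (\<Sum>V\<in>Poly_Mapping.keys z. smul (Poly_Mapping.lookup z V) (prime_cycle V))"
    by (simp add: push_cyc_def)
  also have "\<dots> = z"
    by (rule poly_mapping_eqI)
       (simp add: lookup_sum lookup_single when_def in_keys_iff sum.delta if_distrib cong: if_cong)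
  finally show ?thesis .
qed

context intersection_theory
begin

lemma push_cls:
  assumes "smooth_projective X" "smooth_projective Y" "morphism X Y f"
  shows "push Y f (cls X z) = cls Y (push_cyc f z)"
proof -
  have "cls Y (push_cyc f w) = cls Y (push_cyc f z)" if "w \<in> cls X z" for w
  proof -
    have "w - z \<in> rat_equiv_zero X"
      using that by (simp add: cls_def)
    from push_rat_equiv[OF assms this] show ?thesis
      by (simp add: cls_eq_iff push_cyc_diff)
  qed
  then show ?thesis
    unfolding push_def using cls_self[of z X] by blast
qed

lemma push_linear:
  assumes "smooth_projective X" "smooth_projective Y" "morphism X Y f"
    and "a \<in> range (cls X)" "b \<in> range (cls X)"
  shows "push Y f (a +\<^sub>C b) = push Y f a +\<^sub>C push Y f b"
    and "push Y f (a -\<^sub>C b) = push Y f a -\<^sub>C push Y f b"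
    and "push Y f (q *\<^sub>C a) = q *\<^sub>C push Y f a"
    and "push Y f a \<in> range (cls Y)"
proof -
  obtain u v where "a = cls X u" "b = cls X v"
    using assms(4,5) by blast
  then show "push Y f (a +\<^sub>C b) = push Y f a +\<^sub>C push Y f b"
    "push Y f (a -\<^sub>C b) = push Y f a -\<^sub>C push Y f b"
    "push Y f (q *\<^sub>C a) = q *\<^sub>C push Y f a" "push Y f a \<in> range (cls Y)"
    by (simp_all add: push_cls[OF assms(1-3)] push_cyc_add push_cyc_diff push_cyc_smul)
qed

end

section \<open>Correspondences\<close>

lemma fund_in_Chow: "variety X \<Longrightarrow> fund X \<in> Chow X 0"
  by (auto simp: Chow_def fund_def cycles_def subvariety_def zero_enat_def[symmetric] intro!: imageI)

lemma smooth_projective_zdim: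
  assumes "smooth_projective X"
  obtains n where "zdim X = enat n"
proof -
  have "X \<noteq> {}"
    using assms by (simp add: smooth_projective_def variety_def)
  then show thesis
    using assms that by (auto simp: smooth_projective_def smooth_at_def)
qed

text \<open>Otherwise \<open>X\<close> would have codimension one in a subvariety of
  \<open>X\<close>, against monotonicity of the dimension.\<close>

lemma fund_nonzero:
  assumes "zdim X = enat n"
  shows "fund X \<noteq> czero X"
proof
  assume "fund X = czero X"
  then have "prime_cycle X \<in> rat_equiv_zero X"
    by (simp add: fund_def czero_def cls_eq_iff)
  then obtain W where W: "subvariety W X" "zdim X + 1 = zdim W"
    using rat_equiv_zero_keys[of _ X X] by (force simp: in_keys_iff)
  have "zdim W \<le> zdim X"
    using W(1) by (intro zdim_mono) (simp add: subvariety_def)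
  then show False
    using W(2)[symmetric] assms by (simp add: one_enat_def)
qed

text \<open>A component of codimension zero has full dimension and hence is \<open>X\<close>. This
  turns degrees into scalars: \<open>T 0\<close> of a class in \<open>Chow X 4\<close> will be a
  multiple of \<open>fund X\<close>.\<close>

lemma Chow_zero_multiple:
  assumes X: "variety X" "zdim X = enat n" and a: "a \<in> Chow X 0"
  shows "\<exists>q. a = q *\<^sub>C fund X"
proof -
  obtain z where z: "a = cls X z" "z \<in> cycles X" "\<forall>V\<in>Poly_Mapping.keys z. zdim V + enat 0 = zdim X"
    using a by (auto simp: Chow_def)
  have V: "V = X" if "V \<in> Poly_Mapping.keys z" for V
    using subvariety_full_dim[OF _ X(1) _ X(2)] z that by (auto simp: cycles_def zero_enat_def[symmetric])
  have "z = smul (Poly_Mapping.lookup z X) (prime_cycle X)"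
    using V by (intro poly_mapping_eqI) (auto simp: lookup_single when_def in_keys_iff)
  then show ?thesis
    unfolding z(1) fund_def cscale_cls by metis
qed

lemma Chow_above_dim:
  assumes "zdim X = enat n" "n < i" "a \<in> Chow X i"
  shows "a = czero X"
proof -
  obtain z where z: "a = cls X z" "\<forall>V\<in>Poly_Mapping.keys z. zdim V + enat i = zdim X"
    using assms(3) by (auto simp: Chow_def)
  have "zdim V + enat i \<noteq> zdim X" for V
    using assms(1,2) by (cases "zdim V") auto
  then have "Poly_Mapping.keys z = {}"
    using z(2) by blast
  then show ?thesis
    by (simp add: z(1) czero_def)
qed

lemma czero_in_total [simp]: "czero X \<in> Chow_total X"
  using Chow_closed(3) Chow_subset_total by blast

lemma cscale_0: "a \<in> range (cls X) \<Longrightarrow> 0 *\<^sub>C a = czero X"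
  by (rule cls_eqI[of _ X]) simp_all

section \<open>Linearity of the intersection product in both arguments\<close>

context intersection_theory
begin

lemma dot_scale_right:
  assumes "smooth_projective X" "a \<in> Chow_total X" "b \<in> Chow_total X"
  shows "dot X a (q *\<^sub>C b) = q *\<^sub>C dot X a b"
  using assms by (simp add: dot_commute[OF assms(1,2)] dot_scale)

lemma dot_right:
  assumes "smooth_projective X" "a \<in> Chow_total X" "b \<in> Chow_total X" "c \<in> Chow_total X"
  shows "dot X a (b +\<^sub>C c) = dot X a b +\<^sub>C dot X a c"
    and "dot X a (b -\<^sub>C c) = dot X a b -\<^sub>C dot X a c"
    and "dot X (b -\<^sub>C c) a = dot X b a -\<^sub>C dot X c a"
proof -
  note comm = dot_commute[OF assms(1,2)]
  show add: "dot X a (b +\<^sub>C c) = dot X a b +\<^sub>C dot X a c"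
    using assms by (simp add: comm dot_add)
  have tot: "dot X b a \<in> range (cls X)" "dot X c a \<in> range (cls X)"
    using assms dot_closed by (blast intro: Chow_total_range)+
  have bc: "b -\<^sub>C c = b +\<^sub>C (-1) *\<^sub>C c"
    using assms by (intro csub_conv_cadd[of _ X]) simp_all
  show l: "dot X (b -\<^sub>C c) a = dot X b a -\<^sub>C dot X c a"
    unfolding bc csub_conv_cadd[OF tot] using assms by (simp add: dot_add dot_scale)
  show "dot X a (b -\<^sub>C c) = dot X a b -\<^sub>C dot X a c"
    using l comm[of "b -\<^sub>C c"] comm[of b] comm[of c] assms by simp
qed

lemma dot_czero:
  assumes "smooth_projective X" "a \<in> Chow_total X"
  shows "dot X (czero X) a = czero X" "dot X a (czero X) = czero X"
proof -
  have "dot X (czero X) a = dot X (0 *\<^sub>C czero X) a"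
    by (subst cscale_0) simp_all
  also have "\<dots> = czero X"
    using assms by (subst dot_scale) (auto intro!: cscale_0 Chow_total_range dot_closed)
  finally show "dot X (czero X) a = czero X" .
  then show "dot X a (czero X) = czero X"
    using dot_commute[OF assms, of "czero X"] by simp
qed

end

section \<open>The square of \<open>X\<close>, its projections and its diagonal\<close>

locale correspondences = intersection_theory +
  fixes X :: "pt set"
  assumes smooth: "smooth_projective X"
begin

abbreviation XX :: "pt set" where "XX \<equiv> X \<boxtimes> X"

lemma smooth_square: "smooth_projective XX"
  by (rule smooth_pprod[OF smooth smooth])

lemma variety: "variety X"
  by (rule smooth_projective_variety[OF smooth])

lemma zclosed_square: "zclosed XX"
  using smooth_projective_variety[OF smooth_square] by (simp add: variety_def)

lemmas pr1_morphism = morphism_pr1[OF variety variety zclosed_square]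
lemmas pr2_morphism = morphism_pr2[OF variety variety zclosed_square]
lemmas diag_morphism = morphism_diag[OF variety]

lemma pr_diag:
  assumes "x \<in> X"
  shows "(pr1 X X \<circ> diag) x = x" "(pr2 X X \<circ> diag) x = x"
  using assms by (simp_all add: pr_segre variety)

lemma pull_diag_first:
  assumes "a \<in> Chow_total X"
  shows "pull dot X XX diag (first dot X a) = a"
proof -
  \<comment> \<open>\<open>pull\<close> sees a map only through its graph, so agreement with
    \<open>id\<close> on \<open>X\<close> is enough.\<close>
  have "graph X (pr1 X X \<circ> diag) = graph X id"
    unfolding graph_def by (rule Collect_cong) (metis pr_diag(1) id_apply)
  then have "pull dot X X (pr1 X X \<circ> diag) a = pull dot X X id a"
    by (simp add: pull_def)
  then show ?thesis
    using pull_comp[OF smooth smooth_square smooth diag_morphism pr1_morphism assms] pull_id[OF smooth assms]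
    by (simp add: first_def)
qed

lemma push_pr2_diag:
  assumes "a \<in> Chow_total X"
  shows "push X (pr2 X X) (push XX diag a) = a"
proof -
  obtain z where z: "a = cls X z" "z \<in> cycles X"
    using assms by (auto simp: Chow_total_def)
  \<comment> \<open>\<open>push\<close> runs over all representatives. Each of them is a cycle on
    \<open>X\<close>, because rationally trivial cycles are.\<close>
  have "push_cyc (pr2 X X \<circ> diag) w = w" if "w \<in> a" for w
  proof (rule push_cyc_identity)
    have "(w - z) + z \<in> cycles X"
      using that z rat_equiv_zero_subset_cycles[of X] by (intro cycles_closed) (auto simp: cls_def)
    then show "w \<in> cycles X" by simp
  qed (rule pr_diag)
  then have "push X (pr2 X X \<circ> diag) a = (\<Union>w\<in>a. cls X w)"
    by (simp add: push_def)
  also have "\<dots> = a"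
    unfolding z(1) by (auto simp: mem_cls_iff)
  finally show ?thesis
    using push_comp[OF smooth smooth_square smooth diag_morphism pr2_morphism assms] by simp
qed

lemma fund_total: "fund X \<in> Chow_total X"
  using fund_in_Chow[OF variety] Chow_subset_total by blast

text \<open>Projecting back to \<open>X\<close> shows that \<open>push XX diag (fund X)\<close> is nonzero; by the definition of
  \<open>push_prime\<close> this forces \<open>zdim (diag ` X) = zdim X\<close>.\<close>

lemma push_diag_fund:
  shows "zdim (diag ` X) = zdim X" and "push XX diag (fund X) = diag_class X"
proof -
  obtain n where n: "zdim X = enat n"
    by (rule smooth_projective_zdim[OF smooth])
  have push: "push XX diag (fund X) = cls XX (push_prime diag X)"
    by (simp add: fund_def push_cls[OF smooth smooth_square diag_morphism])
  show dim: "zdim (diag ` X) = zdim X"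
  proof (rule ccontr)
    assume "zdim (diag ` X) \<noteq> zdim X"
    then have "fund X = push X (pr2 X X) (cls XX 0)"
      using push_pr2_diag[OF fund_total] push by (simp add: push_prime_def)
    also have "\<dots> = czero X"
      by (simp add: push_cls[OF smooth_square smooth pr2_morphism] push_cyc_def czero_def)
    finally show False
      using fund_nonzero[OF n] by simp
  qed
  have "inj_on diag X"
    by (rule inj_on_inverseI[where g = "pr1 X X"]) (use pr_diag(1) in simp)
  then have "map_degree diag X = 1"
    using variety by (intro map_degree_inj_on) (auto simp: variety_def)
  then show "push XX diag (fund X) = diag_class X"
    using dim push by (simp add: push_prime_def diag_class_def)
qed

text \<open>Both factors have dimension \<open>n\<close>; the diagonal, of dimension \<open>n\<close> and nonzero, has codimension
  \<open>n\<close> in the product.\<close>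

lemma zdim_square:
  assumes n: "zdim X = enat n" and diag: "diag_class X \<in> Chow XX n"
  shows "zdim XX = enat (2 * n)"
proof (rule ccontr)
  assume ne: "zdim XX \<noteq> enat (2 * n)"
  obtain z where z: "diag_class X = cls XX z" "\<forall>V\<in>Poly_Mapping.keys z. zdim V + enat n = zdim XX"
    using diag by (auto simp: Chow_def)
  \<comment> \<open>Were the dimension of \<open>XX\<close> not \<open>2 * n\<close>, the
    representative \<open>z\<close> of codimension \<open>n\<close> would have no part of dimension
    \<open>n\<close>. Comparing parts of that dimension would then make the diagonal rationally
    trivial, and so \<open>fund X\<close> zero.\<close>
  have "zdim V \<noteq> enat n" if "V \<in> Poly_Mapping.keys z" for V
    using z(2) ne that by (auto simp: mult_2)
  then have "dim_part (enat n) z = 0"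
    by (intro poly_mapping_eqI) (auto simp: in_keys_iff)
  moreover have "dim_part (enat n) (prime_cycle (diag ` X)) = prime_cycle (diag ` X)"
    using push_diag_fund(1) n by (simp add: dim_part_homogeneous[of _ "enat n"])
  moreover have "prime_cycle (diag ` X) - z \<in> rat_equiv_zero XX"
    using z(1) by (simp add: diag_class_def cls_eq_iff)
  then have "dim_part (enat n) (prime_cycle (diag ` X) - z) \<in> rat_equiv_zero XX"
    by (rule dim_part_rat_equiv_zero)
  ultimately have "prime_cycle (diag ` X) \<in> rat_equiv_zero XX"
    by (simp add: dim_part_linear)
  then have "push XX diag (fund X) = cls XX 0"
    by (simp add: push_diag_fund(2) diag_class_def cls_eq_iff)
  then have "fund X = push X (pr2 X X) (cls XX 0)"
    using push_pr2_diag[OF fund_total] by simp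
  then have "fund X = czero X"
    by (simp add: push_cls[OF smooth_square smooth pr2_morphism] push_cyc_def czero_def)
  with fund_nonzero[OF n] show False ..
qed

section \<open>The calculus of correspondences\<close>

lemma first_graded: "a \<in> Chow X i \<Longrightarrow> first dot X a \<in> Chow XX i"
  unfolding first_def by (rule pull_graded[OF smooth_square smooth pr1_morphism])

lemma second_graded: "a \<in> Chow X i \<Longrightarrow> second dot X a \<in> Chow XX i"
  unfolding second_def by (rule pull_graded[OF smooth_square smooth pr2_morphism])

lemma first_total: "a \<in> Chow X i \<Longrightarrow> first dot X a \<in> Chow_total XX"
  by (rule Chow_subset_total[OF first_graded])

lemma second_total: "a \<in> Chow X i \<Longrightarrow> second dot X a \<in> Chow_total XX"
  by (rule Chow_subset_total[OF second_graded])

lemma diag_pull_graded: "\<Gamma> \<in> Chow XX i \<Longrightarrow> diag_pull dot X \<Gamma> \<in> Chow X i"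
  unfolding diag_pull_def by (rule pull_graded[OF smooth smooth_square diag_morphism])

lemma corr_alt: "corr dot X \<Gamma> Z = push X (pr2 X X) (dot XX \<Gamma> (first dot X Z))"
  by (simp add: corr_def first_def)

lemma square_dot: "a \<in> Chow_total XX \<Longrightarrow> b \<in> Chow_total XX \<Longrightarrow> dot XX a b \<in> Chow_total XX"
  by (rule dot_closed[OF smooth_square])

lemma
  assumes \<Gamma>: "\<Gamma> \<in> Chow_total XX" and Z: "Z \<in> Chow X i"
  shows corr_range: "corr dot X \<Gamma> Z \<in> range (cls X)"
    and corr_scale_left: "corr dot X (q *\<^sub>C \<Gamma>) Z = q *\<^sub>C corr dot X \<Gamma> Z"
    and corr_scale_right: "corr dot X \<Gamma> (q *\<^sub>C Z) = q *\<^sub>C corr dot X \<Gamma> Z"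
proof -
  note P = first_total[OF Z]
  have r: "dot XX \<Gamma> (first dot X Z) \<in> range (cls XX)"
    using square_dot[OF \<Gamma> P] by simp
  note push = push_linear(3,4)[OF smooth_square smooth pr2_morphism r r]
  show "corr dot X \<Gamma> Z \<in> range (cls X)"
    unfolding corr_alt by (rule push(2))
  show "corr dot X (q *\<^sub>C \<Gamma>) Z = q *\<^sub>C corr dot X \<Gamma> Z"
    unfolding corr_alt dot_scale[OF smooth_square \<Gamma> P] push(1) ..
  have "first dot X (q *\<^sub>C Z) = q *\<^sub>C first dot X Z"
    unfolding first_def
    by (rule pull_scale[OF smooth_square smooth pr1_morphism Chow_subset_total[OF Z]])
  then show "corr dot X \<Gamma> (q *\<^sub>C Z) = q *\<^sub>C corr dot X \<Gamma> Z"
    unfolding corr_alt by (simp only: dot_scale_right[OF smooth_square \<Gamma> P] push(1))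
qed

lemma corr_left:
  assumes \<Gamma>: "\<Gamma> \<in> Chow_total XX" "\<Gamma>' \<in> Chow_total XX" and Z: "Z \<in> Chow X i"
  shows "corr dot X (\<Gamma> +\<^sub>C \<Gamma>') Z = corr dot X \<Gamma> Z +\<^sub>C corr dot X \<Gamma>' Z"
    and "corr dot X (\<Gamma> -\<^sub>C \<Gamma>') Z = corr dot X \<Gamma> Z -\<^sub>C corr dot X \<Gamma>' Z"
proof -
  note P = first_total[OF Z]
  have r: "dot XX \<Gamma> (first dot X Z) \<in> range (cls XX)" "dot XX \<Gamma>' (first dot X Z) \<in> range (cls XX)"
    using square_dot[OF \<Gamma>(1) P] square_dot[OF \<Gamma>(2) P] by simp_all
  show "corr dot X (\<Gamma> +\<^sub>C \<Gamma>') Z = corr dot X \<Gamma> Z +\<^sub>C corr dot X \<Gamma>' Z"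
    "corr dot X (\<Gamma> -\<^sub>C \<Gamma>') Z = corr dot X \<Gamma> Z -\<^sub>C corr dot X \<Gamma>' Z"
    unfolding corr_alt dot_add[OF smooth_square \<Gamma> P] dot_right(3)[OF smooth_square P \<Gamma>]
    by (rule push_linear(1,2)[OF smooth_square smooth pr2_morphism r])+
qed

lemma corr_right:
  assumes \<Gamma>: "\<Gamma> \<in> Chow_total XX" and Z: "Z \<in> Chow X i" "Z' \<in> Chow X i"
  shows "corr dot X \<Gamma> (Z +\<^sub>C Z') = corr dot X \<Gamma> Z +\<^sub>C corr dot X \<Gamma> Z'"
    and "corr dot X \<Gamma> (Z -\<^sub>C Z') = corr dot X \<Gamma> Z -\<^sub>C corr dot X \<Gamma> Z'"
proof -
  have add: "corr dot X \<Gamma> (A +\<^sub>C B) = corr dot X \<Gamma> A +\<^sub>C corr dot X \<Gamma> B"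
    if A: "A \<in> Chow X i" and B: "B \<in> Chow X i" for A B
  proof -
    note P = first_total[OF A] first_total[OF B]
    have r: "dot XX \<Gamma> (first dot X A) \<in> range (cls XX)" "dot XX \<Gamma> (first dot X B) \<in> range (cls XX)"
      using square_dot[OF \<Gamma> P(1)] square_dot[OF \<Gamma> P(2)] by simp_all
    have "first dot X (A +\<^sub>C B) = first dot X A +\<^sub>C first dot X B"
      unfolding first_def
      by (rule pull_add[OF smooth_square smooth pr1_morphism Chow_subset_total[OF A] Chow_subset_total[OF B]])
    then show ?thesis
      unfolding corr_alt by (simp only: dot_right(1)[OF smooth_square \<Gamma> P]
          push_linear(1)[OF smooth_square smooth pr2_morphism r])
  qed
  show "corr dot X \<Gamma> (Z +\<^sub>C Z') = corr dot X \<Gamma> Z +\<^sub>C corr dot X \<Gamma> Z'"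
    by (rule add[OF Z])
  have sub: "Z -\<^sub>C Z' = Z +\<^sub>C (-1) *\<^sub>C Z'"
    using Z by (intro csub_conv_cadd[of _ X]) (auto intro: Chow_subset_total Chow_total_range)
  show "corr dot X \<Gamma> (Z -\<^sub>C Z') = corr dot X \<Gamma> Z -\<^sub>C corr dot X \<Gamma> Z'"
    unfolding sub csub_conv_cadd[OF corr_range[OF \<Gamma> Z(1)] corr_range[OF \<Gamma> Z(2)]]
    by (simp add: add Z Chow_closed corr_scale_right[OF \<Gamma> Z(2)])
qed

lemma corr_czero:
  assumes "\<Gamma> \<in> Chow_total XX"
  shows "corr dot X \<Gamma> (czero X) = czero X"
proof -
  have "corr dot X \<Gamma> (0 *\<^sub>C czero X) = 0 *\<^sub>C corr dot X \<Gamma> (czero X)"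
    by (rule corr_scale_right[OF assms Chow_closed(3)])
  moreover have "corr dot X \<Gamma> (czero X) \<in> range (cls X)"
    by (rule corr_range[OF assms Chow_closed(3)])
  ultimately show ?thesis
    by (simp add: cscale_0[of _ X])
qed

lemma corr_first:
  assumes \<Gamma>: "\<Gamma> \<in> Chow_total XX" and a: "a \<in> Chow X i" and Z: "Z \<in> Chow X j"
  shows "corr dot X (dot XX \<Gamma> (first dot X a)) Z = corr dot X \<Gamma> (dot X a Z)"
proof -
  have "first dot X (dot X a Z) = dot XX (first dot X a) (first dot X Z)"
    unfolding first_def
    by (rule pull_dot[OF smooth_square smooth pr1_morphism Chow_subset_total[OF a] Chow_subset_total[OF Z]])
  then show ?thesis
    by (simp add: corr_alt dot_assoc[OF smooth_square \<Gamma> first_total[OF a] first_total[OF Z]])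
qed

lemma dot_swap:
  assumes "a \<in> Chow_total XX" "b \<in> Chow_total XX" "c \<in> Chow_total XX"
  shows "dot XX (dot XX a b) c = dot XX (dot XX a c) b"
  using assms by (simp add: dot_assoc[OF smooth_square] dot_commute[OF smooth_square, of b c])

lemma corr_second:
  assumes \<Gamma>: "\<Gamma> \<in> Chow_total XX" and a: "a \<in> Chow X i" and Z: "Z \<in> Chow X j"
  shows "corr dot X (dot XX \<Gamma> (second dot X a)) Z = dot X (corr dot X \<Gamma> Z) a"
  unfolding corr_alt dot_swap[OF \<Gamma> second_total[OF a] first_total[OF Z]]
  unfolding second_def
  by (rule projection_formula[OF smooth_square smooth pr2_morphism square_dot[OF \<Gamma> first_total[OF Z]]
        Chow_subset_total[OF a]])

text \<open>The diagonal is the push-forward of \<open>fund X\<close>, so by the projection formula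
  intersecting with it means pulling back along \<open>diag\<close> and pushing forward again; both
  projections undo \<open>diag\<close>. For \<open>\<Gamma> = L\<close> the result is multiplication
  by \<open>l\<close>, for \<open>fund XX\<close> it is the identity.\<close>

lemma corr_diag:
  assumes \<Gamma>: "\<Gamma> \<in> Chow XX i" and \<Delta>: "diag_class X \<in> Chow_total XX" and Z: "Z \<in> Chow X j"
  shows "corr dot X (dot XX \<Gamma> (diag_class X)) Z = dot X (diag_pull dot X \<Gamma>) Z"
proof -
  note \<Gamma>' = Chow_subset_total[OF \<Gamma>] and Z' = Chow_subset_total[OF Z] and P = first_graded[OF Z]
  let ?B = "dot XX \<Gamma> (first dot X Z)"
  have B: "?B \<in> Chow XX (i + j)"
    by (rule dot_graded[OF smooth_square \<Gamma> P])
  have "pull dot X XX diag ?B = dot X (diag_pull dot X \<Gamma>) Z"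
    unfolding diag_pull_def
    by (simp only: pull_dot[OF smooth smooth_square diag_morphism \<Gamma>' Chow_subset_total[OF P]] pull_diag_first[OF Z'])
  moreover have dB: "pull dot X XX diag ?B \<in> Chow_total X"
    by (rule Chow_subset_total[OF pull_graded[OF smooth smooth_square diag_morphism B]])
  moreover have "dot XX (dot XX \<Gamma> (diag_class X)) (first dot X Z) = dot XX (push XX diag (fund X)) ?B"
    unfolding push_diag_fund(2) dot_swap[OF \<Gamma>' \<Delta> first_total[OF Z]]
    by (rule dot_commute[OF smooth_square Chow_subset_total[OF B] \<Delta>])
  moreover have "\<dots> = push XX diag (pull dot X XX diag ?B)"
    using projection_formula[OF smooth smooth_square diag_morphism fund_total Chow_subset_total[OF B]]
    by (simp add: dot_fund[OF smooth dB])
  ultimately show ?thesis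
    by (simp add: corr_alt push_pr2_diag)
qed

text \<open>The image of a closed set under the projection is not shown to be closed here; its \<open>zdim\<close> is all
  that is used, and membership in \<open>Chow X\<close> will come from the definition of the Fourier components.\<close>

lemma push_pr2_dimensions:
  assumes n: "zdim X = enat n" "zdim XX = enat (2 * n)" and \<Gamma>: "\<Gamma> \<in> Chow XX c"
  obtains w where "push X (pr2 X X) \<Gamma> = cls X w"
    "\<And>W. W \<in> Poly_Mapping.keys w \<Longrightarrow> zdim W \<le> enat n \<and> zdim W + enat c = enat (2 * n)"
proof -
  obtain z where z: "\<Gamma> = cls XX z" "z \<in> cycles XX"
    "\<forall>V\<in>Poly_Mapping.keys z. zdim V + enat c = zdim XX"
    using \<Gamma> by (auto simp: Chow_def)
  show thesis
  proof (rule that[of "push_cyc (pr2 X X) z"])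
    show "push X (pr2 X X) \<Gamma> = cls X (push_cyc (pr2 X X) z)"
      by (simp add: z(1) push_cls[OF smooth_square smooth pr2_morphism])
    fix W assume "W \<in> Poly_Mapping.keys (push_cyc (pr2 X X) z)"
    then obtain V where V: "V \<in> Poly_Mapping.keys z" "W = pr2 X X ` V" "zdim W = zdim V"
      using push_cyc_keys by blast
    have "V \<subseteq> XX"
      using V(1) z(2) by (auto simp: cycles_def subvariety_def)
    then have "W \<subseteq> X"
      using pr2_morphism V(2) by (auto simp: morphism_def)
    then have "zdim W \<le> enat n"
      using zdim_mono n(1) by metis
    then show "zdim W \<le> enat n \<and> zdim W + enat c = enat (2 * n)"
      using V z(3) n(2) by simp
  qed
qed

end

section \<open>The Fourier and the eigenspace decompositions\<close>

text \<open>If \<open>h\<close> acts by \<open>mu\<close> on the sum of the \<open>z\<^sub>j\<close> and by \<open>\<lambda>\<^sub>j\<close> on each \<open>z\<^sub>j\<close>, then the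
  \<open>(\<lambda>\<^sub>j - mu) z\<^sub>j\<close> decompose the zero class, so they vanish.\<close>

lemma direct_sum_eigenspace:
  assumes dsum: "direct_sum X C As"
    and C: "C \<subseteq> range (cls X)" "\<And>a b. a \<in> C \<Longrightarrow> b \<in> C \<Longrightarrow> a +\<^sub>C b \<in> C" "czero X \<in> C"
    and As: "\<And>A. A \<in> set As \<Longrightarrow> A \<subseteq> C" "\<And>A q a. A \<in> set As \<Longrightarrow> a \<in> A \<Longrightarrow> q *\<^sub>C a \<in> A"
      "\<And>A. A \<in> set As \<Longrightarrow> czero X \<in> A"
    and h: "\<And>a b. a \<in> C \<Longrightarrow> b \<in> C \<Longrightarrow> h (a +\<^sub>C b) = h a +\<^sub>C h b" "h (czero X) = czero X"
    and eig: "length ls = length As" "\<And>j a. j < length As \<Longrightarrow> a \<in> As ! j \<Longrightarrow> h a = ls ! j *\<^sub>C a"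
    and Z: "Z \<in> C" "h Z = mu *\<^sub>C Z"
  obtains zs where "list_all2 (\<in>) zs As" "Z = foldr (+\<^sub>C) zs (czero X)"
    "\<And>j. j < length As \<Longrightarrow> ls ! j \<noteq> mu \<Longrightarrow> zs ! j = czero X"
proof -
  obtain zs where zs: "list_all2 (\<in>) zs As" "foldr (+\<^sub>C) zs (czero X) = Z"
    using dsum Z(1) unfolding direct_sum_def by blast
  define ws where "ws = map2 (\<lambda>l z. (l - mu) *\<^sub>C z) ls zs"
  have len: "length zs = length As"
    using zs(1) by (rule list_all2_lengthD)
  have ws: "list_all2 (\<in>) ws As"
    using zs(1) As(2) eig(1) len by (auto simp: list_all2_conv_all_nth ws_def)
  \<comment> \<open>\<open>h\<close> of the sum, with \<open>mu\<close> times the sum split off.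
    Membership in \<open>C\<close> is carried through the induction because additivity of
    \<open>h\<close> is available only there.\<close>
  have key: "foldr (+\<^sub>C) (map2 (\<lambda>l z. (l - mu) *\<^sub>C z) ls zs) (czero X) +\<^sub>C mu *\<^sub>C foldr (+\<^sub>C) zs (czero X)
      = h (foldr (+\<^sub>C) zs (czero X)) \<and> foldr (+\<^sub>C) zs (czero X) \<in> C
      \<and> foldr (+\<^sub>C) (map2 (\<lambda>l z. (l - mu) *\<^sub>C z) ls zs) (czero X) \<in> range (cls X)"
    if "length ls = length zs" "\<forall>j<length zs. zs ! j \<in> C \<and> h (zs ! j) = ls ! j *\<^sub>C zs ! j" for ls zs
    using that
  proof (induction ls zs rule: list_induct2)
    case Nil
    have "czero X +\<^sub>C mu *\<^sub>C czero X = czero X"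
      by (rule cls_eqI[of _ X]) simp_all
    then show ?case
      using C(3) h(2) by simp
  next
    case (Cons l ls z zs)
    let ?S = "foldr (+\<^sub>C) zs (czero X)" and ?W = "foldr (+\<^sub>C) (map2 (\<lambda>l z. (l - mu) *\<^sub>C z) ls zs) (czero X)"
    have IH: "?W +\<^sub>C mu *\<^sub>C ?S = h ?S" "?S \<in> C" "?W \<in> range (cls X)"
      using Cons by (auto simp: All_less_Suc2)
    have z: "z \<in> C" "h z = l *\<^sub>C z"
      using Cons.prems by auto
    have r: "z \<in> range (cls X)" "?S \<in> range (cls X)"
      using z IH C(1) by auto
    have "((l - mu) *\<^sub>C z +\<^sub>C ?W) +\<^sub>C mu *\<^sub>C (z +\<^sub>C ?S) = l *\<^sub>C z +\<^sub>C (?W +\<^sub>C mu *\<^sub>C ?S)"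
      by (rule cls_eqI[of _ X]) (use r IH(3) in \<open>simp_all add: algebra_simps\<close>)
    also have "\<dots> = h (z +\<^sub>C ?S)"
      using h(1)[OF z(1) IH(2)] z(2) IH(1) by simp
    finally show ?case
      using C(2)[OF z(1) IH(2)] r(1) IH(3) by simp
  qed
  have el: "\<forall>j<length zs. zs ! j \<in> C \<and> h (zs ! j) = ls ! j *\<^sub>C zs ! j"
    using zs(1) As(1) eig(2) len by (auto simp: list_all2_conv_all_nth) (use nth_mem in blast)
  have wsum: "foldr (+\<^sub>C) ws (czero X) = czero X"
  proof -
    have Zr: "Z \<in> range (cls X)"
      using Z(1) C(1) by blast
    have W: "foldr (+\<^sub>C) ws (czero X) +\<^sub>C mu *\<^sub>C Z = mu *\<^sub>C Z" "foldr (+\<^sub>C) ws (czero X) \<in> range (cls X)"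
      using key[of ls zs] eig(1) len el zs(2) Z(2) by (simp_all add: ws_def)
    show ?thesis
    proof (rule cls_eqI[of _ X])
      fix V
      show "coord X (foldr (+\<^sub>C) ws (czero X)) V = coord X (czero X) V"
        using arg_cong[OF W(1), of "\<lambda>a. coord X a V"] Zr W(2) by simp
    qed (use W in simp_all)
  qed
  have czs: "list_all2 (\<in>) (map (\<lambda>_. czero X) As) As"
    using As(3) by (auto simp: list_all2_conv_all_nth)
  have csum: "foldr (+\<^sub>C) (map (\<lambda>_. czero X) Bs) (czero X) = czero X" for Bs :: "cls set list"
  proof (induction Bs)
    case (Cons B Bs)
    have "czero X +\<^sub>C czero X = czero X"
      by (rule cls_eqI[of _ X]) simp_all
    with Cons show ?case by simp
  qed simp
  have "ws = map (\<lambda>_. czero X) As"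
  proof -
    have "\<exists>!zs. list_all2 (\<in>) zs As \<and> foldr (+\<^sub>C) zs (czero X) = czero X"
      using dsum C(3) unfolding direct_sum_def by simp
    then show ?thesis
      by (elim ex1E) (use ws wsum czs csum in metis)
  qed
  then have w0: "(ls ! j - mu) *\<^sub>C zs ! j = czero X" if "j < length As" for j
    using that eig(1) len by (auto simp: ws_def list_eq_iff_nth_eq)
  have "zs ! j = czero X" if j: "j < length As" "ls ! j \<noteq> mu" for j
  proof (rule cls_eqI[of _ X])
    show r: "zs ! j \<in> range (cls X)" "czero X \<in> range (cls X)"
      using el j(1) len C(1) by auto
    show "coord X (zs ! j) V = coord X (czero X) V" for V
      using arg_cong[OF w0[OF j(1)], of "\<lambda>a. coord X a V"] r j(2) by simp
  qed
  with zs that show thesis by blast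
qed

lemma foldr_cadd_single:
  assumes "k < length zs" "zs ! k \<in> range (cls X)" "\<And>j. j < length zs \<Longrightarrow> j \<noteq> k \<Longrightarrow> zs ! j = czero X"
  shows "foldr (+\<^sub>C) zs (czero X) = zs ! k"
  using assms
proof (induction zs arbitrary: k)
  case (Cons z zs)
  have zero: "foldr (+\<^sub>C) ys (czero X) = czero X" if "\<forall>y\<in>set ys. y = czero X" for ys
    using that by (induction ys) simp_all
  show ?case
  proof (cases k)
    case 0
    then have "\<forall>y\<in>set zs. y = czero X"
      using Cons.prems(3)[of "Suc _"] by (auto simp: in_set_conv_nth)
    then show ?thesis
      using 0 Cons.prems(2) zero by simp
  next
    case (Suc k')
    have "foldr (+\<^sub>C) zs (czero X) = zs ! k'"
      using Cons.prems(1,2) Cons.prems(3)[of "Suc _"] Suc by (intro Cons.IH) simp_all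
    then show ?thesis
      using Suc Cons.prems(2) Cons.prems(3)[of 0] by simp
  qed
qed simp

lemma direct_sum_1:
  assumes "direct_sum X C [A]" "A \<subseteq> range (cls X)" "Z \<in> C"
  shows "Z \<in> A"
proof -
  obtain zs where "list_all2 (\<in>) zs [A]" "foldr (+\<^sub>C) zs (czero X) = Z"
    using assms(1,3) unfolding direct_sum_def by blast
  then obtain a where "a \<in> A" "a +\<^sub>C czero X = Z"
    by (auto simp: list_all2_Cons2)
  then show ?thesis
    using assms(2) by (simp add: subset_iff)
qed

lemma direct_sum_2:
  assumes "direct_sum X C [A, B]" "B \<subseteq> range (cls X)" "Z \<in> C"
  obtains a b where "a \<in> A" "b \<in> B" "Z = a +\<^sub>C b"
proof -
  obtain zs where "list_all2 (\<in>) zs [A, B]" "foldr (+\<^sub>C) zs (czero X) = Z"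
    using assms(1,3) unfolding direct_sum_def by blast
  then obtain a b where ab: "a \<in> A" "b \<in> B" "a +\<^sub>C (b +\<^sub>C czero X) = Z"
    by (auto simp: list_all2_Cons2)
  moreover have "b +\<^sub>C czero X = b"
    using assms(2) ab(2) by (intro cadd_czero) blast
  ultimately show thesis
    using that by simp
qed

lemma direct_sum_3:
  assumes "direct_sum X C [A, B, E]" "E \<subseteq> range (cls X)" "Z \<in> C"
  obtains a b e where "a \<in> A" "b \<in> B" "e \<in> E" "Z = a +\<^sub>C (b +\<^sub>C e)"
proof -
  obtain zs where "list_all2 (\<in>) zs [A, B, E]" "foldr (+\<^sub>C) zs (czero X) = Z"
    using assms(1,3) unfolding direct_sum_def by blast
  then obtain a b e where abe: "a \<in> A" "b \<in> B" "e \<in> E" "a +\<^sub>C (b +\<^sub>C (e +\<^sub>C czero X)) = Z"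
    by (auto simp: list_all2_Cons2)
  moreover have "e +\<^sub>C czero X = e"
    using assms(2) abe(3) by (intro cadd_czero) blast
  ultimately show thesis
    using that by simp
qed

section \<open>The relation for the square of \<open>L\<close> as an identity of operators\<close>

locale shen_vial = correspondences +
  fixes L :: cls
  assumes dim: "zdim X = 4"
    and L: "L \<in> Chow XX 2"
    and relations: "shen_vial_relations dot X 23 L"
    and decomposition: "chow_decomposition X (Chow_Fourier dot X L)"
begin

abbreviation l :: cls where "l \<equiv> diag_pull dot X L"
abbreviation mult :: "cls \<Rightarrow> cls \<Rightarrow> cls" (infixl "\<cdot>" 70) where "a \<cdot> b \<equiv> dot X a b"
abbreviation D :: "cls \<Rightarrow> cls \<Rightarrow> cls" where "D \<equiv> dot XX"
abbreviation F :: "nat \<Rightarrow> nat \<Rightarrow> cls set" where "F \<equiv> Chow_Fourier dot X L"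

primrec L_pow :: "nat \<Rightarrow> cls" where
  "L_pow 0 = fund XX"
| "L_pow (Suc k) = D (L_pow k) L"

text \<open>Up to the factor \<open>1 / fact k\<close>, the constituent of the Fourier transform
  that shifts codimension by \<open>2 * k - 4\<close>. On zero-cycles \<open>T 0\<close> is the
  degree, as a multiple of \<open>fund X\<close>.\<close>

definition T :: "nat \<Rightarrow> cls \<Rightarrow> cls" where
  "T k Z = corr dot X (L_pow k) Z"

lemma dim': "zdim X = enat 4"
  using dim by (simp add: numeral_eq_enat)

lemma Chow_range: "a \<in> Chow Y i \<Longrightarrow> a \<in> range (cls Y)"
  by (rule Chow_total_range[OF Chow_subset_total])

lemma l: "l \<in> Chow X 2"
  by (rule diag_pull_graded[OF L])

lemma L_pow: "L_pow k \<in> Chow XX (2 * k)"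
proof (induction k)
  case 0
  then show ?case
    using fund_in_Chow[OF smooth_projective_variety[OF smooth_square]] by simp
next
  case (Suc k)
  then show ?case
    using dot_graded[OF smooth_square Suc L] by simp
qed

lemma L_pow_total: "L_pow k \<in> Chow_total XX"
  by (rule Chow_subset_total[OF L_pow])

lemma L_pow_numeral: "L_pow 1 = L" "L_pow 2 = D L L" "L_pow 3 = D (D L L) L" "L_pow 4 = D (D (D L L) L) L"
  by (simp_all add: numeral_eq_Suc dot_fund[OF smooth_square Chow_subset_total[OF L]])

lemma T_linear:
  assumes "Z \<in> Chow X i" "Z' \<in> Chow X i"
  shows "T k (Z +\<^sub>C Z') = T k Z +\<^sub>C T k Z'" "T k (Z -\<^sub>C Z') = T k Z -\<^sub>C T k Z'"
  unfolding T_def by (rule corr_right[OF L_pow_total assms])+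

lemma T_scale: "Z \<in> Chow X i \<Longrightarrow> T k (q *\<^sub>C Z) = q *\<^sub>C T k Z"
  unfolding T_def by (rule corr_scale_right[OF L_pow_total])

lemma T_range: "Z \<in> Chow X i \<Longrightarrow> T k Z \<in> range (cls X)"
  unfolding T_def by (rule corr_range[OF L_pow_total])

lemma T_czero [simp]: "T k (czero X) = czero X"
  unfolding T_def by (rule corr_czero[OF L_pow_total])

lemma l_mult:
  assumes "Z \<in> Chow X i"
  shows "l \<cdot> Z \<in> Chow X (i + 2)" "Z \<cdot> l = l \<cdot> Z"
  using dot_graded[OF smooth l assms] dot_commute[OF smooth Chow_subset_total[OF l] Chow_subset_total[OF assms]]
  by (simp_all add: add.commute)

lemma mult_czero [simp]: "l \<cdot> czero X = czero X" "czero X \<cdot> l = czero X"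
  using dot_czero[OF smooth Chow_subset_total[OF l]] by simp_all

lemma Chow_big: "Z \<in> Chow X i \<Longrightarrow> 4 < i \<Longrightarrow> Z = czero X"
  using Chow_above_dim[OF dim'] by blast

text \<open>The relation is multiplied by \<open>M\<close> so that one computation yields both
  \<open>T 2\<close>, with \<open>M = fund XX\<close>, and \<open>T 3\<close>, with
  \<open>M = L\<close>. For \<open>r = 23\<close> the constants are \<open>2/25 = 2/(r + 2)\<close>
  and \<open>1/575 = 1/(r (r + 2))\<close>.\<close>

lemma corr_L_square:
  assumes M: "M \<in> Chow XX j" and Z: "Z \<in> Chow X i"
  defines "c \<equiv> corr dot X"
  shows "c (D M (D L L)) Z = 2 *\<^sub>C (diag_pull dot X M \<cdot> Z)
      -\<^sub>C (2/25) *\<^sub>C (c (D M L) (l \<cdot> Z) +\<^sub>C c (D M L) Z \<cdot> l)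
      -\<^sub>C (1/575) *\<^sub>C (2 *\<^sub>C c M (l \<cdot> (l \<cdot> Z)) -\<^sub>C 23 *\<^sub>C (c M (l \<cdot> Z) \<cdot> l) +\<^sub>C 2 *\<^sub>C ((c M Z \<cdot> l) \<cdot> l))"
    and "diag_class X \<in> Chow XX 4"
proof -
  define l1 l2 where "l1 = first dot X l" and "l2 = second dot X l"
  define A B where "A = D L (l1 +\<^sub>C l2)" and "B = 2 *\<^sub>C D l1 l1 -\<^sub>C 23 *\<^sub>C D l1 l2 +\<^sub>C 2 *\<^sub>C D l2 l2"
  have g: "l1 \<in> Chow XX 2" "l2 \<in> Chow XX 2"
    unfolding l1_def l2_def by (rule first_graded[OF l] second_graded[OF l])+
  note t = g[THEN Chow_subset_total] Chow_subset_total[OF L] Chow_subset_total[OF M]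
  note dg = dot_graded[OF smooth_square]
  have A: "A \<in> Chow XX 4"
    using dg[OF L Chow_closed(1)[OF g]] by (simp add: A_def)
  have ll: "D l1 l1 \<in> Chow XX 4" "D l1 l2 \<in> Chow XX 4" "D l2 l2 \<in> Chow XX 4"
    using dg[OF g(1) g(1)] dg[OF g(1) g(2)] dg[OF g(2) g(2)] by simp_all
  have B: "B \<in> Chow XX 4"
    unfolding B_def by (intro Chow_closed(1,2) Chow_csub ll)
  have LL: "D L L \<in> Chow XX 4"
    using dg[OF L L] by simp
  have "(2 :: rat) / (of_nat 23 + 2) = 2/25" "(1 :: rat) / (of_nat 23 * (of_nat 23 + 2)) = 1/575" "(of_nat 23 :: rat) = 23"
    by simp_all
  note num = this
  have rel: "D L L = 2 *\<^sub>C diag_class X -\<^sub>C (2/25) *\<^sub>C A -\<^sub>C (1/575) *\<^sub>C B"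
    using relations unfolding shen_vial_relations_def Let_def num by (simp add: A_def B_def l1_def l2_def)
  have \<Delta>r: "diag_class X \<in> range (cls XX)"
    by (simp add: diag_class_def)
  \<comment> \<open>Solving the relation for the diagonal exhibits it as a class of codimension 4;
    \<open>zdim_square\<close> will deduce that \<open>XX\<close> has dimension 8.\<close>
  have "diag_class X = (1/2) *\<^sub>C (D L L +\<^sub>C (2/25) *\<^sub>C A +\<^sub>C (1/575) *\<^sub>C B)"
    unfolding rel by (rule cls_eqI[of _ XX]) (use \<Delta>r A B in \<open>simp_all add: Chow_range\<close>)
  then show \<Delta>: "diag_class X \<in> Chow XX 4"
    using LL A B by (simp add: Chow_closed)
  note \<Delta>t = Chow_subset_total[OF \<Delta>] and At = Chow_subset_total[OF A] and Bt = Chow_subset_total[OF B]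
    and llt = ll[THEN Chow_subset_total]
  note dr = dot_right[OF smooth_square t(4)] and ds = dot_scale_right[OF smooth_square t(4)]
  have MLL: "D M (D L L) = 2 *\<^sub>C D M (diag_class X) -\<^sub>C (2/25) *\<^sub>C D M A -\<^sub>C (1/575) *\<^sub>C D M B"
    unfolding rel by (simp add: dr ds \<Delta>t At Bt)
  have MA: "D M A = D (D M L) l1 +\<^sub>C D (D M L) l2"
    unfolding A_def
    by (simp only: dot_right(1)[OF smooth_square t(3) t(1,2)] dr(1)[OF square_dot[OF t(3) t(1)] square_dot[OF t(3) t(2)]]
        dot_assoc[OF smooth_square t(4,3) t(1)] dot_assoc[OF smooth_square t(4,3) t(2)])
  have MB: "D M B = 2 *\<^sub>C D (D M l1) l1 -\<^sub>C 23 *\<^sub>C D (D M l1) l2 +\<^sub>C 2 *\<^sub>C D (D M l2) l2"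
    unfolding B_def
    by (simp add: dr ds llt dot_assoc[OF smooth_square t(4) t(1) t(1)] dot_assoc[OF smooth_square t(4) t(1) t(2)]
        dot_assoc[OF smooth_square t(4) t(2) t(2)])
  note MLt = square_dot[OF t(4,3)] and M1t = square_dot[OF t(4,1)] and M2t = square_dot[OF t(4,2)]
  have tt: "D M (diag_class X) \<in> Chow_total XX" "D (D M L) l1 \<in> Chow_total XX" "D (D M L) l2 \<in> Chow_total XX"
    "D (D M l1) l1 \<in> Chow_total XX" "D (D M l1) l2 \<in> Chow_total XX" "D (D M l2) l2 \<in> Chow_total XX"
    by (intro square_dot MLt M1t M2t t \<Delta>t)+
  note lZ = l_mult(1)[OF Z]
  have ops: "c (D M (diag_class X)) Z = diag_pull dot X M \<cdot> Z"
    "c (D (D M L) l1) Z = c (D M L) (l \<cdot> Z)" "c (D (D M L) l2) Z = c (D M L) Z \<cdot> l"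
    "c (D (D M l1) l1) Z = c M (l \<cdot> (l \<cdot> Z))" "c (D (D M l1) l2) Z = c M (l \<cdot> Z) \<cdot> l"
    "c (D (D M l2) l2) Z = (c M Z \<cdot> l) \<cdot> l"
    unfolding c_def l1_def l2_def
    by (simp_all only: corr_diag[OF M \<Delta>t Z] corr_first[OF MLt l Z] corr_second[OF MLt l Z]
        corr_first[OF M1t[unfolded l1_def] l Z] corr_first[OF t(4) l lZ] corr_second[OF M1t[unfolded l1_def] l Z]
        corr_first[OF t(4) l Z] corr_second[OF M2t[unfolded l2_def] l Z] corr_second[OF t(4) l Z])
  show "c (D M (D L L)) Z = 2 *\<^sub>C (diag_pull dot X M \<cdot> Z)
      -\<^sub>C (2/25) *\<^sub>C (c (D M L) (l \<cdot> Z) +\<^sub>C c (D M L) Z \<cdot> l)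
      -\<^sub>C (1/575) *\<^sub>C (2 *\<^sub>C c M (l \<cdot> (l \<cdot> Z)) -\<^sub>C 23 *\<^sub>C (c M (l \<cdot> Z) \<cdot> l) +\<^sub>C 2 *\<^sub>C ((c M Z \<cdot> l) \<cdot> l))"
    unfolding MLL MA MB ops[symmetric] unfolding c_def
    by (simp add: corr_left[OF _ _ Z] corr_scale_left[OF _ Z] tt)
qed

lemma zdim_XX: "zdim XX = enat (2 * 4)"
  by (rule zdim_square[OF dim' corr_L_square(2)[OF L l]])

text \<open>Push-forwards are known to be cosets, but not yet to lie in \<open>Chow_total X\<close>,
  so \<open>dot_closed\<close> does not apply. By \<open>corr_second\<close> the products are images
  under correspondences themselves, hence cosets too.\<close>

lemma corr_second_range:
  assumes "M \<in> Chow_total XX" "Z \<in> Chow X i"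
  shows "corr dot X M Z \<cdot> l \<in> range (cls X)" "(corr dot X M Z \<cdot> l) \<cdot> l \<in> range (cls X)"
proof -
  have D2: "D M (second dot X l) \<in> Chow_total XX"
    by (rule square_dot[OF assms(1) second_total[OF l]])
  have D22: "D (D M (second dot X l)) (second dot X l) \<in> Chow_total XX"
    by (rule square_dot[OF D2 second_total[OF l]])
  show "corr dot X M Z \<cdot> l \<in> range (cls X)"
    using corr_range[OF D2 assms(2)] corr_second[OF assms(1) l assms(2)] by simp
  show "(corr dot X M Z \<cdot> l) \<cdot> l \<in> range (cls X)"
    using corr_range[OF D22 assms(2)] corr_second[OF assms(1) l assms(2)] corr_second[OF D2 l assms(2)]
    by simp
qed

lemma T_ranges:
  assumes "Z \<in> Chow X i"
  shows "T k Z \<in> range (cls X)" "T k (l \<cdot> Z) \<in> range (cls X)" "T k (l \<cdot> (l \<cdot> Z)) \<in> range (cls X)"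
    "T k Z \<cdot> l \<in> range (cls X)" "T k (l \<cdot> Z) \<cdot> l \<in> range (cls X)" "(T k Z \<cdot> l) \<cdot> l \<in> range (cls X)"
  using T_range[OF assms] T_range[OF l_mult(1)[OF assms]] T_range[OF l_mult(1)[OF l_mult(1)[OF assms]]]
    corr_second_range[OF L_pow_total assms] corr_second_range[OF L_pow_total l_mult(1)[OF assms]]
  by (simp_all add: T_def)

lemma diag_pull_fund: "diag_pull dot X (fund XX) = fund X"
  unfolding diag_pull_def by (rule pull_fund[OF smooth smooth_square diag_morphism])

lemma T2:
  assumes "Z \<in> Chow X i"
  shows "T 2 Z = 2 *\<^sub>C Z -\<^sub>C (2/25) *\<^sub>C (T 1 (l \<cdot> Z) +\<^sub>C T 1 Z \<cdot> l)
    -\<^sub>C (1/575) *\<^sub>C (2 *\<^sub>C T 0 (l \<cdot> (l \<cdot> Z)) -\<^sub>C 23 *\<^sub>C (T 0 (l \<cdot> Z) \<cdot> l) +\<^sub>C 2 *\<^sub>C ((T 0 Z \<cdot> l) \<cdot> l))"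
  using corr_L_square(1)[OF L_pow[of 0] assms]
  by (simp add: T_def L_pow_numeral diag_pull_fund dot_fund[OF smooth Chow_subset_total[OF assms]]
      dot_fund[OF smooth_square] Chow_subset_total[OF L] square_dot del: One_nat_def)

lemma T3:
  assumes "Z \<in> Chow X i"
  shows "T 3 Z = 2 *\<^sub>C (l \<cdot> Z) -\<^sub>C (2/25) *\<^sub>C (T 2 (l \<cdot> Z) +\<^sub>C T 2 Z \<cdot> l)
    -\<^sub>C (1/575) *\<^sub>C (2 *\<^sub>C T 1 (l \<cdot> (l \<cdot> Z)) -\<^sub>C 23 *\<^sub>C (T 1 (l \<cdot> Z) \<cdot> l) +\<^sub>C 2 *\<^sub>C ((T 1 Z \<cdot> l) \<cdot> l))"
  using corr_L_square(1)[OF L assms]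
  by (simp add: T_def L_pow_numeral dot_assoc[OF smooth_square] Chow_subset_total[OF L] del: One_nat_def)

lemma corr_H:
  assumes Z: "Z \<in> Chow X i"
  shows "corr dot X (H_class dot X 23 L) Z
    = (4/575) *\<^sub>C ((T 0 Z \<cdot> l) \<cdot> l -\<^sub>C T 0 (l \<cdot> (l \<cdot> Z))) +\<^sub>C (2/25) *\<^sub>C (T 1 Z \<cdot> l -\<^sub>C T 1 (l \<cdot> Z))"
proof -
  define l1 l2 where "l1 = first dot X l" and "l2 = second dot X l"
  have t: "l1 \<in> Chow_total XX" "l2 \<in> Chow_total XX"
    unfolding l1_def l2_def by (rule first_total[OF l] second_total[OF l])+
  note Lt = Chow_subset_total[OF L] and F0 = L_pow_total[of 0, simplified]
  note lZ = l_mult(1)[OF Z]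
  have "(4 :: rat) / (of_nat 23 * (of_nat 23 + 2)) = 4/575" "(2 :: rat) / (of_nat 23 + 2) = 2/25"
    by simp_all
  note num = this
  have H: "H_class dot X 23 L = (4/575) *\<^sub>C (D l2 l2 -\<^sub>C D l1 l1) +\<^sub>C (2/25) *\<^sub>C (D L l2 -\<^sub>C D L l1)"
    unfolding H_class_def Let_def num l1_def[symmetric] l2_def[symmetric]
    by (simp add: dot_right(2)[OF smooth_square Lt t(2) t(1)])
  \<comment> \<open>Inserting \<open>fund XX\<close> lets the squares of \<open>l1\<close> and
    \<open>l2\<close> act through \<open>T 0\<close>.\<close>
  have f: "D l1 l1 = D (D (fund XX) l1) l1" "D l2 l2 = D (D (fund XX) l2) l2"
    by (simp_all add: dot_fund[OF smooth_square] t)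
  have tt: "D l1 l1 \<in> Chow_total XX" "D l2 l2 \<in> Chow_total XX" "D L l1 \<in> Chow_total XX" "D L l2 \<in> Chow_total XX"
    by (intro square_dot t Lt)+
  have F: "D (fund XX) l1 \<in> Chow_total XX" "D (fund XX) l2 \<in> Chow_total XX"
    by (intro square_dot t F0)+
  have ops: "corr dot X (D l1 l1) Z = T 0 (l \<cdot> (l \<cdot> Z))" "corr dot X (D l2 l2) Z = (T 0 Z \<cdot> l) \<cdot> l"
    "corr dot X (D L l1) Z = T 1 (l \<cdot> Z)" "corr dot X (D L l2) Z = T 1 Z \<cdot> l"
    unfolding f T_def L_pow_numeral L_pow.simps(1) unfolding l1_def l2_def
    by (simp_all only: corr_first[OF F(1)[unfolded l1_def] l Z] corr_first[OF F0 l lZ] corr_second[OF F0 l Z]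
        corr_second[OF F(2)[unfolded l2_def] l Z] corr_first[OF Lt l Z] corr_second[OF Lt l Z])
  show ?thesis
    unfolding ops[symmetric] H by (simp add: corr_left[OF _ _ Z] corr_scale_left[OF _ Z] tt)
qed

subsection \<open>Homogeneous components of the Fourier transform\<close>

lemma T_representative:
  assumes "Z \<in> Chow X i"
  obtains w where "T k Z = cls X w"
    "\<And>W. W \<in> Poly_Mapping.keys w \<Longrightarrow> 4 \<le> 2 * k + i \<and> 2 * k + i \<le> 8 \<and> zdim W = enat (8 - (2 * k + i))"
proof -
  have "D (L_pow k) (first dot X Z) \<in> Chow XX (2 * k + i)"
    by (rule dot_graded[OF smooth_square L_pow first_graded[OF assms]])
  then obtain w where w: "push X (pr2 X X) (D (L_pow k) (first dot X Z)) = cls X w"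
    "\<And>W. W \<in> Poly_Mapping.keys w \<Longrightarrow> zdim W \<le> enat 4 \<and> zdim W + enat (2 * k + i) = enat (2 * 4)"
    using push_pr2_dimensions[OF dim' zdim_XX] by blast
  show thesis
  proof (rule that)
    show "T k Z = cls X w"
      using w(1) by (simp add: T_def corr_alt)
    fix W assume "W \<in> Poly_Mapping.keys w"
    from w(2)[OF this] obtain m where "zdim W = enat m" "m \<le> 4" "m + (2 * k + i) = 8"
      by (cases "zdim W") auto
    then show "4 \<le> 2 * k + i \<and> 2 * k + i \<le> 8 \<and> zdim W = enat (8 - (2 * k + i))"
      by auto
  qed
qed

text \<open>The image would have dimension \<open>8 - (2 * k + i)\<close>, which has to lie between
  0 and 4.\<close>

lemma T_vanishes:
  assumes "Z \<in> Chow X i" "2 * k + i < 4 \<or> 8 < 2 * k + i"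
  shows "T k Z = czero X"
proof -
  obtain w where w: "T k Z = cls X w"
    "\<And>W. W \<in> Poly_Mapping.keys w \<Longrightarrow> 4 \<le> 2 * k + i \<and> 2 * k + i \<le> 8 \<and> zdim W = enat (8 - (2 * k + i))"
    using T_representative[OF assms(1)] by blast
  then have "Poly_Mapping.keys w = {}"
    using assms(2) by fastforce
  then show ?thesis
    using w(1) by (simp add: czero_def)
qed

lemma exp_class_L_pow:
  "exp_class dot X L = L_pow 0 +\<^sub>C L_pow 1 +\<^sub>C (1/2) *\<^sub>C L_pow 2 +\<^sub>C (1/6) *\<^sub>C L_pow 3 +\<^sub>C (1/24) *\<^sub>C L_pow 4"
  by (simp only: exp_class_def Let_def L_pow_numeral L_pow.simps(1))

lemma corr_exp:
  assumes Z: "Z \<in> Chow X i"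
  shows "corr dot X (exp_class dot X L) Z
    = T 0 Z +\<^sub>C T 1 Z +\<^sub>C (1/2) *\<^sub>C T 2 Z +\<^sub>C (1/6) *\<^sub>C T 3 Z +\<^sub>C (1/24) *\<^sub>C T 4 Z"
  unfolding exp_class_L_pow T_def
  by (simp only: corr_left(1)[OF _ _ Z] corr_scale_left[OF _ Z] L_pow_total Chow_total_closed)

text \<open>For fixed \<open>i\<close> the classes \<open>T k Z\<close> live in different dimensions
  \<open>8 - (2 * k + i)\<close>, while the transform of \<open>Z\<close> is represented in the
  single dimension \<open>i - s\<close>. The two agree exactly if
  \<open>2 * k + 2 * i = 8 + s\<close>; all other constituents must vanish, and the remaining one
  inherits membership in a Chow group.\<close>

lemma Fourier_components:
  assumes Z: "Z \<in> F i s" and ik: "i \<le> 4" "k \<le> 4"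
  shows "2 * k + 2 * i \<noteq> 8 + s \<Longrightarrow> T k Z = czero X"
    and "2 * k + 2 * i = 8 + s \<Longrightarrow> T k Z \<in> Chow X (4 - i + s)"
proof -
  have Zi: "Z \<in> Chow X i" and Zs: "corr dot X (exp_class dot X L) Z \<in> Chow X (4 - i + s)"
    using Z by (auto simp: Chow_Fourier_def)
  have "\<forall>k. \<exists>w. T k Z = cls X w \<and> (\<forall>W\<in>Poly_Mapping.keys w.
      4 \<le> 2 * k + i \<and> 2 * k + i \<le> 8 \<and> zdim W = enat (8 - (2 * k + i)))"
    using T_representative[OF Zi] by metis
  then obtain w where w: "\<And>k. T k Z = cls X (w k)" "\<And>k. \<forall>W\<in>Poly_Mapping.keys (w k).
      4 \<le> 2 * k + i \<and> 2 * k + i \<le> 8 \<and> zdim W = enat (8 - (2 * k + i))"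
    by metis
  obtain z where z: "corr dot X (exp_class dot X L) Z = cls X z" "z \<in> cycles X"
    "\<forall>V\<in>Poly_Mapping.keys z. zdim V + enat (4 - i + s) = zdim X"
    using Zs by (auto simp: Chow_def)
  define q :: "nat \<Rightarrow> rat" where "q j = 1 / fact j" for j
  have "cls X (\<Sum>j\<le>4. smul (q j) (w j)) = cls X z"
    using z(1) corr_exp[OF Zi] by (simp add: w(1) q_def numeral_eq_Suc)
  then have R: "(\<Sum>j\<le>4. smul (q j) (w j)) - z \<in> rat_equiv_zero X"
    by (simp add: cls_eq_iff)
  \<comment> \<open>In this range \<open>8 - (2 * k + i)\<close> is a true difference and a possible
    dimension; outside it \<open>T_vanishes\<close> applies.\<close>
  have comp: "smul (q k) (w k) - (if 2 * k + 2 * i = 8 + s then z else 0) \<in> rat_equiv_zero X"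
    if ki: "4 \<le> 2 * k + i \<and> 2 * k + i \<le> 8"
  proof -
    let ?n = "8 - (2 * k + i)"
    have "dim_part (enat ?n) (w j) = (if j = k then w k else 0)" for j
    proof (cases "j = k")
      case True
      then show ?thesis
        using w(2)[of k] by (simp add: dim_part_homogeneous[of _ "enat ?n"])
    next
      case False
      have "zdim W \<noteq> enat ?n" if "W \<in> Poly_Mapping.keys (w j)" for W
        using w(2)[of j] that ki False by auto
      then show ?thesis
        using False by (intro poly_mapping_eqI) (auto simp: in_keys_iff)
    qed
    then have "dim_part (enat ?n) (\<Sum>j\<le>4. smul (q j) (w j)) = (\<Sum>j\<le>4. smul (q j) (if j = k then w k else 0))"
      by (simp add: dim_part_sum dim_part_linear)
    also have "\<dots> = (\<Sum>j\<le>4. if j = k then smul (q k) (w k) else 0)"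
      by (rule sum.cong) simp_all
    also have "\<dots> = smul (q k) (w k)"
      using ik(2) by simp
    finally have sum: "dim_part (enat ?n) (\<Sum>j\<le>4. smul (q j) (w j)) = smul (q k) (w k)" .
    have zV: "zdim V = enat (i - s) \<and> s \<le> i" if "V \<in> Poly_Mapping.keys z" for V
    proof -
      have "zdim V + enat (4 - i + s) = enat 4"
        using z(3) that dim' by simp
      then show ?thesis
        using ik(1) by (cases "zdim V") auto
    qed
    have "dim_part (enat ?n) z = (if 2 * k + 2 * i = 8 + s then z else 0)"
    proof (rule poly_mapping_eqI)
      fix V
      show "Poly_Mapping.lookup (dim_part (enat ?n) z) V
          = Poly_Mapping.lookup (if 2 * k + 2 * i = 8 + s then z else 0) V"
      proof (cases "V \<in> Poly_Mapping.keys z")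
        case True
        then show ?thesis
          using zV[OF True] ki by auto
      qed (simp add: in_keys_iff)
    qed
    with dim_part_rat_equiv_zero[OF R, of ?n] sum show ?thesis
      by (simp add: dim_part_linear)
  qed
  show "T k Z = czero X" if ne: "2 * k + 2 * i \<noteq> 8 + s"
  proof (cases "4 \<le> 2 * k + i \<and> 2 * k + i \<le> 8")
    case True
    then have "smul (q k) (w k) \<in> rat_equiv_zero X"
      using comp ne by simp
    then have "smul (inverse (q k)) (smul (q k) (w k)) \<in> rat_equiv_zero X"
      by (rule rat_equiv_zero_smul)
    then show ?thesis
      by (simp add: w(1) czero_def cls_eq_iff q_def)
  next
    case False
    then show ?thesis
      using T_vanishes[OF Zi] by auto
  qed
  show "T k Z \<in> Chow X (4 - i + s)" if eq: "2 * k + 2 * i = 8 + s"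
  proof (cases "4 \<le> 2 * k + i \<and> 2 * k + i \<le> 8")
    case True
    then have "cls X (smul (q k) (w k)) = cls X z"
      using comp eq by (simp add: cls_eq_iff)
    moreover have "cls X z \<in> Chow X (4 - i + s)"
      using Zs z(1) by simp
    ultimately have "inverse (q k) *\<^sub>C cls X (smul (q k) (w k)) \<in> Chow X (4 - i + s)"
      using Chow_closed(2) by metis
    then show ?thesis
      by (simp add: w(1) q_def)
  next
    case False
    then show ?thesis
      using T_vanishes[OF Zi] Chow_closed(3) by auto
  qed
qed

subsection \<open>The operator \<open>H\<close> on the Fourier components\<close>

lemma F_Chow: "Z \<in> F i s \<Longrightarrow> Z \<in> Chow X i"
  by (simp add: Chow_Fourier_def)

lemma F_range: "F i s \<subseteq> range (cls X)"
  using F_Chow Chow_range by blast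

lemma decompositions:
  "direct_sum X (Chow X 0) [F 0 0]" "direct_sum X (Chow X 1) [F 1 0]"
  "direct_sum X (Chow X 2) [F 2 0, F 2 2]" "direct_sum X (Chow X 3) [F 3 0, F 3 2]"
  "direct_sum X (Chow X 4) [F 4 0, F 4 2, F 4 4]"
  using decomposition by (simp_all add: chow_decomposition_def)

text \<open>\<open>T 1\<close> would be the constituent of weight \<open>s = -2\<close>, and the
  summands have weights 0 and 2.\<close>

lemma T1_Chow2:
  assumes "Z \<in> Chow X 2"
  shows "T 1 Z = czero X"
proof -
  obtain a b where ab: "a \<in> F 2 0" "b \<in> F 2 2" "Z = a +\<^sub>C b"
    using direct_sum_2[OF decompositions(3) F_range assms] .
  then show ?thesis
    using Fourier_components(1)[OF ab(1), of 1] Fourier_components(1)[OF ab(2), of 1]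
      T_linear(1)[OF F_Chow[OF ab(1)] F_Chow[OF ab(2)], of 1] by simp
qed

text \<open>In codimension 4, \<open>T k\<close> sees only the summand of weight
  \<open>2 * k\<close>: \<open>T 0\<close> only \<open>a\<close>, \<open>T 1\<close> only
  \<open>b\<close>. That \<open>l \<cdot> T 1 Z\<close> has degree zero follows because it is a
  multiple of \<open>b\<close>.\<close>

lemma Chow4_transform:
  assumes "Z \<in> Chow X 4"
  shows "T 1 Z \<in> Chow X 2" "T 0 Z \<in> Chow X 0" "T 0 (l \<cdot> T 1 Z) = czero X"
proof -
  obtain a b e where abe: "a \<in> F 4 0" "b \<in> F 4 2" "e \<in> F 4 4" "Z = a +\<^sub>C (b +\<^sub>C e)"
    using direct_sum_3[OF decompositions(5) F_range assms] .
  note ch = F_Chow[OF abe(1)] F_Chow[OF abe(2)] F_Chow[OF abe(3)]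
  have lin: "T k Z = T k a +\<^sub>C (T k b +\<^sub>C T k e)" for k
    unfolding abe(4) using T_linear(1)[OF ch(1) Chow_closed(1)[OF ch(2,3)]] T_linear(1)[OF ch(2,3)] by simp
  note fc = Fourier_components(1)[OF abe(1)] Fourier_components(1)[OF abe(2)] Fourier_components(1)[OF abe(3)]
  have "T 1 Z = T 1 b"
    using lin[of 1] fc(1,3)[of 1] T_range[OF ch(2), of 1] by simp
  have T1b: "T 1 b \<in> Chow X 2"
    using Fourier_components(2)[OF abe(2), of 1] by (simp add: numeral_2_eq_2)
  with \<open>T 1 Z = T 1 b\<close> show T1: "T 1 Z \<in> Chow X 2"
    by simp
  have "T 0 Z = T 0 a"
    using lin[of 0] fc(2,3)[of 0] T_range[OF ch(1), of 0] by simp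
  then show "T 0 Z \<in> Chow X 0"
    using Fourier_components(2)[OF abe(1), of 0] by simp
  have T0b: "T 0 b = czero X" and T2b: "T 2 b = czero X"
    using fc(2)[of 0] fc(2)[of 2] by simp_all
  have lb: "l \<cdot> b = czero X"
    using l_mult(1)[OF ch(2)] by (rule Chow_big) simp
  have r: "l \<cdot> T 1 b \<in> range (cls X)"
    using l_mult(1)[OF T1b] by (rule Chow_range)
  \<comment> \<open>With \<open>T 2 b\<close>, \<open>T 0 b\<close> and \<open>l \<cdot> b\<close>
    all zero, the relation reduces to \<open>2 b = (2/25) (l \<cdot> T 1 b)\<close>.\<close>
  have "l \<cdot> T 1 b = 25 *\<^sub>C b"
  proof (rule cls_eqI[of _ X])
    fix V
    show "coord X (l \<cdot> T 1 b) V = coord X (25 *\<^sub>C b) V"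
      using arg_cong[OF T2[OF ch(2)], of "\<lambda>a. coord X a V"] r Chow_range[OF ch(2)]
      by (simp add: T0b T2b lb l_mult(2)[OF T1b] del: One_nat_def)
  qed (use r Chow_range[OF ch(2)] in simp_all)
  then show "T 0 (l \<cdot> T 1 Z) = czero X"
    using T0b T_scale[OF ch(2), of 0 25] \<open>T 1 Z = T 1 b\<close> cls_eqI[of "25 *\<^sub>C czero X" X "czero X"] by simp
qed

lemma T2_coord:
  assumes Z: "Z \<in> Chow X i"
  shows "coord X (T 2 Z) V = 2 * coord X Z V - (2/25) * (coord X (T 1 (l \<cdot> Z)) V + coord X (T 1 Z \<cdot> l) V)
    - (1/575) * (2 * coord X (T 0 (l \<cdot> (l \<cdot> Z))) V - 23 * coord X (T 0 (l \<cdot> Z) \<cdot> l) V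
      + 2 * coord X ((T 0 Z \<cdot> l) \<cdot> l) V)"
  unfolding T2[OF Z] using T_ranges[OF Z] Chow_range[OF Z] by (simp del: One_nat_def)

lemma H_eigenI:
  assumes Z: "Z \<in> Chow X i"
    and eq: "\<And>V. (4/575) * (coord X ((T 0 Z \<cdot> l) \<cdot> l) V - coord X (T 0 (l \<cdot> (l \<cdot> Z))) V)
      + (2/25) * (coord X (T 1 Z \<cdot> l) V - coord X (T 1 (l \<cdot> Z)) V) = q * coord X Z V"
  shows "corr dot X (H_class dot X 23 L) Z = q *\<^sub>C Z"
proof (rule cls_eqI[of _ X])
  show "corr dot X (H_class dot X 23 L) Z \<in> range (cls X)" "q *\<^sub>C Z \<in> range (cls X)"
    unfolding corr_H[OF Z] using T_ranges[OF Z] Chow_range[OF Z] by (simp_all del: One_nat_def)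
  show "coord X (corr dot X (H_class dot X 23 L) Z) V = coord X (q *\<^sub>C Z) V" for V
    unfolding corr_H[OF Z] using T_ranges[OF Z] Chow_range[OF Z] eq[of V] by (simp del: One_nat_def)
qed

text \<open>For \<open>Z = fund X\<close> this is the degree \<open>r (r + 2)\<close> of
  \<open>l \<cdot> l\<close>. The transform of \<open>Z\<close> is concentrated in codimension 4, so
  \<open>T 2 Z\<close>, of codimension 0, vanishes and the relation becomes
  \<open>2 Z = (2/575) T 0 (l \<cdot> (l \<cdot> Z))\<close>.\<close>

lemma T0_l_l:
  assumes Z: "Z \<in> Chow X 0"
  shows "T 0 (l \<cdot> (l \<cdot> Z)) = 575 *\<^sub>C Z"
proof (rule cls_eqI[of _ X])
  show r: "T 0 (l \<cdot> (l \<cdot> Z)) \<in> range (cls X)" "575 *\<^sub>C Z \<in> range (cls X)"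
    using T_ranges[OF Z] Chow_range[OF Z] by simp_all
  have "Z \<in> F 0 0"
    by (rule direct_sum_1[OF decompositions(1) F_range Z])
  then have T2: "T 2 Z = czero X"
    using Fourier_components(1)[of Z 0 0 2] by simp
  have lZ: "l \<cdot> Z \<in> Chow X 2"
    using l_mult(1)[OF Z] by (simp add: numeral_2_eq_2)
  have "T 1 (l \<cdot> Z) = czero X" "T 1 Z = czero X" "T 0 (l \<cdot> Z) = czero X" "T 0 Z = czero X"
    using T1_Chow2[OF lZ] T_vanishes[OF Z] T_vanishes[OF lZ] by simp_all
  then show "coord X (T 0 (l \<cdot> (l \<cdot> Z))) V = coord X (575 *\<^sub>C Z) V" for V
    using T2_coord[OF Z, of V] T2 Chow_range[OF Z] by (simp del: One_nat_def)
qed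

lemma H_on_F0:
  assumes "Z \<in> F 0 0"
  shows "corr dot X (H_class dot X 23 L) Z = (-4) *\<^sub>C Z"
proof -
  note Z = F_Chow[OF assms]
  have lZ: "l \<cdot> Z \<in> Chow X 2"
    using l_mult(1)[OF Z] by (simp add: numeral_2_eq_2)
  have "T 1 (l \<cdot> Z) = czero X" "T 1 Z = czero X" "T 0 Z = czero X"
    using T1_Chow2[OF lZ] T_vanishes[OF Z] by simp_all
  then show ?thesis
    by (intro H_eigenI[OF Z]) (simp add: T0_l_l[OF Z] Chow_range[OF Z] del: One_nat_def)
qed

lemma H_on_F1:
  assumes "Z \<in> F 1 0"
  shows "corr dot X (H_class dot X 23 L) Z = (-2) *\<^sub>C Z"
proof -
  note Z = F_Chow[OF assms]
  note lZ = l_mult(1)[OF Z]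
  have "l \<cdot> (l \<cdot> Z) = czero X"
    using l_mult(1)[OF lZ] by (rule Chow_big) simp
  then have z: "T 1 Z = czero X" "T 0 Z = czero X" "T 0 (l \<cdot> Z) = czero X" "T 0 (l \<cdot> (l \<cdot> Z)) = czero X"
    using T_vanishes[OF Z] T_vanishes[OF lZ] by simp_all
  have "T 2 Z = czero X"
    using Fourier_components(1)[OF assms, of 2] by simp
  then show ?thesis
    using T2_coord[OF Z] by (intro H_eigenI[OF Z]) (simp add: z del: One_nat_def)
qed

lemma Chow2_zeros:
  assumes Z: "Z \<in> Chow X 2"
  shows "T 1 Z = czero X" "T 0 Z = czero X" "l \<cdot> (l \<cdot> Z) = czero X" "l \<cdot> Z \<in> Chow X 4"
    "T 1 (l \<cdot> Z) \<in> Chow X 2" "T 0 (l \<cdot> Z) \<in> Chow X 0"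
proof -
  show lZ: "l \<cdot> Z \<in> Chow X 4"
    using l_mult(1)[OF Z] by simp
  show "T 1 Z = czero X" "T 0 Z = czero X"
    using T1_Chow2[OF Z] T_vanishes[OF Z] by simp_all
  show "l \<cdot> (l \<cdot> Z) = czero X"
    using l_mult(1)[OF lZ] by (rule Chow_big) simp
  show "T 1 (l \<cdot> Z) \<in> Chow X 2" "T 0 (l \<cdot> Z) \<in> Chow X 0"
    by (rule Chow4_transform[OF lZ])+
qed

lemma T1_l_relations:
  "T 1 (l \<cdot> l) = czero X"
  "Z \<in> Chow X 4 \<Longrightarrow> T 1 (l \<cdot> T 1 Z) = 25 *\<^sub>C T 1 Z"
  using relations by (simp_all add: shen_vial_relations_def Let_def T_def L_pow_numeral del: One_nat_def)

lemma fund_l: "fund X \<cdot> l = l" "l \<cdot> fund X = l"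
  using dot_fund[OF smooth Chow_subset_total[OF l]] dot_commute[OF smooth Chow_subset_total[OF l] fund_total]
  by simp_all

text \<open>Multiplying the relation for \<open>L\<^sup>2\<close> by \<open>l\<close> and taking degrees shows that \<open>l \<cdot> Z\<close> has degree zero.\<close>

lemma H_on_F22:
  assumes "Z \<in> F 2 2"
  shows "corr dot X (H_class dot X 23 L) Z = (-2) *\<^sub>C Z"
proof -
  note Z = F_Chow[OF assms]
  note z = Chow2_zeros[OF Z]
  let ?B = "T 1 (l \<cdot> Z)"
  obtain e where e: "T 0 (l \<cdot> Z) = e *\<^sub>C fund X"
    using Chow_zero_multiple[OF variety dim' z(6)] by blast
  have el: "T 0 (l \<cdot> Z) \<cdot> l = e *\<^sub>C l"
    unfolding e using dot_scale[OF smooth fund_total Chow_subset_total[OF l]] by (simp add: fund_l)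
  have T2Z: "T 2 Z = czero X"
    using Fourier_components(1)[OF assms, of 2] by simp
  note r = Chow_range[OF Z] Chow_range[OF z(5)] Chow_range[OF l]
  \<comment> \<open>\<open>T 2 Z = 0\<close> solved for \<open>Z\<close>; the factor
    \<open>1/50\<close> is half of \<open>23/575\<close>.\<close>
  have Zeq: "Z = (1/25) *\<^sub>C ?B -\<^sub>C (e/50) *\<^sub>C l"
  proof (rule cls_eqI[of _ X])
    show "coord X Z V = coord X ((1/25) *\<^sub>C ?B -\<^sub>C (e/50) *\<^sub>C l) V" for V
      using T2_coord[OF Z, of V] r by (simp add: T2Z z(1-3) el field_simps del: One_nat_def)
  qed (use r in simp_all)
  have t: "?B \<in> Chow_total X" "l \<in> Chow_total X" "(1/25) *\<^sub>C ?B \<in> Chow_total X" "(e/50) *\<^sub>C l \<in> Chow_total X"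
    using z(5) l by (auto intro: Chow_subset_total Chow_total_closed)
  have lZ: "l \<cdot> Z = (1/25) *\<^sub>C (l \<cdot> ?B) -\<^sub>C (e/50) *\<^sub>C (l \<cdot> l)"
    by (subst Zeq) (simp only: dot_right(2)[OF smooth t(2,3,4)] dot_scale_right[OF smooth t(2,1)]
        dot_scale_right[OF smooth t(2,2)])
  have lB: "l \<cdot> ?B \<in> Chow X 4" and ll: "l \<cdot> l \<in> Chow X 4"
    using l_mult(1)[OF z(5)] l_mult(1)[OF l] by simp_all
  from arg_cong[OF lZ, of "T 0"] have "T 0 (l \<cdot> Z) = (1/25) *\<^sub>C T 0 (l \<cdot> ?B) -\<^sub>C (e/50) *\<^sub>C T 0 (l \<cdot> l)"
    by (simp only: T_linear(2)[OF Chow_closed(2)[OF lB] Chow_closed(2)[OF ll]] T_scale[OF lB] T_scale[OF ll])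
  \<comment> \<open>In degrees: \<open>l \<cdot> ?B\<close> contributes 0 by
    \<open>Chow4_transform\<close> and \<open>l \<cdot> l\<close> contributes 575, so
    \<open>e = - (575/50) e\<close> and \<open>e = 0\<close>.\<close>
  then have eq: "e *\<^sub>C fund X = (1/25) *\<^sub>C czero X -\<^sub>C (e/50) *\<^sub>C (575 *\<^sub>C fund X)"
    unfolding e using Chow4_transform(3)[OF z(4)] T0_l_l[OF fund_in_Chow[OF variety]] by (simp add: fund_l)
  have fr: "fund X \<in> range (cls X)"
    using fund_total by simp
  have "e * coord X (fund X) V = 0" for V
    using arg_cong[OF eq, of "\<lambda>a. coord X a V"] fr by (simp add: field_simps)
  then have "T 0 (l \<cdot> Z) = czero X"
    unfolding e by (intro cls_eqI[of _ X]) (use fr in simp_all)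
  then show ?thesis
    using T2_coord[OF Z] by (intro H_eigenI[OF Z]) (simp add: z(1-3) T2Z del: One_nat_def)
qed

text \<open>Applying \<open>L\<^sub>*\<close> to the relation \<open>(L\<^sup>3)\<^sub>* Z = 0\<close> gives \<open>3 L\<^sub>*(l \<cdot> Z) = 0\<close>.\<close>

lemma H_on_F20:
  assumes "Z \<in> F 2 0"
  shows "corr dot X (H_class dot X 23 L) Z = 0 *\<^sub>C Z"
proof -
  note Z = F_Chow[OF assms]
  note z = Chow2_zeros[OF Z]
  let ?B = "T 1 (l \<cdot> Z)"
  obtain e where e: "T 0 (l \<cdot> Z) = e *\<^sub>C fund X"
    using Chow_zero_multiple[OF variety dim' z(6)] by blast
  have el: "T 0 (l \<cdot> Z) \<cdot> l = e *\<^sub>C l"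
    unfolding e using dot_scale[OF smooth fund_total Chow_subset_total[OF l]] by (simp add: fund_l)
  have lt: "l \<in> Chow_total X"
    by (rule Chow_subset_total[OF l])
  have ell: "(e *\<^sub>C l) \<cdot> l = e *\<^sub>C (l \<cdot> l)"
    by (rule dot_scale[OF smooth lt lt])
  have T3Z: "T 3 Z = czero X"
    using Fourier_components(1)[OF assms, of 3] by simp
  note r = Chow_range[OF Z] Chow_range[OF z(5)] Chow_range[OF l]
  have lB: "l \<cdot> ?B \<in> Chow X 4" "?B \<cdot> l = l \<cdot> ?B" and ll: "l \<cdot> l \<in> Chow X 4"
    using l_mult[OF z(5)] l_mult(1)[OF l] by simp_all
  have T2lZ: "T 2 (l \<cdot> Z) = 2 *\<^sub>C (l \<cdot> Z) -\<^sub>C (2/25) *\<^sub>C (l \<cdot> ?B) -\<^sub>C (2 * e / 575) *\<^sub>C (l \<cdot> l)"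
  proof (rule cls_eqI[of _ X])
    show "T 2 (l \<cdot> Z) \<in> range (cls X)"
      by (rule T_range[OF z(4)])
    show "coord X (T 2 (l \<cdot> Z)) V
        = coord X (2 *\<^sub>C (l \<cdot> Z) -\<^sub>C (2/25) *\<^sub>C (l \<cdot> ?B) -\<^sub>C (2 * e / 575) *\<^sub>C (l \<cdot> l)) V" for V
      using T2_coord[OF z(4), of V] Chow_range[OF lB(1)] Chow_range[OF ll] Chow_range[OF z(4)]
      by (simp add: z(3) el ell lB(2) del: One_nat_def)
  qed (use Chow_range[OF lB(1)] Chow_range[OF ll] Chow_range[OF z(4)] in simp)
  have T2Z: "T 2 Z = 2 *\<^sub>C Z -\<^sub>C (2/25) *\<^sub>C ?B +\<^sub>C (e/25) *\<^sub>C l"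
  proof (rule cls_eqI[of _ X])
    show "T 2 Z \<in> range (cls X)"
      by (rule T_range[OF Z])
    show "coord X (T 2 Z) V = coord X (2 *\<^sub>C Z -\<^sub>C (2/25) *\<^sub>C ?B +\<^sub>C (e/25) *\<^sub>C l) V" for V
      using T2_coord[OF Z, of V] r by (simp add: z(1-3) el del: One_nat_def)
  qed (use r in simp)
  have T2Zl: "T 2 Z \<cdot> l = 2 *\<^sub>C (l \<cdot> Z) -\<^sub>C (2/25) *\<^sub>C (l \<cdot> ?B) +\<^sub>C (e/25) *\<^sub>C (l \<cdot> l)"
  proof -
    have t: "Z \<in> Chow_total X" "?B \<in> Chow_total X"
      using Z z(5) by (auto intro: Chow_subset_total)
    show ?thesis
      unfolding T2Z by (simp add: dot_add[OF smooth _ _ lt] dot_right(3)[OF smooth lt] dot_scale[OF smooth _ lt]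
          t lt l_mult(2)[OF Z] lB(2) del: One_nat_def)
  qed
  \<comment> \<open>The terms in \<open>l \<cdot> l\<close> of \<open>T2lZ\<close> and
    \<open>T2Zl\<close> add up to \<open>(1/25 - 2/575) e = (21/575) e\<close>, which
    \<open>T3\<close> multiplies by \<open>- 2/25\<close>. Below, \<open>g\<close> meets
    \<open>T 1 (l \<cdot> l) = 0\<close>.\<close>
  define g where "g = - 42 * e / 14375"
  have "czero X = (42/25) *\<^sub>C (l \<cdot> Z) +\<^sub>C (33/625) *\<^sub>C (l \<cdot> ?B) +\<^sub>C g *\<^sub>C (l \<cdot> l)"
  proof (rule cls_eqI[of _ X])
    show "coord X (czero X) V
        = coord X ((42/25) *\<^sub>C (l \<cdot> Z) +\<^sub>C (33/625) *\<^sub>C (l \<cdot> ?B) +\<^sub>C g *\<^sub>C (l \<cdot> l)) V" for V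
      using arg_cong[OF T3[OF Z], of "\<lambda>a. coord X a V"]
        Chow_range[OF lB(1)] Chow_range[OF ll] Chow_range[OF z(4)]
      by (simp add: T3Z z(1,3) T2lZ T2Zl lB(2) g_def field_simps del: One_nat_def)
  qed (use Chow_range[OF lB(1)] Chow_range[OF ll] Chow_range[OF z(4)] in simp_all)
  from arg_cong[OF this, of "T 1"]
  \<comment> \<open>\<open>T 1\<close> sends \<open>l \<cdot> Z\<close> to \<open>?B\<close> and
    \<open>l \<cdot> ?B\<close> to \<open>25 ?B\<close>; the coefficients add up to
    \<open>42/25 + 33/25 = 3\<close>.\<close>
  have "czero X = (42/25) *\<^sub>C ?B +\<^sub>C (33/625) *\<^sub>C (25 *\<^sub>C ?B) +\<^sub>C g *\<^sub>C czero X"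
    by (simp only: T_linear(1)[OF Chow_closed(1)[OF Chow_closed(2)[OF z(4)] Chow_closed(2)[OF lB(1)]] Chow_closed(2)[OF ll]]
        T_linear(1)[OF Chow_closed(2)[OF z(4)] Chow_closed(2)[OF lB(1)]] T_scale[OF z(4)] T_scale[OF lB(1)]
        T_scale[OF ll] T_czero T1_l_relations(1) T1_l_relations(2)[OF z(4)])
  from arg_cong[OF this, of "\<lambda>a. coord X a V" for V]
  have "coord X ?B V = 0" for V
    using r(2) by simp
  then show ?thesis
    using Chow_range[OF Z] by (intro H_eigenI[OF Z]) (simp add: z(1-3) del: One_nat_def)
qed

lemma H_on_F3:
  assumes "Z \<in> F 3 s"
  shows "s = 0 \<Longrightarrow> corr dot X (H_class dot X 23 L) Z = 2 *\<^sub>C Z"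
    and "s = 2 \<Longrightarrow> corr dot X (H_class dot X 23 L) Z = 0 *\<^sub>C Z"
proof -
  note Z = F_Chow[OF assms]
  have "l \<cdot> Z = czero X"
    using l_mult(1)[OF Z] by (rule Chow_big) simp
  moreover have "T 0 Z = czero X"
    using T_vanishes[OF Z] by simp
  ultimately have z: "l \<cdot> Z = czero X" "T 0 Z = czero X" .
  note fc = Fourier_components(1)[OF assms]
  show "corr dot X (H_class dot X 23 L) Z = 2 *\<^sub>C Z" if "s = 0"
  proof -
    have "T 2 Z = czero X"
      using fc[of 2] that by simp
    then show ?thesis
      using T2_coord[OF Z] by (intro H_eigenI[OF Z]) (simp add: z del: One_nat_def)
  qed
  show "corr dot X (H_class dot X 23 L) Z = 0 *\<^sub>C Z" if "s = 2"
  proof -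
    have "T 1 Z = czero X"
      using fc[of 1] that by simp
    then show ?thesis
      by (intro H_eigenI[OF Z]) (simp add: z del: One_nat_def)
  qed
qed

text \<open>Here \<open>l \<cdot> Z\<close> vanishes for reasons of dimension, and weight
  \<open>s\<close> leaves only \<open>T k\<close> with \<open>k = s/2\<close>. For
  \<open>s = 4\<close> this is \<open>T 2\<close>, while \<open>H\<close> is built from
  \<open>T 0\<close> and \<open>T 1\<close>; for \<open>s = 0\<close> and \<open>s = 2\<close> the
  relation \<open>T 2 Z = 0\<close> evaluates the surviving term.\<close>

lemma H_on_F4:
  assumes "Z \<in> F 4 s"
  shows "s = 0 \<Longrightarrow> corr dot X (H_class dot X 23 L) Z = 4 *\<^sub>C Z"
    and "s = 2 \<Longrightarrow> corr dot X (H_class dot X 23 L) Z = 2 *\<^sub>C Z"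
    and "s = 4 \<Longrightarrow> corr dot X (H_class dot X 23 L) Z = 0 *\<^sub>C Z"
proof -
  note Z = F_Chow[OF assms]
  have z: "l \<cdot> Z = czero X"
    using l_mult(1)[OF Z] by (rule Chow_big) simp
  note fc = Fourier_components(1)[OF assms]
  show "corr dot X (H_class dot X 23 L) Z = 4 *\<^sub>C Z" if "s = 0"
  proof -
    have "T 2 Z = czero X" "T 1 Z = czero X"
      using fc[of 2] fc[of 1] that by simp_all
    then show ?thesis
      using T2_coord[OF Z] by (intro H_eigenI[OF Z]) (simp add: z del: One_nat_def)
  qed
  show "corr dot X (H_class dot X 23 L) Z = 2 *\<^sub>C Z" if "s = 2"
  proof -
    have "T 2 Z = czero X" "T 0 Z = czero X"
      using fc[of 2] fc[of 0] that by simp_all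
    then show ?thesis
      using T2_coord[OF Z] by (intro H_eigenI[OF Z]) (simp add: z del: One_nat_def)
  qed
  show "corr dot X (H_class dot X 23 L) Z = 0 *\<^sub>C Z" if "s = 4"
  proof -
    have "T 1 Z = czero X" "T 0 Z = czero X"
      using fc[of 1] fc[of 0] that by simp_all
    then show ?thesis
      by (intro H_eigenI[OF Z]) (simp add: z del: One_nat_def)
  qed
qed

section \<open>Fourier components as eigenspaces\<close>

lemma H_on_F:
  assumes ij: "(i, s) \<in> {(0, 0), (1, 0), (2, 0), (2, 2), (3, 0), (3, 2), (4, 0), (4, 2), (4, 4)}" and Z: "Z \<in> F i s"
  shows "corr dot X (H_class dot X 23 L) Z = (2 * of_nat i - 4 - of_nat s) *\<^sub>C Z"
  using ij Z H_on_F0[of Z] H_on_F1[of Z] H_on_F20[of Z] H_on_F22[of Z] H_on_F3[of Z] H_on_F4[of Z]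
  by auto

lemma F_closed:
  shows "a \<in> F i s \<Longrightarrow> q *\<^sub>C a \<in> F i s" "czero X \<in> F i s"
proof -
  have E: "exp_class dot X L \<in> Chow_total XX"
    unfolding exp_class_L_pow by (simp only: L_pow_total Chow_total_closed)
  show "q *\<^sub>C a \<in> F i s" if "a \<in> F i s"
    using that corr_scale_right[OF E F_Chow[OF that]] by (simp add: Chow_Fourier_def Chow_closed)
  show "czero X \<in> F i s"
    by (simp add: Chow_Fourier_def Chow_closed corr_czero[OF E])
qed

lemma H_total: "H_class dot X 23 L \<in> Chow_total XX"
  unfolding H_class_def Let_def
  by (intro Chow_total_closed Chow_total_csub square_dot first_total[OF l] second_total[OF l] Chow_subset_total[OF L])

lemma Chow_H_eq_Fourier:
  assumes dsum: "direct_sum X (Chow X i) (map (F i) ss)" and ss: "distinct ss" "s \<in> set ss"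
    and pairs: "\<And>s. s \<in> set ss \<Longrightarrow> (i, s) \<in> {(0, 0), (1, 0), (2, 0), (2, 2), (3, 0), (3, 2), (4, 0), (4, 2), (4, 4)}"
  shows "Chow_H dot X 23 L i s = F i s"
proof
  show "F i s \<subseteq> Chow_H dot X 23 L i s"
    using H_on_F[OF pairs[OF ss(2)]] F_Chow by (auto simp: Chow_H_def)
  show "Chow_H dot X 23 L i s \<subseteq> F i s"
  proof
    fix Z assume "Z \<in> Chow_H dot X 23 L i s"
    then have Z: "Z \<in> Chow X i" "corr dot X (H_class dot X 23 L) Z = (2 * of_nat i - 4 - of_nat s) *\<^sub>C Z"
      by (auto simp: Chow_H_def)
    obtain k where k: "k < length ss" "ss ! k = s"
      using ss(2) by (auto simp: in_set_conv_nth)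
    let ?h = "corr dot X (H_class dot X 23 L)"
    obtain zs where zs: "list_all2 (\<in>) zs (map (F i) ss)" "Z = foldr (+\<^sub>C) zs (czero X)"
      "\<And>j. j < length ss \<Longrightarrow> (2 * of_nat i - 4 - of_nat (ss ! j) :: rat) \<noteq> 2 * of_nat i - 4 - of_nat s \<Longrightarrow> zs ! j = czero X"
    proof (rule direct_sum_eigenspace[OF dsum, where h = ?h and mu = "2 * of_nat i - 4 - of_nat s"
          and ls = "map (\<lambda>s. 2 * of_nat i - 4 - of_nat s) ss" and Z = Z])
      show "?h (a +\<^sub>C b) = ?h a +\<^sub>C ?h b" if "a \<in> Chow X i" "b \<in> Chow X i" for a b
        by (rule corr_right(1)[OF H_total that])
      show "?h (czero X) = czero X"
        by (rule corr_czero[OF H_total])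
      show "?h a = map (\<lambda>s. 2 * of_nat i - 4 - of_nat s) ss ! j *\<^sub>C a"
        if "j < length (map (F i) ss)" "a \<in> map (F i) ss ! j" for j a
        using that H_on_F[OF pairs, of "ss ! j" a] by simp
    qed (use Z Chow_closed Chow_range F_Chow F_closed in auto)
    have len: "length zs = length ss"
      using zs(1) by (auto dest: list_all2_lengthD)
    have zk: "zs ! k \<in> F i s"
      using list_all2_nthD2[OF zs(1), of k] k by simp
    have "zs ! j = czero X" if "j < length zs" "j \<noteq> k" for j
      using zs(3)[of j] that k ss(1) len by (auto simp: nth_eq_iff_index_eq)
    then have "Z = zs ! k"
      using zs(2) zk F_range k(1) len by (simp add: foldr_cadd_single subset_iff)
    with zk show "Z \<in> F i s" by simp
  qed
qed

lemma Chow_H_eq: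
  assumes "(i, s) \<in> {(0, 0), (1, 0), (2, 0), (2, 2), (3, 0), (3, 2), (4, 0), (4, 2), (4, 4)}"
  shows "Chow_H dot X 23 L i s = F i s"
  using assms Chow_H_eq_Fourier[of 0 "[0]" s] Chow_H_eq_Fourier[of 1 "[0]" s] Chow_H_eq_Fourier[of 2 "[0, 2]" s]
    Chow_H_eq_Fourier[of 3 "[0, 2]" s] Chow_H_eq_Fourier[of 4 "[0, 2, 4]" s] decompositions
  by auto

end

theorem theorem1p7:
  fixes dot :: "pt set \<Rightarrow> cls \<Rightarrow> cls \<Rightarrow> cls"
    and X :: "pt set" and L :: cls and r :: nat
  assumes "intersection_theory dot"
    and "shen_vial_theorem dot"
    and "hyperkaehler_K3_2_type X"
    and "r = betti (classical_top X) 2" and "r = 23"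
    and "L \<in> Chow (X \<boxtimes> X) 2" and "lifts_BB_class X L"
    and "shen_vial_relations dot X r L"
  shows "chow_decomposition X (Chow_H dot X r L) \<and>
    (\<forall>(i, s) \<in> {(0, 0), (1, 0), (2, 0), (2, 2), (3, 0), (3, 2), (4, 0), (4, 2), (4, 4)}.
       Chow_H dot X r L i s = Chow_Fourier dot X L i s)"
proof -
  have dec: "chow_decomposition X (Chow_Fourier dot X L)"
    using assms(2-8) unfolding shen_vial_theorem_def by blast
  interpret intersection_theory dot
    by (rule assms(1))
  interpret shen_vial dot X L
    by unfold_locales (use assms dec in \<open>auto simp: hyperkaehler_K3_2_type_def\<close>)
  have eq: "\<forall>(i, s) \<in> {(0, 0), (1, 0), (2, 0), (2, 2), (3, 0), (3, 2), (4, 0), (4, 2), (4, 4)}.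
      Chow_H dot X r L i s = Chow_Fourier dot X L i s"
    unfolding assms(5) using Chow_H_eq by blast
  moreover have "chow_decomposition X (Chow_H dot X r L)"
    using dec eq by (simp add: chow_decomposition_def)
  ultimately show ?thesis
    by blast
qed

end
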